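(* Let $r\geq2$, $m\geq1$. There is an algorithm that, given a FDVA $\mathcal{A}$ in basis $r$ representing a Presburger-definable set $X\subseteq\mathbb{Z}^m$, computes the semi-affine hull direction $\vec{\mathrm{saff}}(X)$ (as the finite list of vector subspaces of $\mathbb{Q}^m$, each given by a basis, whose union it is) in time polynomial in the size of $\mathcal{A}$.
   Context: A set $X\subseteq\mathbb{Z}^m$ is Presburger-definable if it is first-order definable in $\langle\mathbb{Z},+,\leq\rangle$. A semi-affine space is a finite union of affine subspaces of $\mathbb{Q}^m$; $\mathrm{saff}(X)$ is the smallest semi-affine space containing $X$, its affine components are the maximal affine spaces it contains, and $\vec{\mathrm{saff}}(X)$ is the union of the directions of the affine components of $\mathrm{saff}(X)$ (a finite union of vector subspaces). FDVA in basis $r$ (least significant digit first): $\Sigma_{r,m}=\{0,\dots,r-1\}^m$, $S_{r,m}=\{0,r-1\}^m$; for $\sigma=b_1\cdots b_k\in\Sigma_{r,m}^*$, $s\in S_{r,m}$, $\rho_{r,m}(\sigma,s)=\sum_{j=1}^k r^{j-1}b_j+r^k\frac{s}{1-r}$. A FDVA is a finite deterministic automaton $(Q,q_0,\delta:Q\times\Sigma_{r,m}\to Q)$ with a final function $F_0:Q\to2^{S_{r,m}}$; it represents $X$ if for all $\sigma\in\Sigma_{r,m}^*$ and $s\in S_{r,m}$, $\rho_{r,m}(\sigma,s)\in X$ iff $s\in F_0(\delta(q_0,\sigma))$. Its size is that of an explicit listing of its states, transitions and final function. *)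

theory Defs
  imports
    "Jordan_Normal_Form.VS_Connect"
    "HOL-Computational_Algebra.Polynomial"
begin

section \<open>Presburger-definable sets\<close>

datatype pterm = PVar nat | PAdd pterm pterm

datatype pform =
    PEq pterm pterm
  | PLe pterm pterm
  | PNot pform
  | PAnd pform pform
  | PEx nat pform

primrec pterm_val :: "(nat \<Rightarrow> int) \<Rightarrow> pterm \<Rightarrow> int" where
  "pterm_val e (PVar i) = e i"
| "pterm_val e (PAdd s t) = pterm_val e s + pterm_val e t"

primrec pform_sat :: "(nat \<Rightarrow> int) \<Rightarrow> pform \<Rightarrow> bool" where
  "pform_sat e (PEq s t) \<longleftrightarrow> pterm_val e s = pterm_val e t"
| "pform_sat e (PLe s t) \<longleftrightarrow> pterm_val e s \<le> pterm_val e t"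
| "pform_sat e (PNot f) \<longleftrightarrow> \<not> pform_sat e f"
| "pform_sat e (PAnd f g) \<longleftrightarrow> pform_sat e f \<and> pform_sat e g"
| "pform_sat e (PEx x f) \<longleftrightarrow> (\<exists>a. pform_sat (e(x := a)) f)"

primrec pterm_vars :: "pterm \<Rightarrow> nat set" where
  "pterm_vars (PVar i) = {i}"
| "pterm_vars (PAdd s t) = pterm_vars s \<union> pterm_vars t"

primrec pform_free :: "pform \<Rightarrow> nat set" where
  "pform_free (PEq s t) = pterm_vars s \<union> pterm_vars t"
| "pform_free (PLe s t) = pterm_vars s \<union> pterm_vars t"
| "pform_free (PNot f) = pform_free f"
| "pform_free (PAnd f g) = pform_free f \<union> pform_free g"
| "pform_free (PEx x f) = pform_free f - {x}"

definition presburger_definable :: "nat \<Rightarrow> int vec set \<Rightarrow> bool" where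
  "presburger_definable m X \<longleftrightarrow>
     (\<exists>f. pform_free f \<subseteq> {..<m} \<and> X = {v \<in> carrier_vec m. pform_sat (\<lambda>i. v $ i) f})"

section \<open>Semi-affine spaces\<close>

abbreviation Qvec :: "nat \<Rightarrow> (rat, rat vec) module" where
  "Qvec m \<equiv> module_vec TYPE(rat) m"

definition subspace_Q :: "nat \<Rightarrow> rat vec set \<Rightarrow> bool" where
  "subspace_Q m V \<longleftrightarrow> VectorSpace.subspace class_ring V (Qvec m)"

definition span_Q :: "nat \<Rightarrow> rat vec set \<Rightarrow> rat vec set" where
  "span_Q m B = LinearCombinations.module.span class_ring (Qvec m) B"

definition lin_indpt_Q :: "nat \<Rightarrow> rat vec set \<Rightarrow> bool" where
  "lin_indpt_Q m B \<longleftrightarrow> \<not> LinearCombinations.module.lin_dep class_ring (Qvec m) B"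

text \<open>Affine subspaces are non-empty by convention; the empty set is still a semi-affine space,
  being the empty union, and it has no affine component.\<close>

definition affine_space :: "nat \<Rightarrow> rat vec set \<Rightarrow> bool" where
  "affine_space m A \<longleftrightarrow> (\<exists>a \<in> carrier_vec m. \<exists>V. subspace_Q m V \<and> A = {a + v | v. v \<in> V})"

definition semi_affine_space :: "nat \<Rightarrow> rat vec set \<Rightarrow> bool" where
  "semi_affine_space m S \<longleftrightarrow> (\<exists>F. finite F \<and> (\<forall>A \<in> F. affine_space m A) \<and> S = \<Union> F)"

definition saff :: "nat \<Rightarrow> rat vec set \<Rightarrow> rat vec set" where
  "saff m X = (LEAST S. semi_affine_space m S \<and> X \<subseteq> S)"

definition affine_components :: "nat \<Rightarrow> rat vec set \<Rightarrow> rat vec set set" where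
  "affine_components m S =
     {A. affine_space m A \<and> A \<subseteq> S \<and> (\<forall>B. affine_space m B \<and> A \<subseteq> B \<and> B \<subseteq> S \<longrightarrow> B = A)}"

text \<open>For $A = a + V$ this is the vector space $V$.\<close>

definition direction :: "rat vec set \<Rightarrow> rat vec set" where
  "direction A = {x - y | x y. x \<in> A \<and> y \<in> A}"

definition saff_direction :: "nat \<Rightarrow> rat vec set \<Rightarrow> rat vec set" where
  "saff_direction m X = (\<Union>A \<in> affine_components m (saff m X). direction A)"

definition rat_points :: "int vec set \<Rightarrow> rat vec set" where
  "rat_points X = map_vec rat_of_int ` X"

section \<open>Finite digit vector automata\<close>

definition digit_vectors :: "nat \<Rightarrow> nat \<Rightarrow> nat list set" where
  "digit_vectors r m = {b. length b = m \<and> set b \<subseteq> {0..r - 1}}"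

definition sign_vectors :: "nat \<Rightarrow> nat \<Rightarrow> nat list set" where
  "sign_vectors r m = {s. length s = m \<and> set s \<subseteq> {0, r - 1}}"

definition rho :: "nat \<Rightarrow> nat \<Rightarrow> nat list list \<Rightarrow> nat list \<Rightarrow> rat vec" where
  "rho r m w s = vec m (\<lambda>i.
     (\<Sum>j<length w. of_nat r ^ j * of_nat (w ! j ! i))
       + of_nat r ^ length w * (of_nat (s ! i) / (1 - of_nat r)))"

text \<open>An automaton is given by its explicit listing: its states (named by numbers), the graph of
  its transition function, and the graph of its final function, a set of sign vectors being listed
  by its elements. The order of the entries is arbitrary.\<close>

record fdva =
  states :: "nat list"
  start :: nat
  transitions :: "((nat \<times> nat list) \<times> nat) list"
  finals :: "(nat \<times> nat list list) list"

definition wf_fdva :: "nat \<Rightarrow> nat \<Rightarrow> fdva \<Rightarrow> bool" where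
  "wf_fdva r m A \<longleftrightarrow>
     distinct (states A) \<and> start A \<in> set (states A) \<and>
     distinct (map fst (transitions A)) \<and>
     fst ` set (transitions A) = set (states A) \<times> digit_vectors r m \<and>
     snd ` set (transitions A) \<subseteq> set (states A) \<and>
     distinct (map fst (finals A)) \<and>
     fst ` set (finals A) = set (states A) \<and>
     (\<forall>(q, ss) \<in> set (finals A). distinct ss \<and> set ss \<subseteq> sign_vectors r m)"

definition delta :: "fdva \<Rightarrow> nat \<Rightarrow> nat list \<Rightarrow> nat" where
  "delta A q b = the (map_of (transitions A) (q, b))"

definition final_fun :: "fdva \<Rightarrow> nat \<Rightarrow> nat list set" where
  "final_fun A q = set (the (map_of (finals A) q))"

definition represents :: "nat \<Rightarrow> nat \<Rightarrow> fdva \<Rightarrow> int vec set \<Rightarrow> bool" where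
  "represents r m A X \<longleftrightarrow>
     (\<forall>w \<in> lists (digit_vectors r m). \<forall>s \<in> sign_vectors r m.
        rho r m w s \<in> rat_points X \<longleftrightarrow> s \<in> final_fun A (foldl (delta A) (start A) w))"

section \<open>Algorithms and their running time\<close>

text \<open>The machine model is a first-order functional language over binary trees: a program is a
  finite list of function bodies that may call each other recursively, and its entry point is
  function 0. Evaluating an expression costs the costs of the subexpressions evaluated, plus the
  number of cells of the value returned (its datatype size), plus 1. Values are thus charged as if copied in
  full (no sharing): the running time bounds the number of steps, the size of every value and
  hence the total memory, so that, up to a polynomial, it is the running time of a Turing
  machine.\<close>

datatype data = Nul | Cell (car: data) (cdr: data)
  where
    "car Nul = Nul"
  | "cdr Nul = Nul"

datatype expr =
    Param nat
  | NulE
  | CellE expr expr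
  | CarE expr
  | CdrE expr
  | IfE expr expr expr
  | CallE nat "expr list"

type_synonym program = "expr list"

inductive eval :: "program \<Rightarrow> data list \<Rightarrow> expr \<Rightarrow> data \<Rightarrow> nat \<Rightarrow> bool"
  and evals :: "program \<Rightarrow> data list \<Rightarrow> expr list \<Rightarrow> data list \<Rightarrow> nat \<Rightarrow> bool"
  for P :: program
where
  Param: "i < length env \<Longrightarrow> eval P env (Param i) (env ! i) (size (env ! i) + 1)"
| NulE: "eval P env NulE Nul 1"
| CellE: "eval P env a x s \<Longrightarrow> eval P env b y t
    \<Longrightarrow> eval P env (CellE a b) (Cell x y) (s + t + size (Cell x y) + 1)"
| CarE: "eval P env a x s \<Longrightarrow> eval P env (CarE a) (car x) (s + size (car x) + 1)"
| CdrE: "eval P env a x s \<Longrightarrow> eval P env (CdrE a) (cdr x) (s + size (cdr x) + 1)"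
| IfE_true: "eval P env c x s \<Longrightarrow> x \<noteq> Nul \<Longrightarrow> eval P env a v t
    \<Longrightarrow> eval P env (IfE c a b) v (s + t + size v + 1)"
| IfE_false: "eval P env c Nul s \<Longrightarrow> eval P env b v t
    \<Longrightarrow> eval P env (IfE c a b) v (s + t + size v + 1)"
| CallE: "evals P env as xs s \<Longrightarrow> f < length P \<Longrightarrow> eval P xs (P ! f) v t
    \<Longrightarrow> eval P env (CallE f as) v (s + t + size v + 1)"
| evals_Nil: "evals P env [] [] 0"
| evals_Cons: "eval P env a x s \<Longrightarrow> evals P env as xs t
    \<Longrightarrow> evals P env (a # as) (x # xs) (s + t)"

lemma eval_deterministic:
  "eval P env e v t \<Longrightarrow> eval P env e v' t' \<Longrightarrow> v = v' \<and> t = t'"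
  "evals P env es vs t \<Longrightarrow> evals P env es vs' t' \<Longrightarrow> vs = vs' \<and> t = t'"
proof (induction arbitrary: v' t' and vs' t' rule: eval_evals.inducts)
  case (Param i env)
  from Param.prems show ?case by cases auto
next
  case (NulE env)
  from NulE.prems show ?case by cases auto
next
  case (CellE env a x s b y t)
  from CellE.prems show ?case by cases (use CellE.IH in blast)
next
  case (CarE env a x s)
  from CarE.prems show ?case by cases (use CarE.IH in blast)
next
  case (CdrE env a x s)
  from CdrE.prems show ?case by cases (use CdrE.IH in blast)
next
  case (IfE_true env c x s a v t b)
  from IfE_true.prems show ?case by cases (use IfE_true.IH IfE_true.hyps in blast)+
next
  case (IfE_false env c s b v t a)
  from IfE_false.prems show ?case by cases (use IfE_false.IH in blast)+
next
  case (CallE env as xs s f v t)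
  from CallE.prems show ?case by cases (use CallE.IH in blast)
next
  case (evals_Nil env)
  from evals_Nil.prems show ?case by cases auto
next
  case (evals_Cons env a x s as xs t)
  from evals_Cons.prems show ?case by cases (use evals_Cons.IH in blast)
qed

definition computes_in_time :: "program \<Rightarrow> data \<Rightarrow> data \<Rightarrow> nat \<Rightarrow> bool" where
  "computes_in_time P x y t \<longleftrightarrow> eval P [x] (CallE 0 [Param 0]) y t"

section \<open>Encodings\<close>

definition enc_pair :: "('a \<Rightarrow> data) \<Rightarrow> ('b \<Rightarrow> data) \<Rightarrow> 'a \<times> 'b \<Rightarrow> data" where
  "enc_pair f g p = Cell (f (fst p)) (g (snd p))"

definition enc_list :: "('a \<Rightarrow> data) \<Rightarrow> 'a list \<Rightarrow> data" where
  "enc_list f xs = foldr (\<lambda>x. Cell (f x)) xs Nul"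

definition enc_bool :: "bool \<Rightarrow> data" where
  "enc_bool b = (if b then Cell Nul Nul else Nul)"

text \<open>Numbers are written in binary, least significant bit first.\<close>

fun enc_nat :: "nat \<Rightarrow> data" where
  "enc_nat n = (if n = 0 then Nul else Cell (enc_bool (odd n)) (enc_nat (n div 2)))"

declare enc_nat.simps [simp del]

definition enc_int :: "int \<Rightarrow> data" where
  "enc_int k = Cell (enc_bool (k < 0)) (enc_nat (nat \<bar>k\<bar>))"

definition enc_rat :: "rat \<Rightarrow> data" where
  "enc_rat q = enc_pair enc_int enc_int (quotient_of q)"

definition enc_fdva :: "fdva \<Rightarrow> data" where
  "enc_fdva A =
     Cell (enc_list enc_nat (states A))
    (Cell (enc_nat (start A))
    (Cell (enc_list (enc_pair (enc_pair enc_nat (enc_list enc_nat)) enc_nat) (transitions A))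
          (enc_list (enc_pair enc_nat (enc_list (enc_list enc_nat))) (finals A))))"

definition fdva_size :: "fdva \<Rightarrow> nat" where
  "fdva_size A = size (enc_fdva A)"

definition enc_bases :: "rat vec list list \<Rightarrow> data" where
  "enc_bases Bs = enc_list (enc_list (\<lambda>v. enc_list enc_rat (list_of_vec v))) Bs"

definition union_of_subspaces_with_bases :: "nat \<Rightarrow> rat vec list list \<Rightarrow> rat vec set \<Rightarrow> bool" where
  "union_of_subspaces_with_bases m Bs D \<longleftrightarrow>
     (\<forall>B \<in> set Bs. distinct B \<and> set B \<subseteq> carrier_vec m \<and> lin_indpt_Q m (set B)) \<and>
     D = (\<Union>B \<in> set Bs. span_Q m (set B))"

end

theory Submission
  imports Defs "HOL-Decision_Procs.Cooper"
begin

text \<open>For a state \<open>q\<close> let \<open>V q\<close> be spanned by the differences of the values of two loops at \<open>q\<close> of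
  the same length. The hull direction is the union of the \<open>V q\<close> over the states \<open>q\<close> that are
  reachable and from which a sign vector can be accepted.

  By quantifier elimination and Dickson's lemma, \<open>X\<close> is a finite union of sets \<open>x + K\<close> with \<open>K\<close> a
  submonoid of the integer vectors, and the hull direction is the union of the spans of the \<open>K\<close>. If
  \<open>x + K\<close> lies in \<open>X\<close>, let the automaton read sums of elements of a finite spanning set of
  \<open>K\<close>, one summand per digit position: the carries stay bounded, so there is a recurrent pair of a
  carry and a state \<open>q\<close>, and its loops show that the span of \<open>K\<close> lies in \<open>V q\<close>. Conversely, \<open>k\<close>-fold
  products of two loops of equal length put many points on a line into \<open>X\<close>, so that by the pigeonhole
  principle one affine component contains all directions of \<open>V q\<close>.

  The space \<open>V q\<close> is already spanned by the differences of the values of \<open>w w'\<close> and \<open>w' w\<close>, where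
  \<open>w\<close> and \<open>w'\<close> are loops composed of a chosen path from \<open>q\<close>, at most one edge, and a chosen
  path back. Cross-multiplying elimination, one coordinate at a time, extracts a basis; since the dimension is
  fixed, repeatedly doubling the lengths of the numbers is harmless. The polynomial running time follows from
  closure properties of the functions on encoded data that the machine computes in polynomial time.\<close>

text \<open>Loops of equal length are compared because they multiply the rest of the word by the
  same factor, so only the difference of their values survives. Checking all such pairs would
  involve loops of unbounded length. The words \<open>w w'\<close> and \<open>w' w\<close> have
  equal length whatever the lengths of \<open>w\<close> and \<open>w'\<close>, so pairs of short
  loops suffice, and each state has only quadratically many of them.

  Both inclusions rest on the irreducibility of affine spaces over the infinite field of rationals:
  if finitely many affine spaces cover a sufficiently branching tree of points, one of them contains
  the root and has all the branch vectors among its directions.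

  In the complexity argument the danger is iteration, since repeating a harmless step along the
  input can make values exponentially long. Elimination multiplies its numbers and violates this,
  but \<open>m\<close> is fixed: its recursion is unrolled into the program, and only a constant
  number of polynomials is composed.\<close>

hide_const (open) Cooper.T Cooper.F Cooper.E Cooper.A Cooper.C

section \<open>Typed encodings\<close>

text \<open>Injectivity lets equality of typed values be decided by comparing trees.\<close>

class encodable =
  fixes encode :: "'a \<Rightarrow> data"
  assumes enc_inj: "encode x = encode y \<Longrightarrow> x = y"

lemma enc_eq_iff [simp]: "encode x = encode y \<longleftrightarrow> x = y"
  using enc_inj by blast

lemma enc_nat_0 [simp]: "enc_nat 0 = Nul"
  by (simp add: enc_nat.simps)

lemma enc_nat_pos: "n > 0 \<Longrightarrow> enc_nat n = Cell (enc_bool (odd n)) (enc_nat (n div 2))"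
  by (subst enc_nat.simps) simp

lemma enc_bool_eq_iff [simp]: "enc_bool a = enc_bool b \<longleftrightarrow> a = b"
  by (auto simp: enc_bool_def)

lemma enc_nat_inj: "enc_nat a = enc_nat b \<Longrightarrow> a = b"
proof (induction a arbitrary: b rule: less_induct)
  case (less a)
  show ?case
  proof (cases "a = 0 \<or> b = 0")
    case True
    with less.prems show ?thesis
      by (metis data.distinct(1) enc_nat.simps)
  next
    case False
    with less.prems have "odd a = odd b" "enc_nat (a div 2) = enc_nat (b div 2)"
      by (simp_all add: enc_nat_pos)
    moreover have "a div 2 < a" using False by simp
    ultimately have "odd a = odd b" "a div 2 = b div 2"
      using less.IH by blast+
    thus ?thesis by (metis odd_two_times_div_two_succ even_two_times_div_two)
  qed
qed

instantiation bool :: encodable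
begin
definition "encode = enc_bool"
instance by standard (simp add: encode_bool_def)
end

instantiation nat :: encodable
begin
definition "encode = enc_nat"
instance by standard (simp add: encode_nat_def enc_nat_inj)
end

instantiation int :: encodable
begin
definition "encode = enc_int"
instance
proof
  fix x y :: int
  assume "encode x = encode y"
  hence "(x < 0) = (y < 0)" "nat \<bar>x\<bar> = nat \<bar>y\<bar>"
    using enc_nat_inj by (auto simp: encode_int_def enc_int_def)
  thus "x = y" by linarith
qed
end

instantiation prod :: (encodable, encodable) encodable
begin
definition "encode = enc_pair encode encode"
instance by standard (auto simp: encode_prod_def enc_pair_def prod_eq_iff)
end

instantiation list :: (encodable) encodable
begin
definition "encode = enc_list encode"
instance
proof
  fix x y :: "'a list"
  show "encode x = encode y \<Longrightarrow> x = y"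
  proof (induction x arbitrary: y)
    case Nil thus ?case by (cases y) (auto simp: encode_list_def enc_list_def)
  next
    case (Cons a x) thus ?case by (cases y) (auto simp: encode_list_def enc_list_def)
  qed
qed
end

lemmas enc_defs = encode_bool_def encode_nat_def encode_int_def
  encode_list_def encode_prod_def

lemma enc_Pair [simp]: "encode (a, b) = Cell (encode a) (encode b)"
  by (simp add: encode_prod_def enc_pair_def)

lemma enc_Nil [simp]: "encode [] = Nul"
  by (simp add: enc_defs enc_list_def)

lemma enc_Cons [simp]: "encode (a # l) = Cell (encode a) (encode l)"
  by (simp add: enc_defs enc_list_def)

lemma enc_True [simp]: "encode True = Cell Nul Nul"
  and enc_False [simp]: "encode False = Nul"
  by (simp_all add: enc_defs enc_bool_def)

lemma enc_0 [simp]: "encode (0::nat) = Nul"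
  by (simp add: enc_defs)

lemma enc_nat_pos': "n > 0 \<Longrightarrow> encode (n::nat) = Cell (encode (odd n)) (encode (n div 2))"
  by (simp add: enc_defs enc_nat_pos)

lemma enc_int_eq: "encode (k::int) = Cell (encode (k < 0)) (encode (nat \<bar>k\<bar>))"
  by (simp add: enc_defs enc_int_def)

lemma enc_eq_Nul_simps [simp]:
  "encode (b::bool) = Nul \<longleftrightarrow> \<not> b" "encode (n::nat) = Nul \<longleftrightarrow> n = 0" "encode (l::'a::encodable list) = Nul \<longleftrightarrow> l = []"
  by (cases b; simp) (metis enc_0 enc_eq_iff, metis enc_Nil enc_eq_iff)

abbreviation esz :: "'a::encodable \<Rightarrow> nat" where "esz x \<equiv> size (encode x)"

section \<open>Linking programs\<close>

text \<open>Functions are called by their position in the program, so a program placed behind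
  \<open>k\<close> other bodies must have its calls shifted by \<open>k\<close>.\<close>

fun shiftE :: "nat \<Rightarrow> expr \<Rightarrow> expr" where
  "shiftE k (Param i) = Param i"
| "shiftE k NulE = NulE"
| "shiftE k (CellE a b) = CellE (shiftE k a) (shiftE k b)"
| "shiftE k (CarE a) = CarE (shiftE k a)"
| "shiftE k (CdrE a) = CdrE (shiftE k a)"
| "shiftE k (IfE a b c) = IfE (shiftE k a) (shiftE k b) (shiftE k c)"
| "shiftE k (CallE f as) = CallE (f + k) (map (shiftE k) as)"

lemma eval_shift:
  "eval P env e v t \<Longrightarrow> length Q = k \<Longrightarrow> eval (Q @ map (shiftE k) P @ R) env (shiftE k e) v t"
  "evals P env es vs t \<Longrightarrow> length Q = k \<Longrightarrow>
     evals (Q @ map (shiftE k) P @ R) env (map (shiftE k) es) vs t"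
proof (induction rule: eval_evals.inducts)
  case (CallE env as xs s f v t)
  hence "(Q @ map (shiftE k) P @ R) ! (f + k) = shiftE k (P ! f)"
    by (simp add: nth_append)
  moreover have "f + k < length (Q @ map (shiftE k) P @ R)" using CallE by simp
  ultimately show ?case using CallE by (metis eval_evals.CallE shiftE.simps(7))
qed (simp only: shiftE.simps list.map, blast intro: eval_evals.intros)+

lemma shiftE_0 [simp]: "shiftE 0 e = e"
  by (induction "0::nat" e rule: shiftE.induct) (auto simp: map_idI)

lemma map_shiftE_0 [simp]: "map (shiftE 0) es = es"
  by (simp add: map_idI)

text \<open>Costs are kept as upper bounds, so that they can be rounded up to a polynomial at each
  composition.\<close>

definition ev :: "program \<Rightarrow> data list \<Rightarrow> expr \<Rightarrow> data \<Rightarrow> nat \<Rightarrow> bool" where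
  "ev P env e v b \<longleftrightarrow> (\<exists>t\<le>b. eval P env e v t)"

lemma ev_shift: "ev P env e v t \<Longrightarrow> length Q = k \<Longrightarrow> ev (Q @ map (shiftE k) P @ R) env (shiftE k e) v t"
  using eval_shift(1) unfolding ev_def by blast

lemma ev_append: "ev P env e v t \<Longrightarrow> ev (P @ R) env e v t"
  using ev_shift[of P env e v t "[]" 0 R] by simp

lemma ev_mono: "ev P env e v b \<Longrightarrow> b \<le> b' \<Longrightarrow> ev P env e v b'"
  unfolding ev_def using le_trans by blast

lemma ev_Param: "ev P [z] (Param 0) z (size z + 1)"
  unfolding ev_def using eval_evals.Param[of 0 "[z]" P] by auto

lemma ev_NulE: "ev P env NulE Nul 1"
  unfolding ev_def using eval_evals.NulE by blast

lemma ev_CellE: "ev P env a x s \<Longrightarrow> ev P env b y t \<Longrightarrow> ev P env (CellE a b) (Cell x y) (s + t + size (Cell x y) + 1)"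
  unfolding ev_def using eval_evals.CellE[of P env a x _ b y] by (meson add_le_mono le_refl)

lemma ev_CarE: "ev P env a x s \<Longrightarrow> ev P env (CarE a) (car x) (s + size (car x) + 1)"
  unfolding ev_def using eval_evals.CarE[of P env a x] by (meson add_le_mono le_refl)

lemma ev_CdrE: "ev P env a x s \<Longrightarrow> ev P env (CdrE a) (cdr x) (s + size (cdr x) + 1)"
  unfolding ev_def using eval_evals.CdrE[of P env a x] by (meson add_le_mono le_refl)

lemma ev_IfE:
  assumes "ev P env c x s" "ev P env (if x \<noteq> Nul then a else b) v t"
  shows "ev P env (IfE c a b) v (s + t + size v + 1)"
proof -
  from assms obtain s' t' where st: "s' \<le> s" "t' \<le> t" "eval P env c x s'"
    "eval P env (if x \<noteq> Nul then a else b) v t'"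
    unfolding ev_def by blast
  hence "eval P env (IfE c a b) v (s' + t' + size v + 1)"
    by (cases "x = Nul") (simp_all only: not_True_eq_False not_False_eq_True if_True if_False refl eval_evals.IfE_true eval_evals.IfE_false)
  thus ?thesis unfolding ev_def using st(1,2) by (intro exI[of _ "s' + t' + size v + 1"]) simp
qed

lemma ev_Call1:
  assumes "ev P env a x s" "f < length P" "ev P [x] (P ! f) v t"
  shows "ev P env (CallE f [a]) v (s + t + size v + 1)"
proof -
  from assms obtain s' t' where st: "s' \<le> s" "t' \<le> t" "eval P env a x s'" "eval P [x] (P ! f) v t'"
    unfolding ev_def by auto
  have "evals P env [a] [x] (s' + 0)"
    by (intro eval_evals.intros st)
  from eval_evals.CallE[OF this assms(2) st(4)] show ?thesis
    unfolding ev_def using st(1,2) by (intro exI[of _ "s' + 0 + t' + size v + 1"]) auto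
qed

text \<open>Every evaluation rule charges the size of the value it returns. A time bound is
  therefore also a bound on the size of the output, which is what makes composition work.\<close>

lemma size_ev: "eval P env e v t \<Longrightarrow> size v < t" "evals P env es vs t \<Longrightarrow> True"
  by (induction rule: eval_evals.inducts) auto

section \<open>Functions computable in polynomial time\<close>

lemma poly_nat_mono: "x \<le> y \<Longrightarrow> poly (p :: nat poly) x \<le> poly p y"
  by (induction p) (auto intro!: add_mono mult_mono)

text \<open>The expression \<open>e\<close> sees a single parameter; several arguments are passed as
  nested pairs. The bound covers all values of the input type, including those that do not describe
  an automaton.\<close>

definition fp :: "('a::encodable \<Rightarrow> 'b::encodable) \<Rightarrow> bool" where
  "fp f \<longleftrightarrow> (\<exists>P e p. \<forall>a. ev P [encode a] e (encode (f a)) (poly p (esz a)))"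

lemma fpI: "(\<And>a. ev P [encode a] e (encode (f a)) (poly p (esz a))) \<Longrightarrow> fp f"
  unfolding fp_def by blast

lemma fp_computes:
  assumes "fp f"
  obtains P p where "\<And>a. \<exists>t. computes_in_time P (encode a) (encode (f a)) t \<and> t \<le> poly p (esz a)"
proof -
  from assms obtain P e p where *: "\<And>a. ev P [encode a] e (encode (f a)) (poly p (esz a))"
    unfolding fp_def by blast
  \<comment> \<open>\<open>e\<close> becomes the entry function 0 and the other bodies move up by
    one. Calling it adds the sizes of the argument and of the result to the cost.\<close>
  let ?P = "[shiftE 1 e] @ map (shiftE 1) P @ []"
  let ?p = "[:0, 1:] + p + p + [:2:] :: nat poly"
  have "\<exists>t. computes_in_time ?P (encode a) (encode (f a)) t \<and> t \<le> poly ?p (esz a)" for a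
  proof -
    from * obtain t where t: "t \<le> poly p (esz a)" "eval P [encode a] e (encode (f a)) t"
      unfolding ev_def by blast
    have "eval ?P [encode a] (shiftE 1 e) (encode (f a)) t"
      by (rule eval_shift(1)[OF t(2)]) simp
    hence "ev ?P [encode a] (CallE 0 [Param 0]) (encode (f a)) ((esz a + 1) + t + esz (f a) + 1)"
      by (intro ev_Call1[OF ev_Param]) (use ev_def in auto)
    then obtain t' where "t' \<le> (esz a + 1) + t + esz (f a) + 1" "computes_in_time ?P (encode a) (encode (f a)) t'"
      unfolding ev_def computes_in_time_def by blast
    thus ?thesis using t size_ev(1)[OF t(2)] by (intro exI[of _ t']) auto
  qed
  thus thesis using that by blast
qed

lemma fp_size:
  assumes "fp f"
  obtains p where "\<And>a. esz (f a) \<le> poly p (esz a)"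
proof -
  from assms obtain P e p where *: "\<And>a. ev P [encode a] e (encode (f a)) (poly p (esz a))"
    unfolding fp_def by blast
  hence "esz (f a) \<le> poly p (esz a)" for a
    by (metis ev_def le_trans less_imp_le size_ev(1))
  thus thesis using that by blast
qed

text \<open>Both expressions run over one concatenated program. The arbitrary suffix
  \<open>R\<close> leaves room for bodies that use them.\<close>

lemma fp_link2:
  fixes f :: "'a::encodable \<Rightarrow> 'b::encodable" and g :: "'c::encodable \<Rightarrow> 'd::encodable"
  assumes "fp f" "fp g"
  obtains P e1 e2 p where "\<And>a R. ev (P @ R) [encode a] e1 (encode (f a)) (poly p (esz a))"
    "\<And>a R. ev (P @ R) [encode a] e2 (encode (g a)) (poly p (esz a))"
proof -
  obtain P1 e1 p1 where 1: "\<And>a. ev P1 [encode a] e1 (encode (f a)) (poly p1 (esz a))"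
    using assms(1) unfolding fp_def by blast
  obtain P2 e2 p2 where 2: "\<And>a. ev P2 [encode a] e2 (encode (g a)) (poly p2 (esz a))"
    using assms(2) unfolding fp_def by blast
  let ?P = "P1 @ map (shiftE (length P1)) P2"
  have "ev (?P @ R) [encode a] e1 (encode (f a)) (poly (p1 + p2) (esz a))" for a R
    unfolding append_assoc by (rule ev_mono[OF ev_append[OF 1]]) simp
  moreover have "ev (?P @ R) [encode a] (shiftE (length P1) e2) (encode (g a)) (poly (p1 + p2) (esz a))" for a R
    unfolding append_assoc by (rule ev_mono[OF ev_shift[OF 2]]) simp_all
  ultimately show thesis using that by blast
qed

lemma fp_ident: "fp (\<lambda>x. x)"
  by (rule fpI[of "[]" "Param 0" _ "[:1, 1:]"]) (use ev_Param in auto)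

text \<open>The machine sees only trees. This is how a value is reread at another type: a pair as a
  nonempty list, a bit list as a number, a sign with a magnitude as an integer.\<close>

lemma fp_cong_enc:
  assumes "fp f" "\<And>a. encode (g a) = encode (f a)"
  shows "fp g"
  using assms unfolding fp_def by simp

primrec const_expr :: "data \<Rightarrow> expr" where
  "const_expr Nul = NulE"
| "const_expr (Cell a b) = CellE (const_expr a) (const_expr b)"

lemma fp_const: "fp (\<lambda>_. c)"
proof -
  have "\<exists>t. \<forall>env. ev [] env (const_expr d) d t" for d
  proof (induction d)
    case Nul show ?case using ev_NulE by auto
  next
    case (Cell a b) thus ?case by (auto intro: ev_CellE)
  qed
  then obtain t where "\<And>env. ev [] env (const_expr (encode c)) (encode c) t" by blast
  thus ?thesis by (intro fpI[of "[]" "const_expr (encode c)" _ "[:t:]"]) simp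
qed

text \<open>The cost of \<open>f\<close> is measured in the size of \<open>g x\<close>, which is
  polynomial in the size of \<open>x\<close> by \<open>fp_size\<close>. The code of \<open>g\<close>
  is inlined and \<open>f\<close> becomes a new function.\<close>

lemma fp_comp:
  fixes f :: "'a::encodable \<Rightarrow> 'b::encodable" and g :: "'c::encodable \<Rightarrow> 'a"
  assumes "fp f" "fp g"
  shows "fp (\<lambda>x. f (g x))"
proof -
  obtain P ef eg p where f: "\<And>a R. ev (P @ R) [encode a] ef (encode (f a)) (poly p (esz a))"
    and g: "\<And>a R. ev (P @ R) [encode a] eg (encode (g a)) (poly p (esz a))"
    using fp_link2[OF assms] by metis
  obtain s where s: "\<And>a. esz (f a) \<le> poly s (esz a)" using fp_size[OF assms(1)] by blast
  obtain s' where s': "\<And>a. esz (g a) \<le> poly s' (esz a)" using fp_size[OF assms(2)] by blast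
  show ?thesis
  proof (rule fpI[of "P @ [ef]" "CallE (length P) [eg]" _ "p + pcompose p s' + pcompose s s' + 1"])
    fix x
    have "ev (P @ [ef]) [encode x] (CallE (length P) [eg]) (encode (f (g x)))
      (poly p (esz x) + poly p (esz (g x)) + esz (f (g x)) + 1)"
      by (rule ev_Call1[OF g]) (simp_all add: f)
    moreover have "poly p (esz (g x)) \<le> poly p (poly s' (esz x))"
      by (intro poly_nat_mono s')
    moreover have "esz (f (g x)) \<le> poly s (poly s' (esz x))"
      using s[of "g x"] poly_nat_mono[OF s', of s x] le_trans by blast
    ultimately show "ev (P @ [ef]) [encode x] (CallE (length P) [eg]) (encode (f (g x)))
      (poly (p + pcompose p s' + pcompose s s' + 1) (esz x))"
      by (elim ev_mono) (simp add: poly_pcompose)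
  qed
qed

lemma fp_Pair:
  assumes "fp f" "fp g"
  shows "fp (\<lambda>x. (f x, g x))"
proof -
  obtain P e1 e2 p where f: "\<And>a R. ev (P @ R) [encode a] e1 (encode (f a)) (poly p (esz a))"
    and g: "\<And>a R. ev (P @ R) [encode a] e2 (encode (g a)) (poly p (esz a))"
    using fp_link2[OF assms] by metis
  obtain s where s: "\<And>a. esz (f a) \<le> poly s (esz a)" using fp_size[OF assms(1)] by blast
  obtain s' where s': "\<And>a. esz (g a) \<le> poly s' (esz a)" using fp_size[OF assms(2)] by blast
  have "ev P [encode x] (CellE e1 e2) (encode (f x, g x)) (poly (p + p + s + s' + [:2:]) (esz x))" for x
    using ev_CellE[OF f[of "[]" x] g[of "[]" x]] s[of x] s'[of x]
    by (auto elim!: ev_mono)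
  thus ?thesis by (rule fpI)
qed

lemma fp_fst': "fp fst"
proof (rule fpI[of "[]" "CarE (Param 0)" _ "[:2, 2:]"])
  fix a :: "'a \<times> 'b"
  show "ev [] [encode a] (CarE (Param 0)) (encode (fst a)) (poly [:2, 2:] (esz a))"
    using ev_CarE[OF ev_Param[of "[]" "encode a"]] by (cases a) (auto elim!: ev_mono)
qed

lemma fp_snd': "fp snd"
proof (rule fpI[of "[]" "CdrE (Param 0)" _ "[:2, 2:]"])
  fix a :: "'a \<times> 'b"
  show "ev [] [encode a] (CdrE (Param 0)) (encode (snd a)) (poly [:2, 2:] (esz a))"
    using ev_CdrE[OF ev_Param[of "[]" "encode a"]] by (cases a) (auto elim!: ev_mono)
qed

lemmas fp_fst = fp_comp[OF fp_fst']
lemmas fp_snd = fp_comp[OF fp_snd']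

lemma fp_comp2: "fp (\<lambda>z. f (fst z) (snd z)) \<Longrightarrow> fp g \<Longrightarrow> fp h \<Longrightarrow> fp (\<lambda>x. f (g x) (h x))"
  using fp_comp[of "\<lambda>z. f (fst z) (snd z)" "\<lambda>x. (g x, h x)"] fp_Pair[of g h] by simp

lemma fp_If_enc:
  fixes c :: "'a::encodable \<Rightarrow> 'c::encodable" and f g :: "'a \<Rightarrow> 'b::encodable"
  assumes "fp c" "fp f" "fp g" "\<And>x. b x \<longleftrightarrow> encode (c x) \<noteq> Nul"
  shows "fp (\<lambda>x. if b x then f x else g x)"
proof -
  obtain P e1 e2 p where f: "\<And>a R. ev (P @ R) [encode a] e1 (encode (f a)) (poly p (esz a))"
    and g: "\<And>a R. ev (P @ R) [encode a] e2 (encode (g a)) (poly p (esz a))"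
    using fp_link2[OF assms(2,3)] by metis
  obtain P' e' p' where c: "\<And>a. ev P' [encode a] e' (encode (c a)) (poly p' (esz a))"
    using assms(1) unfolding fp_def by blast
  obtain s where s: "\<And>a. esz (f a) \<le> poly s (esz a)" using fp_size[OF assms(2)] by blast
  obtain s' where s': "\<And>a. esz (g a) \<le> poly s' (esz a)" using fp_size[OF assms(3)] by blast
  let ?P = "P @ map (shiftE (length P)) P' @ []"
  have c': "ev ?P [encode a] (shiftE (length P) e') (encode (c a)) (poly p' (esz a))" for a
    by (rule ev_shift[OF c]) simp
  have "ev ?P [encode x] (IfE (shiftE (length P) e') e1 e2) (encode (if b x then f x else g x))
    (poly (p' + p + s + s' + 1) (esz x))" for x
  proof -
    have "ev ?P [encode x] (if encode (c x) \<noteq> Nul then e1 else e2) (encode (if b x then f x else g x)) (poly p (esz x))"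
      using f[where a = x] g[where a = x] by (simp add: assms(4))
    from ev_IfE[OF c' this] show ?thesis
      using s[of x] s'[of x] by (elim ev_mono) auto
  qed
  thus ?thesis by (rule fpI)
qed

lemmas fp_If = fp_If_enc[where c = "b :: _ \<Rightarrow> bool" and b = b for b, simplified]

lemma fp_Not: "fp b \<Longrightarrow> fp (\<lambda>x. \<not> b x)"
  by (rule fp_cong_enc[OF fp_If[OF _ fp_const[of False] fp_const[of True]]]) auto

lemma fp_conj:
  assumes "fp a" "fp b"
  shows "fp (\<lambda>x. a x \<and> b x)"
  by (rule fp_cong_enc[OF fp_If[OF assms fp_const[of False]]]) auto

lemma fp_disj:
  assumes "fp a" "fp b"
  shows "fp (\<lambda>x. a x \<or> b x)"
  by (rule fp_cong_enc[OF fp_If[OF assms(1) fp_const[of True] assms(2)]]) auto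

lemma fp_Cons: "fp f \<Longrightarrow> fp g \<Longrightarrow> fp (\<lambda>x. f x # g x)"
  by (rule fp_cong_enc[OF fp_Pair]) auto

section \<open>Recursion along the spine of a list or the bits of a number\<close>

text \<open>A single scheme serves lists and binary numbers: descend along the right spine of
  \<open>x\<close>, update the accumulator \<open>p\<close> by \<open>H\<close> on the way down,
  keep \<open>e\<close> fixed, and combine by \<open>G\<close> on the way back. The depth is at most
  the size of \<open>x\<close>. The growth of \<open>p\<close> in one step may depend on
  \<open>x\<close> and \<open>e\<close> but not on \<open>p\<close>, and \<open>result\<close>
  bounds every intermediate value in advance; so each level costs polynomially much.\<close>

lemma fp_rec:
  fixes nul :: "'x::encodable \<Rightarrow> bool" and head :: "'x \<Rightarrow> 'a::encodable" and tail :: "'x \<Rightarrow> 'x"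
    and f :: "'x \<Rightarrow> 'p::encodable \<Rightarrow> 'e::encodable \<Rightarrow> 'y::encodable"
  assumes view: "\<And>x. encode x = (if nul x then Nul else Cell (encode (head x)) (encode (tail x)))"
    and f: "\<And>x p e. f x p e = (if nul x then B p e else G (head x) (tail x) p e (f (tail x) (H (head x) (tail x) p e) e))"
    and B: "fp (\<lambda>z. B (fst z) (snd z))"
    and H: "fp (\<lambda>z. H (fst (fst z)) (snd (fst z)) (fst (snd z)) (snd (snd z)))"
    and G: "fp (\<lambda>z. G (fst (fst (fst z))) (snd (fst (fst z))) (fst (snd (fst z))) (snd (snd (fst z))) (snd z))"
    and param: "\<And>x p e. \<not> nul x \<Longrightarrow> esz (H (head x) (tail x) p e) \<le> esz p + poly c (esz x + esz e)"
    and result: "\<And>x p e. esz (f x p e) \<le> poly d (esz x + esz p + esz e)"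
  shows "fp (\<lambda>z. f (fst z) (fst (snd z)) (snd (snd z)))"
proof -
  obtain P1 eB eH p1 where B1: "\<And>a R. ev (P1 @ R) [encode a] eB (encode (B (fst a) (snd a))) (poly p1 (esz a))"
    and H1: "\<And>a R. ev (P1 @ R) [encode a] eH (encode (H (fst (fst a)) (snd (fst a)) (fst (snd a)) (snd (snd a)))) (poly p1 (esz a))"
    using fp_link2[OF B H] by metis
  obtain P2 eG p2 where G2: "\<And>a. ev P2 [encode a] eG
      (encode (G (fst (fst (fst a))) (snd (fst (fst a))) (fst (snd (fst a))) (snd (snd (fst a))) (snd a))) (poly p2 (esz a))"
    using G unfolding fp_def by blast
  define n where "n = length P1 + length P2"
  \<comment> \<open>The functions \<open>n\<close> to \<open>n + 3\<close> are \<open>B\<close>,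
    \<open>H\<close>, \<open>G\<close> and the recursion itself. The argument is the tree of
    \<open>(x, p, e)\<close>: its left part is \<open>x\<close>, and its right part is the argument
    of \<open>B\<close>.\<close>
  define body where "body = IfE (CarE (Param 0) )
    (CallE (n + 2) [CellE (Param 0) (CallE (n + 3)
        [CellE (CdrE (CarE (Param 0))) (CellE (CallE (n + 1) [Param 0]) (CdrE (CdrE (Param 0))))])])
    (CallE n [CdrE (Param 0)])"
  define P where "P = P1 @ map (shiftE (length P1)) P2 @ [eB, eH, shiftE (length P1) eG, body]"
  have len: "length P = n + 4" by (simp add: P_def n_def)
  have nth: "P ! n = eB" "P ! (n + 1) = eH" "P ! (n + 2) = shiftE (length P1) eG" "P ! (n + 3) = body"
    by (simp_all add: P_def n_def nth_append)
  have Bev: "ev P [encode a] (P ! n) (encode (B (fst a) (snd a))) (poly p1 (esz a))" for a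
    unfolding nth by (simp add: P_def B1)
  have Hev: "ev P [encode a] (P ! (n + 1)) (encode (H (fst (fst a)) (snd (fst a)) (fst (snd a)) (snd (snd a)))) (poly p1 (esz a))" for a
    unfolding nth by (simp add: P_def H1)
  have Gev: "ev P [encode a] (P ! (n + 2)) (encode (G (fst (fst (fst a))) (snd (fst (fst a))) (fst (snd (fst a))) (snd (snd (fst a))) (snd a)))
      (poly p2 (esz a))" for a
    unfolding nth unfolding P_def by (rule ev_shift[OF G2]) simp
  define cost where "cost = (\<lambda>V. 30 * V + 30 + 2 * poly p1 V + poly p2 V)"
  \<comment> \<open>\<open>K\<close> bounds the growth of the accumulator in one step. The invariant
    with \<open>M\<close> survives because \<open>esz x\<close> drops at each step, which pays for
    one \<open>K\<close>. \<open>V\<close> bounds every tree handled at one level, and the factor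
    \<open>esz x + 1\<close> counts the levels.\<close>
  have cost: "ev P [Cell (encode x) (Cell (encode p) (encode e))] body (encode (f x p e)) ((esz x + 1) * cost V)"
    if "esz x \<le> X" "esz p + esz x * K \<le> M" "K = poly c (X + esz e)" "V = X + M + esz e + poly d (X + M + esz e) + 5"
    for x p e X K M V
    using that(1,2)
  proof (induction "esz x" arbitrary: x p rule: less_induct)
    case less
    let ?z = "Cell (encode x) (Cell (encode p) (encode e))"
    have z: "?z = encode (x, p, e)" by simp
    have szp: "esz p \<le> M" using less.prems(2) by linarith
    have szf: "esz (f x' p' e) \<le> V" if "esz x' \<le> X" "esz p' \<le> M" for x' p'
      using result[of x' p' e] poly_nat_mono[of "esz x' + esz p' + esz e" "X + M + esz e" d] that \<open>V = _\<close>
      by linarith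
    show ?case
    proof (cases "nul x")
      case True
      hence [simp]: "encode x = Nul" by (simp add: view)
      have "ev P [?z] (CallE n [CdrE (Param 0)]) (encode (B p e))
          ((size ?z + 1 + size (cdr ?z) + 1) + poly p1 (esz (p, e)) + esz (B p e) + 1)"
        using Bev[of "(p, e)"] ev_CdrE[OF ev_Param[of P ?z]] by (intro ev_Call1) (auto simp: len)
      hence "ev P [?z] body (encode (B p e)) ((size ?z + 1 + size (car ?z) + 1) +
        ((size ?z + 1 + size (cdr ?z) + 1) + poly p1 (esz (p, e)) + esz (B p e) + 1) + esz (B p e) + 1)"
        unfolding body_def by (intro ev_IfE[OF ev_CarE[OF ev_Param]]) simp
      moreover have "poly p1 (esz (p, e)) \<le> poly p1 V"
        using szp \<open>V = _\<close> by (intro poly_nat_mono) simp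
      moreover have "esz (B p e) \<le> V" using szf[of x p] True less.prems szp by (simp add: f)
      ultimately have "ev P [?z] body (encode (B p e)) (cost V)"
        using szp \<open>V = _\<close> unfolding cost_def by (elim ev_mono) simp
      thus ?thesis using True by (simp add: f[of x])
    next
      case False
      have x: "encode x = Cell (encode (head x)) (encode (tail x))" using False by (simp add: view)
      \<comment> \<open>A nonempty \<open>x\<close> has the same tree as the pair of its head and
        tail, so the argument can be handed to \<open>H\<close> and \<open>G\<close>
        unchanged.\<close>
      have xpe: "encode ((x, p, e), y) = encode (((head x, tail x), p, e), y)" for y :: 'y
        by (simp add: x)
      define p' where "p' = H (head x) (tail x) p e"
      have lt: "esz (tail x) < esz x" by (simp add: x)
      have "esz p' \<le> esz p + poly c (esz x + esz e)" unfolding p'_def by (rule param[OF False])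
      also have "poly c (esz x + esz e) \<le> K" unfolding \<open>K = _\<close> using less.prems by (intro poly_nat_mono) simp
      finally have p': "esz p' \<le> esz p + K" by simp
      have "esz p' + esz (tail x) * K \<le> esz p + (esz (tail x) + 1) * K" using p' by simp
      also have "\<dots> \<le> esz p + esz x * K" using lt by (intro add_mono mult_right_mono) auto
      also have "\<dots> \<le> M" by (rule less.prems)
      finally have M': "esz p' + esz (tail x) * K \<le> M" .
      hence szp': "esz p' \<le> M" by linarith
      define y where "y = f (tail x) p' e"
      have IH: "ev P [Cell (encode (tail x)) (Cell (encode p') (encode e))] (P ! (n + 3)) (encode y) ((esz (tail x) + 1) * cost V)"
        unfolding nth y_def using lt less.prems M' by (intro less.hyps) auto
      have szy: "esz y \<le> V" unfolding y_def using szf[of "tail x" p'] lt less.prems szp' by simp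
      have fx: "f x p e = G (head x) (tail x) p e y" using False by (simp add: f[of x] y_def p'_def)
      have "ev P [?z] (CallE (n + 1) [Param 0]) (encode p') ((size ?z + 1) + poly p1 (size ?z) + esz p' + 1)"
        using Hev[of "((head x, tail x), p, e)"] ev_Param[of P ?z] unfolding p'_def by (intro ev_Call1) (auto simp: len x)
      hence h: "ev P [?z] (CallE (n + 1) [Param 0]) (encode p') (2 * V + 2 + poly p1 V)"
        using szp szp' poly_nat_mono[of "size ?z" V p1] less.prems(1) \<open>V = _\<close> by (elim ev_mono) auto
      have "ev P [?z] (CdrE (CarE (Param 0))) (encode (tail x)) (size ?z + 1 + esz x + 1 + esz (tail x) + 1)"
        using ev_CdrE[OF ev_CarE[OF ev_Param[of P ?z]]] by (simp add: x)
      hence tl: "ev P [?z] (CdrE (CarE (Param 0))) (encode (tail x)) (3 * V)"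
        using szp szp' lt less.prems(1) \<open>V = _\<close> by (elim ev_mono) auto
      have "ev P [?z] (CdrE (CdrE (Param 0))) (encode e) (size ?z + 1 + (esz p + esz e + 1) + 1 + esz e + 1)"
        using ev_CdrE[OF ev_CdrE[OF ev_Param[of P ?z]]] by simp
      hence ee: "ev P [?z] (CdrE (CdrE (Param 0))) (encode e) (3 * V)"
        using szp szp' lt less.prems(1) \<open>V = _\<close> by (elim ev_mono) auto
      let ?z' = "Cell (encode (tail x)) (Cell (encode p') (encode e))"
      have "ev P [?z] (CellE (CdrE (CarE (Param 0))) (CellE (CallE (n + 1) [Param 0]) (CdrE (CdrE (Param 0))))) ?z'
        (3 * V + ((2 * V + 2 + poly p1 V) + 3 * V + (esz p' + esz e + 1) + 1) + size ?z' + 1)"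
        using ev_CellE[OF tl ev_CellE[OF h ee]] by simp
      hence arg: "ev P [?z] (CellE (CdrE (CarE (Param 0))) (CellE (CallE (n + 1) [Param 0]) (CdrE (CdrE (Param 0))))) ?z'
        (10 * V + 4 + poly p1 V)"
        using szp' lt less.prems(1) \<open>V = _\<close> by (elim ev_mono) auto
      have "ev P [?z] (CallE (n + 3)
        [CellE (CdrE (CarE (Param 0))) (CellE (CallE (n + 1) [Param 0]) (CdrE (CdrE (Param 0))))]) (encode y)
        ((10 * V + 4 + poly p1 V) + (esz (tail x) + 1) * cost V + esz y + 1)"
        by (rule ev_Call1[OF arg _ IH]) (simp add: len)
      from ev_CellE[OF ev_Param[of P ?z] this]
      have "ev P [?z] (CellE (Param 0) (CallE (n + 3)
        [CellE (CdrE (CarE (Param 0))) (CellE (CallE (n + 1) [Param 0]) (CdrE (CdrE (Param 0))))])) (encode ((x, p, e), y))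
        ((size ?z + 1) + ((10 * V + 4 + poly p1 V) + (esz (tail x) + 1) * cost V + esz y + 1) + (size ?z + esz y + 1) + 1)"
        by simp
      from ev_Call1[OF this[unfolded xpe], of "n + 2", OF _ Gev]
      have call: "ev P [?z] (CallE (n + 2) [CellE (Param 0) (CallE (n + 3)
        [CellE (CdrE (CarE (Param 0))) (CellE (CallE (n + 1) [Param 0]) (CdrE (CdrE (Param 0))))])]) (encode (f x p e))
        (((size ?z + 1) + ((10 * V + 4 + poly p1 V) + (esz (tail x) + 1) * cost V + esz y + 1) + (size ?z + esz y + 1) + 1)
          + poly p2 (esz (((head x, tail x), p, e), y)) + esz (f x p e) + 1)"
        by (simp add: len fx x)
      have "ev P [?z] body (encode (f x p e)) ((size ?z + 1 + size (car ?z) + 1) +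
        (((size ?z + 1) + ((10 * V + 4 + poly p1 V) + (esz (tail x) + 1) * cost V + esz y + 1) + (size ?z + esz y + 1) + 1)
          + poly p2 (esz (((head x, tail x), p, e), y)) + esz (f x p e) + 1) + esz (f x p e) + 1)"
        unfolding body_def by (rule ev_IfE[OF ev_CarE[OF ev_Param]]) (use call x in simp)
      moreover have "poly p2 (esz (((head x, tail x), p, e), y)) \<le> poly p2 V"
        unfolding xpe[symmetric]
      proof (rule poly_nat_mono)
        have "esz y \<le> poly d (X + M + esz e)" unfolding y_def
          using result[of "tail x" p' e] poly_nat_mono[of "esz (tail x) + esz p' + esz e" "X + M + esz e" d]
            lt less.prems szp' by linarith
        thus "esz ((x, p, e), y) \<le> V" using szp less.prems(1) \<open>V = _\<close> by simp
      qed
      moreover have "size ?z \<le> V" using szp less.prems(1) \<open>V = _\<close> by simp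
      moreover have "esz x \<le> V" using less.prems(1) \<open>V = _\<close> by simp
      moreover have "esz (f x p e) \<le> V" using szf less.prems szp by blast
      ultimately have "ev P [?z] body (encode (f x p e)) (30 * V + 30 + 2 * poly p1 V + poly p2 V + (esz (tail x) + 1) * cost V)"
        using szy by (elim ev_mono) simp
      moreover have "30 * V + 30 + 2 * poly p1 V + poly p2 V + (esz (tail x) + 1) * cost V = (esz (tail x) + 2) * cost V"
        unfolding cost_def by (simp add: algebra_simps)
      moreover have "(esz (tail x) + 2) * cost V \<le> (esz x + 1) * cost V"
        using lt by (intro mult_right_mono) auto
      ultimately show ?thesis by (metis ev_mono)
    qed
  qed
  \<comment> \<open>Polynomials in the size of the whole argument that majorize \<open>M\<close>,
    \<open>V\<close> and the total cost.\<close>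
  define Mp where "Mp = [:0, 1:] + [:0, 1:] * c"
  define Vp where "Vp = [:0, 1:] + Mp + pcompose d ([:0, 1:] + Mp) + [:5:]"
  define Cp where "Cp = [:1, 1:] * ([:30:] * Vp + [:30:] + [:2:] * pcompose p1 Vp + pcompose p2 Vp)"
  show ?thesis
  proof (rule fpI[of P body _ Cp])
    fix z :: "'x \<times> 'p \<times> 'e"
    obtain x p e where z: "z = (x, p, e)" by (cases z)
    let ?K = "poly c (esz x + esz e)"
    let ?M = "esz p + esz x * ?K"
    let ?V = "esz x + ?M + esz e + poly d (esz x + ?M + esz e) + 5"
    have "ev P [Cell (encode x) (Cell (encode p) (encode e))] body (encode (f x p e)) ((esz x + 1) * cost ?V)"
      by (rule cost) auto
    moreover have K: "?K \<le> poly c (esz z)" by (intro poly_nat_mono) (simp add: z)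
    moreover have sum: "esz x + ?M + esz e \<le> poly ([:0, 1:] + Mp) (esz z)"
    proof -
      have "esz x * ?K \<le> esz z * poly c (esz z)" using K by (intro mult_mono) (auto simp: z)
      thus ?thesis unfolding Mp_def by (simp add: z)
    qed
    moreover have V: "?V \<le> poly Vp (esz z)"
      using sum poly_nat_mono[OF sum, of d] unfolding Vp_def by (simp add: poly_pcompose)
    moreover have "(esz x + 1) * cost ?V \<le> poly Cp (esz z)"
    proof -
      have "cost ?V \<le> cost (poly Vp (esz z))"
        unfolding cost_def by (intro add_mono mult_left_mono poly_nat_mono V) auto
      hence "(esz x + 1) * cost ?V \<le> (esz z + 1) * cost (poly Vp (esz z))"
        by (intro mult_mono) (auto simp: z)
      thus ?thesis unfolding Cp_def cost_def by (simp add: poly_pcompose algebra_simps)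
    qed
    ultimately show "ev P [encode z] body (encode (f (fst z) (fst (snd z)) (snd (snd z)))) (poly Cp (esz z))"
      by (simp add: z ev_mono)
  qed
qed

section \<open>Lists, numbers and equality in polynomial time\<close>

definition eq_both :: expr where
  "eq_both = IfE (CallE 0 [CellE (CarE (CarE (Param 0))) (CarE (CdrE (Param 0)))])
     (CallE 0 [CellE (CdrE (CarE (Param 0))) (CdrE (CdrE (Param 0)))]) NulE"

definition eq_body :: expr where
  "eq_body = IfE (CarE (Param 0)) (IfE (CdrE (Param 0)) eq_both NulE)
     (IfE (CdrE (Param 0)) NulE (CellE NulE NulE))"

text \<open>The factor \<open>2 * size x + 1\<close> is the number of nodes of \<open>x\<close>,
  leaves included; there is at most one call for each of them. \<open>N\<close> bounds the trees
  copied by any call.\<close>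

lemma ev_eq_body:
  "size x + size y \<le> N \<Longrightarrow>
    ev [eq_body] [Cell x y] eq_body (encode (x = y)) ((2 * size x + 1) * (40 * N + 70))"
proof (induction x arbitrary: y)
  case Nul
  let ?P = "[eq_body]" and ?z = "Cell Nul y"
  have c: "ev ?P [?z] (CarE (Param 0)) Nul (2 * N + 6)"
    using ev_CarE[OF ev_Param[of ?P ?z]] Nul by (auto elim!: ev_mono)
  have d: "ev ?P [?z] (CdrE (Param 0)) y (2 * N + 6)"
    using ev_CdrE[OF ev_Param[of ?P ?z]] Nul by (auto elim!: ev_mono)
  have r: "ev ?P [?z] (if y \<noteq> Nul then NulE else CellE NulE NulE) (encode (Nul = y)) 5"
    using ev_NulE[of ?P "[?z]"] ev_CellE[OF ev_NulE ev_NulE, of ?P "[?z]"]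
    by (auto elim!: ev_mono)
  have sz: "esz (Nul = y) \<le> 1" by (cases "Nul = y") auto
  have a: "ev ?P [?z] eq_body v (2 * N + 6 + t + size v + 1)"
    if "ev ?P [?z] (IfE (CdrE (Param 0)) NulE (CellE NulE NulE)) v t" for v t
    using ev_IfE[OF c, where a = "IfE (CdrE (Param 0)) eq_both NulE"
          and b = "IfE (CdrE (Param 0)) NulE (CellE NulE NulE)"] that
    unfolding eq_body_def[symmetric] by simp
  show ?case using a[OF ev_IfE[OF d r]] sz by (elim ev_mono) simp
next
  case (Cell a b)
  let ?P = "[eq_body]" and ?z = "Cell (Cell a b) y" and ?C = "40 * N + 70"
  have c: "ev ?P [?z] (CarE (Param 0)) (Cell a b) (2 * N + 6)"
    using ev_CarE[OF ev_Param[of ?P ?z]] Cell.prems by (auto elim!: ev_mono)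
  have d: "ev ?P [?z] (CdrE (Param 0)) y (2 * N + 6)"
    using ev_CdrE[OF ev_Param[of ?P ?z]] Cell.prems by (auto elim!: ev_mono)
  have sz: "esz b \<le> 1" for b :: bool by (cases b) auto
  have a: "ev ?P [?z] eq_body v (2 * N + 6 + t + size v + 1)"
    if "ev ?P [?z] (IfE (CdrE (Param 0)) eq_both NulE) v t" for v t
    using ev_IfE[OF c, where a = "IfE (CdrE (Param 0)) eq_both NulE"
          and b = "IfE (CdrE (Param 0)) NulE (CellE NulE NulE)"] that
    unfolding eq_body_def[symmetric] by simp
  show ?case
  proof (cases y)
    case Nul
    have "ev ?P [?z] (if y \<noteq> Nul then eq_both else NulE) Nul 1"
      using ev_NulE[of ?P "[?z]"] Nul by simp
    from a[OF ev_IfE[OF d this]] show ?thesis using Nul by (auto elim!: ev_mono)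
  next
    case y: (Cell a' b')
    have N: "size a + size a' \<le> N" "size b + size b' \<le> N" "size a + size b + size a' + size b' + 2 \<le> N"
      using Cell.prems y by auto
    have 1: "ev ?P [?z] (CellE (CarE (CarE (Param 0))) (CarE (CdrE (Param 0)))) (Cell a a') (8 * N + 20)"
      using ev_CellE[OF ev_CarE[OF c] ev_CarE[OF d]] N by (auto simp: y elim!: ev_mono)
    have 2: "ev ?P [?z] (CellE (CdrE (CarE (Param 0))) (CdrE (CdrE (Param 0)))) (Cell b b') (8 * N + 20)"
      using ev_CellE[OF ev_CdrE[OF c] ev_CdrE[OF d]] N by (auto simp: y elim!: ev_mono)
    have "ev ?P [Cell a a'] (?P ! 0) (encode (a = a')) ((2 * size a + 1) * ?C)"
      using Cell.IH(1)[OF N(1)] by simp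
    from ev_Call1[OF 1 _ this]
    have 3: "ev ?P [?z] (CallE 0 [CellE (CarE (CarE (Param 0))) (CarE (CdrE (Param 0)))]) (encode (a = a'))
      ((8 * N + 20) + (2 * size a + 1) * ?C + 2)"
      using sz[of "a = a'"] by (auto elim!: ev_mono)
    have "ev ?P [Cell b b'] (?P ! 0) (encode (b = b')) ((2 * size b + 1) * ?C)"
      using Cell.IH(2)[OF N(2)] by simp
    from ev_Call1[OF 2 _ this]
    have 4: "ev ?P [?z] (CallE 0 [CellE (CdrE (CarE (Param 0))) (CdrE (CdrE (Param 0)))]) (encode (b = b'))
      ((8 * N + 20) + (2 * size b + 1) * ?C + 2)"
      using sz[of "b = b'"] by (auto elim!: ev_mono)
    have 5: "ev ?P [?z] (if encode (a = a') \<noteq> Nul then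
        CallE 0 [CellE (CdrE (CarE (Param 0))) (CdrE (CdrE (Param 0)))] else NulE) (encode (Cell a b = y))
      ((8 * N + 20) + (2 * size b + 1) * ?C + 2)"
      using 4 ev_NulE[of ?P "[?z]"] by (cases "a = a'") (auto simp: y elim!: ev_mono)
    let ?b1 = "(8 * N + 20) + (2 * size a + 1) * ?C + 2 + ((8 * N + 20) + (2 * size b + 1) * ?C + 2) + esz (Cell a b = y) + 1"
    have "ev ?P [?z] eq_both (encode (Cell a b = y)) ?b1"
      using ev_IfE[OF 3 5] unfolding eq_both_def[symmetric] .
    hence "ev ?P [?z] (if y \<noteq> Nul then eq_both else NulE) (encode (Cell a b = y)) ?b1"
      using y by simp
    from a[OF ev_IfE[OF d this]] have "ev ?P [?z] eq_body (encode (Cell a b = y))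
      (2 * N + 6 + (2 * N + 6 + ?b1 + esz (Cell a b = y) + 1) + esz (Cell a b = y) + 1)" .
    moreover have "2 * N + 6 + (2 * N + 6 + ?b1 + esz (Cell a b = y) + 1) + esz (Cell a b = y) + 1
        \<le> (2 * size (Cell a b) + 1) * ?C"
      using sz[of "Cell a b = y"] by (simp add: algebra_simps)
    ultimately show ?thesis by (rule ev_mono)
  qed
qed

lemma fp_eq':
  "fp (\<lambda>z. fst z = snd (z :: 'a::encodable \<times> 'a))"
proof (rule fpI[of "[eq_body]" eq_body _ "[:1, 2:] * [:70, 40:]"])
  fix z :: "'a \<times> 'a"
  obtain x y where z: "z = (x, y)" by (cases z)
  have "ev [eq_body] [Cell (encode x) (encode y)] eq_body (encode (encode x = encode y))
    ((2 * esz x + 1) * (40 * esz z + 70))"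
    by (rule ev_eq_body) (simp add: z)
  moreover have "(2 * esz x + 1) * (40 * esz z + 70) \<le> poly ([:1, 2:] * [:70, 40:]) (esz z)"
    by (simp add: z algebra_simps)
  ultimately show "ev [eq_body] [encode z] eq_body (encode (fst z = snd z)) (poly ([:1, 2:] * [:70, 40:]) (esz z))"
    using ev_mono by (simp add: z)
qed

lemma fp_eq: "fp f \<Longrightarrow> fp g \<Longrightarrow> fp (\<lambda>x. f x = g x)"
  using fp_comp2[OF fp_eq'] .

lemmas fp_basic = fp_ident fp_const fp_fst fp_snd fp_Pair fp_Cons fp_If fp_Not fp_conj fp_disj fp_eq

lemma fp_rec_list:
  fixes f :: "'a::encodable list \<Rightarrow> 'p::encodable \<Rightarrow> 'e::encodable \<Rightarrow> 'y::encodable"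
  assumes f: "\<And>p e. f [] p e = B p e" "\<And>a l p e. f (a # l) p e = G a l p e (f l (H a l p e) e)"
    and "fp (\<lambda>z. B (fst z) (snd z))"
    and "fp (\<lambda>z. H (fst (fst z)) (snd (fst z)) (fst (snd z)) (snd (snd z)))"
    and "fp (\<lambda>z. G (fst (fst (fst z))) (snd (fst (fst z))) (fst (snd (fst z))) (snd (snd (fst z))) (snd z))"
    and param: "\<And>a l p e. esz (H a l p e) \<le> esz p + poly c (esz a + esz l + esz e)"
    and "\<And>l p e. esz (f l p e) \<le> poly d (esz l + esz p + esz e)"
  shows "fp (\<lambda>z. f (fst z) (fst (snd z)) (snd (snd z)))"
proof (rule fp_rec[where nul = "\<lambda>l. l = []" and head = hd and tail = tl and f = f and B = B and G = G and H = H
      and c = c and d = d])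
  show "encode x = (if x = [] then Nul else Cell (encode (hd x)) (encode (tl x)))" for x :: "'a list"
    by (cases x) auto
  show "f x p e = (if x = [] then B p e else G (hd x) (tl x) p e (f (tl x) (H (hd x) (tl x) p e) e))" for x p e
    by (cases x) (auto simp: f)
  show "esz (H (hd x) (tl x) p e) \<le> esz p + poly c (esz x + esz e)" if "x \<noteq> []" for x p e
  proof -
    have "esz (hd x) + esz (tl x) \<le> esz x" using that by (cases x) auto
    hence "poly c (esz (hd x) + esz (tl x) + esz e) \<le> poly c (esz x + esz e)"
      by (intro poly_nat_mono) simp
    thus ?thesis using param[of "hd x" "tl x" p e] by linarith
  qed
qed fact+

lemma fp_rec_nat:
  fixes f :: "nat \<Rightarrow> 'p::encodable \<Rightarrow> 'e::encodable \<Rightarrow> 'y::encodable"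
  assumes "\<And>p e. f 0 p e = B p e"
    "\<And>n p e. n > 0 \<Longrightarrow> f n p e = G (odd n) (n div 2) p e (f (n div 2) (H (odd n) (n div 2) p e) e)"
    and "fp (\<lambda>z. B (fst z) (snd z))"
    and "fp (\<lambda>z. H (fst (fst z)) (snd (fst z)) (fst (snd z)) (snd (snd z)))"
    and "fp (\<lambda>z. G (fst (fst (fst z))) (snd (fst (fst z))) (fst (snd (fst z))) (snd (snd (fst z))) (snd z))"
    and "\<And>b n p e. esz (H b n p e) \<le> esz p + poly c 0"
    and "\<And>n p e. esz (f n p e) \<le> poly d (esz n + esz p + esz e)"
  shows "fp (\<lambda>z. f (fst z) (fst (snd z)) (snd (snd z)))"
proof (rule fp_rec[where nul = "\<lambda>n. n = 0" and head = odd and tail = "\<lambda>n. n div 2" and f = f and B = B and G = G and H = H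
      and c = c and d = d])
  show "encode x = (if x = 0 then Nul else Cell (encode (odd x)) (encode (x div 2)))" for x :: nat
    by (auto simp: enc_nat_pos')
  show "esz (H (odd x) (x div 2) p e) \<le> esz p + poly c (esz x + esz e)" for x p e
    using assms(6)[of "odd x" "x div 2" p e] poly_nat_mono[of 0 "esz x + esz e" c] by linarith
  show "f x p e = (if x = 0 then B p e else G (odd x) (x div 2) p e (f (x div 2) (H (odd x) (x div 2) p e) e))" for x p e
    using assms(1,2) by simp
qed fact+

section \<open>Operations on lists\<close>

lemma esz_list_bound: "(\<And>a. a \<in> set l \<Longrightarrow> esz a \<le> k) \<Longrightarrow> esz l \<le> length l * (k + 1)"
proof (induction l)
  case (Cons a l)
  hence "esz a \<le> k" "esz l \<le> length l * (k + 1)" by auto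
  thus ?case by simp
qed simp

lemma length_le_esz: "length l \<le> esz l"
  by (induction l) auto

lemma esz_member: "a \<in> set l \<Longrightarrow> esz a \<le> esz l"
  by (induction l) auto

text \<open>A case distinction is the degenerate recursion whose combining function ignores the
  recursive result.\<close>

lemma fp_case_list':
  assumes "fp A" "fp (\<lambda>z. B (fst z) (fst (snd z)) (snd (snd z)))"
  shows "fp (\<lambda>z. case fst z of [] \<Rightarrow> A (snd z) | a # l \<Rightarrow> B (snd z) a l)"
proof -
  obtain s where s: "\<And>x. esz (A x) \<le> poly s (esz x)" using fp_size[OF assms(1)] by blast
  obtain s' where s': "\<And>x. esz (B (fst x) (fst (snd x)) (snd (snd x))) \<le> poly s' (esz x)"
    using fp_size[OF assms(2)] by blast
  have sz: "esz (case l of [] \<Rightarrow> A e | a # l \<Rightarrow> B e a l) \<le> poly (s + pcompose s' [:1, 1:]) (esz l + esz p + esz e)"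
    for l e and p :: bool
  proof (cases l)
    case Nil
    have "poly s (esz e) \<le> poly s (esz l + esz p + esz e)" by (intro poly_nat_mono) simp
    thus ?thesis using s[of e] Nil by simp
  next
    case (Cons a l')
    have "poly s' (esz (e, a, l')) \<le> poly s' (1 + (esz l + esz p + esz e))" by (intro poly_nat_mono) (simp add: Cons)
    thus ?thesis using s'[of "(e, a, l')"] Cons by (simp add: poly_pcompose)
  qed
  have "fp (\<lambda>z. (\<lambda>l (p::bool) e. case l of [] \<Rightarrow> A e | a # l \<Rightarrow> B e a l) (fst z) (fst (snd z)) (snd (snd z)))"
    by (rule fp_rec_list[where B = "\<lambda>p e. A e" and G = "\<lambda>a l p e y. B e a l" and H = "\<lambda>a l p e. False" and c = 0, OF _ _ _ _ _ _ sz])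
      (auto intro!: fp_basic fp_comp[OF assms(1)] fp_comp[OF assms(2), of "\<lambda>z. (F z, G z, H z)" for F G H, simplified])
  from fp_comp[OF this fp_Pair[OF fp_fst' fp_Pair[OF fp_const[of False] fp_snd']]]
  show ?thesis unfolding fst_conv snd_conv .
qed

lemma fp_case_list:
  assumes "fp L" "fp A" "fp (\<lambda>z. B (fst z) (fst (snd z)) (snd (snd z)))"
  shows "fp (\<lambda>x. case L x of [] \<Rightarrow> A x | a # l \<Rightarrow> B x a l)"
  using fp_comp[OF fp_case_list'[OF assms(2,3)] fp_Pair[OF assms(1) fp_ident]] unfolding fst_conv snd_conv .

lemma fp_map:
  assumes L: "fp L" and F: "fp (\<lambda>z. F (fst z) (snd z))"
  shows "fp (\<lambda>x. map (F x) (L x))"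
proof -
  obtain s where s: "\<And>x. esz (F (fst x) (snd x)) \<le> poly s (esz x)" using fp_size[OF F] by blast
  have sz: "esz (map (F e) l) \<le> poly ([:0,1:] * (pcompose s [:1, 1:] + 1)) (esz l + esz p + esz e)" for l e and p :: bool
  proof -
    let ?n = "esz l + esz p + esz e"
    have "esz (map (F e) l) \<le> length (map (F e) l) * (poly s (1 + ?n) + 1)"
    proof (rule esz_list_bound)
      fix y assume "y \<in> set (map (F e) l)"
      then obtain a where a: "a \<in> set l" "y = F e a" by auto
      have "esz y \<le> poly s (esz (e, a))" using s[of "(e, a)"] a by simp
      also have "\<dots> \<le> poly s (1 + ?n)" using esz_member[OF a(1)] by (intro poly_nat_mono) simp
      finally show "esz y \<le> poly s (1 + ?n)" .
    qed
    also have "\<dots> \<le> ?n * (poly s (1 + ?n) + 1)" using length_le_esz[of l] by (intro mult_right_mono) auto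
    finally show ?thesis by (simp add: poly_pcompose)
  qed
  have "fp (\<lambda>z. (\<lambda>l (p::bool) e. map (F e) l) (fst z) (fst (snd z)) (snd (snd z)))"
    by (rule fp_rec_list[where B = "\<lambda>p e. []" and G = "\<lambda>a l p e y. F e a # y" and H = "\<lambda>a l p e. False" and c = 0, OF _ _ _ _ _ _ sz])
      (auto intro!: fp_basic fp_comp2[OF F])
  from fp_comp[OF this, of "\<lambda>x. (L x, False, x)"] show ?thesis using L by (simp add: fp_basic)
qed

lemma esz_filter: "esz (filter P l) \<le> esz l"
  by (induction l) auto

lemma fp_filter:
  assumes L: "fp L" and F: "fp (\<lambda>z. F (fst z) (snd z))"
  shows "fp (\<lambda>x. filter (F x) (L x))"
proof -
  have "fp (\<lambda>z. (\<lambda>l (p::bool) e. filter (F e) l) (fst z) (fst (snd z)) (snd (snd z)))"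
    by (rule fp_rec_list[where B = "\<lambda>p e. []" and G = "\<lambda>a l p e y. if F e a then a # y else y" and H = "\<lambda>a l p e. False"
          and c = 0 and d = "[:0,1:]"])
      (auto intro!: fp_basic fp_comp2[OF F] intro: order.trans[OF esz_filter])
  from fp_comp[OF this, of "\<lambda>x. (L x, False, x)"] show ?thesis using L by (simp add: fp_basic)
qed

lemma fp_list_ex:
  assumes L: "fp L" and F: "fp (\<lambda>z. F (fst z) (snd z))"
  shows "fp (\<lambda>x. \<exists>a\<in>set (L x). F x a)"
  by (rule fp_cong_enc[OF fp_Not[OF fp_eq[OF fp_filter[OF assms] fp_const[of "[]"]]]])
    (auto simp: filter_empty_conv)

lemma esz_append: "esz (l @ l') = esz l + esz l'"
  by (induction l) auto

lemma fp_append: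
  assumes "fp L" "fp L'"
  shows "fp (\<lambda>x. L x @ L' x)"
proof -
  have "fp (\<lambda>z. (\<lambda>l (p::bool) e. l @ e) (fst z) (fst (snd z)) (snd (snd z)))"
    by (rule fp_rec_list[where B = "\<lambda>p e. e" and G = "\<lambda>a l p e y. a # y" and H = "\<lambda>a l p e. False"
          and c = 0 and d = "[:0,1:]"])
      (auto intro!: fp_basic simp: esz_append)
  from fp_comp[OF this, of "\<lambda>x. (L x, False, L' x)"] show ?thesis using assms by (simp add: fp_basic)
qed

lemma esz_concat: "esz (concat ls) \<le> esz ls"
  by (induction ls) (auto simp: esz_append)

lemma fp_concat:
  assumes L: "fp L"
  shows "fp (\<lambda>x. concat (L x))"
proof -
  have "fp (\<lambda>z. (\<lambda>l (p::bool) (e::bool). concat l) (fst z) (fst (snd z)) (snd (snd z)))"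
    by (rule fp_rec_list[where B = "\<lambda>p e. []" and G = "\<lambda>a l p e y. a @ y" and H = "\<lambda>a l p e. False"
          and c = 0 and d = "[:0,1:]"])
      (auto intro!: fp_basic fp_append intro: order.trans[OF esz_concat])
  from fp_comp[OF this, of "\<lambda>x. (L x, False, False)"] show ?thesis using L by (simp add: fp_basic)
qed

lemma esz_foldl:
  assumes "\<And>acc a. esz (s acc a) \<le> esz acc + poly c (esz a + E)"
  shows "esz (foldl s acc l) \<le> esz acc + esz l * poly c (esz l + E)"
proof -
  have "esz (foldl s acc l) \<le> esz acc + length l * poly c (k + E)" if "esz l \<le> k" for k
    using that
  proof (induction l arbitrary: acc)
    case (Cons a l)
    have "esz (foldl s (s acc a) l) \<le> esz (s acc a) + length l * poly c (k + E)"
      using Cons by simp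
    also have "esz (s acc a) \<le> esz acc + poly c (esz a + E)" by fact
    also have "poly c (esz a + E) \<le> poly c (k + E)" using Cons.prems by (intro poly_nat_mono) simp
    finally show ?case by simp
  qed simp
  from this[OF order.refl] show ?thesis
    using mult_right_mono[OF length_le_esz[of l], of "poly c (esz l + E)"] by linarith
qed

text \<open>The running value is the descending accumulator of the recursion scheme, hence the
  requirement that a step enlarge it only by an amount independent of it.\<close>

lemma fp_foldl:
  fixes S :: "'e::encodable \<Rightarrow> 'p::encodable \<Rightarrow> 'a::encodable \<Rightarrow> 'p"
  assumes L: "fp L" and I: "fp I" and S: "fp (\<lambda>z. S (fst z) (fst (snd z)) (snd (snd z)))"
    and sz: "\<And>e acc a. esz (S e acc a) \<le> esz acc + poly c (esz a + esz e)"
  shows "fp (\<lambda>x. foldl (S x) (I x) (L x))"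
proof -
  have "fp (\<lambda>z. (\<lambda>l p e. foldl (S e) p l) (fst z) (fst (snd z)) (snd (snd z)))"
  proof (rule fp_rec_list[where B = "\<lambda>p e. p" and G = "\<lambda>a l p e y. y" and H = "\<lambda>a l p e. S e p a"
        and c = c and d = "[:0,1:] + [:0,1:] * c"])
    fix a :: 'a and l :: "'a list" and p :: 'p and e :: 'e
    have "poly c (esz a + esz e) \<le> poly c (esz a + esz l + esz e)" by (intro poly_nat_mono) simp
    thus "esz (S e p a) \<le> esz p + poly c (esz a + esz l + esz e)" using sz[of e p a] by linarith
  next
    fix l :: "'a list" and p :: 'p and e :: 'e
    let ?n = "esz l + esz p + esz e"
    have "esz l * poly c (esz l + esz e) \<le> ?n * poly c ?n" by (intro mult_mono poly_nat_mono) auto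
    thus "esz (foldl (S e) p l) \<le> poly ([:0,1:] + [:0,1:] * c) ?n"
      using esz_foldl[of "S e" c "esz e" p l, OF sz] by simp
  next
    show "fp (\<lambda>z. S (snd (snd z)) (fst (snd z)) (fst (fst z)))"
      using fp_comp[OF S, of "\<lambda>z. (snd (snd z), fst (snd z), fst (fst z))"] by (simp add: fp_basic)
  qed (auto intro!: fp_basic)
  from fp_comp[OF this, of "\<lambda>x. (L x, I x, x)"] show ?thesis using L I by (simp add: fp_basic)
qed

subsection \<open>Natural numbers\<close>

text \<open>A binary digit costs one cell for its place in the list and a second one if it is
  1.\<close>

lemma esz_nat_bound: "n < 2 ^ k \<Longrightarrow> esz (n::nat) \<le> 2 * k"
proof (induction k arbitrary: n)
  case (Suc k)
  show ?case
  proof (cases "n = 0")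
    case False
    have "esz (odd n) \<le> 1" by (cases "odd n") auto
    moreover have "esz (n div 2) \<le> 2 * k" using Suc by auto
    ultimately show ?thesis using False by (simp add: enc_nat_pos')
  qed simp
qed simp

lemma less_two_pow_esz: "(n::nat) < 2 ^ esz n"
proof (induction n rule: less_induct)
  case (less n)
  show ?case
  proof (cases "n = 0")
    case False
    hence "n div 2 < 2 ^ esz (n div 2)" by (intro less) auto
    hence "n < 2 * 2 ^ esz (n div 2)" by linarith
    also have "\<dots> = 2 ^ (esz (n div 2) + 1)" by simp
    also have "\<dots> \<le> 2 ^ esz n" using False by (intro power_increasing) (auto simp: enc_nat_pos')
    finally show ?thesis .
  qed simp
qed

lemma esz_bool: "esz (b::bool) \<le> 1"
  by (cases b) auto

text \<open>Ones are more expensive than zeros, so the size is not monotone: 7 takes six cells and 8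
  takes five. Hence the factor 2.\<close>

lemma esz_mono: "(m::nat) \<le> n \<Longrightarrow> esz m \<le> 2 * esz n"
  using esz_nat_bound[of m "esz n"] less_two_pow_esz[of n] by linarith

lemma esz_add3: "esz (m + n + k :: nat) \<le> 2 * (esz m + esz n + esz k + 2)"
proof (rule esz_nat_bound)
  let ?N = "2 ^ (esz m + esz n + esz k) :: nat"
  have "2 ^ esz m \<le> ?N" "2 ^ esz n \<le> ?N" "2 ^ esz k \<le> ?N"
    by (auto intro!: power_increasing)
  hence "m < ?N" "n < ?N" "k < ?N"
    using less_two_pow_esz[of m] less_two_pow_esz[of n] less_two_pow_esz[of k] by linarith+
  moreover have "2 ^ (esz m + esz n + esz k + 2) = 4 * ?N" by (simp add: power_add)
  ultimately show "m + n + k < 2 ^ (esz m + esz n + esz k + 2)" by linarith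
qed

lemma esz_mult: "esz (m * n :: nat) \<le> 2 * (esz m + esz n)"
  using less_two_pow_esz[of m] less_two_pow_esz[of n]
  by (intro esz_nat_bound) (auto simp: power_add intro: mult_strict_mono)

text \<open>A number and its bit list have the same tree, so operations on lists apply to
  numbers.\<close>

fun bits :: "nat \<Rightarrow> bool list" where
  "bits n = (if n = 0 then [] else odd n # bits (n div 2))"

declare bits.simps [simp del]

lemma bits_0 [simp]: "bits 0 = []"
  by (simp add: bits.simps)

lemma bits_pos: "n > 0 \<Longrightarrow> bits n = odd n # bits (n div 2)"
  by (subst bits.simps) simp

lemma encode_bits [simp]: "encode (bits n) = encode n"
proof (induction n rule: bits.induct)
  case (1 n) thus ?case by (cases "n = 0") (simp_all add: bits_pos enc_nat_pos')
qed

lemma fp_bits: "fp f \<Longrightarrow> fp (\<lambda>x. bits (f x))"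
  by (rule fp_cong_enc[of f]) simp_all

lemma fp_odd:
  assumes "fp f"
  shows "fp (\<lambda>x. odd (f x :: nat))"
proof (rule fp_cong_enc[OF fp_case_list[where L = "\<lambda>x. bits (f x)" and A = "\<lambda>_. False" and B = "\<lambda>_ b _. b"]])
  show "encode (odd (f x)) = encode (case bits (f x) of [] \<Rightarrow> False | b # _ \<Rightarrow> b)" for x
    by (cases "f x = 0") (auto simp: bits_pos)
qed (intro fp_basic fp_bits assms)+

lemma fp_div2:
  assumes "fp f"
  shows "fp (\<lambda>x. (f x :: nat) div 2)"
proof (rule fp_cong_enc[OF fp_case_list[where L = "\<lambda>x. bits (f x)" and A = "\<lambda>_. []" and B = "\<lambda>_ _ l. l"]])
  show "encode (f x div 2) = encode (case bits (f x) of [] \<Rightarrow> [] | _ # l \<Rightarrow> l)" for x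
    by (cases "f x = 0") (auto simp: bits_pos)
qed (intro fp_basic fp_bits assms)+

text \<open>Encodings have no leading zeros: putting the bit 0 in front of the number 0 must give
  the empty list again.\<close>

lemma fp_bitcons:
  assumes "fp b" "fp n"
  shows "fp (\<lambda>x. 2 * n x + of_bool (b x) :: nat)"
proof (rule fp_cong_enc[of "\<lambda>x. if b x \<or> n x \<noteq> 0 then b x # bits (n x) else []"])
  show "encode (2 * n x + of_bool (b x)) = encode (if b x \<or> n x \<noteq> 0 then b x # bits (n x) else [])" for x
    by (cases "b x") (auto simp: enc_nat_pos')
qed (intro fp_basic fp_bits assms)+

lemma fp_double: "fp n \<Longrightarrow> fp (\<lambda>x. 2 * n x :: nat)"
  using fp_bitcons[OF fp_const[of False]] by simp

lemma fp_inc: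
  assumes "fp n" "fp b"
  shows "fp (\<lambda>x. n x + of_bool (b x) :: nat)"
proof -
  have "fp (\<lambda>z. (\<lambda>(n::nat) (b::bool) (e::bool). n + of_bool b) (fst z) (fst (snd z)) (snd (snd z)))"
  proof (rule fp_rec_nat[where B = "\<lambda>b e. if b then 1 else 0" and H = "\<lambda>c n b e. c \<and> b"
        and G = "\<lambda>c n b e y. 2 * y + of_bool (c \<noteq> b)" and c = 1 and d = "[:6, 2:]"])
    show "esz (n + of_bool b) \<le> poly [:6, 2:] (esz n + esz b + esz e)" for n :: nat and b e :: bool
      using esz_add3[of n "of_bool b" 0] by (cases b) (auto simp: enc_nat_pos')
    show "n + of_bool b = 2 * (n div 2 + of_bool (odd n \<and> b)) + of_bool (odd n \<noteq> b)" for n :: nat and b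
      by (cases b) (auto elim!: oddE)
  qed (auto intro!: fp_basic fp_bitcons simp: order.trans[OF esz_bool])
  from fp_comp[OF this, of "\<lambda>x. (n x, b x, False)"] show ?thesis using assms by (simp add: fp_basic)
qed

text \<open>Ripple-carry addition. The accumulator holds the rest of the second summand and the
  carry; the outgoing carry is the majority of three bits and the digit is their parity.\<close>

lemma fp_add:
  assumes "fp f" "fp g"
  shows "fp (\<lambda>x. f x + g x :: nat)"
proof -
  have "fp (\<lambda>z. (\<lambda>(n::nat) (p::nat \<times> bool) (e::bool). n + fst p + of_bool (snd p)) (fst z) (fst (snd z)) (snd (snd z)))"
  proof (rule fp_rec_nat[where B = "\<lambda>p e. fst p + of_bool (snd p)"
        and H = "\<lambda>b n p e. (fst p div 2, (b \<and> odd (fst p)) \<or> (b \<and> snd p) \<or> (odd (fst p) \<and> snd p))"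
        and G = "\<lambda>b n p e y. 2 * y + of_bool ((b \<noteq> odd (fst p)) \<noteq> snd p)" and c = 1 and d = "[:6, 2:]"])
    show "esz (fst p div 2, (b \<and> odd (fst p)) \<or> (b \<and> snd p) \<or> (odd (fst p) \<and> snd p)) \<le> esz p + poly 1 0"
      for b and p :: "nat \<times> bool"
    proof (cases p)
      case (Pair n c)
      have "esz (n div 2) \<le> esz n" by (cases "n = 0") (auto simp: enc_nat_pos')
      thus ?thesis using esz_bool[of "(b \<and> odd n) \<or> (b \<and> c) \<or> (odd n \<and> c)"] by (simp add: Pair)
    qed
    show "n + fst p + of_bool (snd p) = 2 * (n div 2 + fst (fst p div 2, odd n \<and> odd (fst p) \<or> odd n \<and> snd p \<or> odd (fst p) \<and> snd p) +
         of_bool (snd (fst p div 2, odd n \<and> odd (fst p) \<or> odd n \<and> snd p \<or> odd (fst p) \<and> snd p))) +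
        of_bool ((odd n \<noteq> odd (fst p)) \<noteq> snd p)" for n :: nat and p
      by (cases "odd n"; cases "odd (fst p)"; cases "snd p") (auto elim!: oddE)
    show "esz (n + fst p + of_bool (snd p)) \<le> poly [:6, 2:] (esz n + esz p + esz e)" for n :: nat and p :: "nat \<times> bool" and e :: bool
      using esz_add3[of n "fst p" "of_bool (snd p)"] by (cases p; cases "snd p") (auto simp: enc_nat_pos')
  qed (intro fp_basic fp_bitcons fp_inc fp_odd fp_div2 | simp)+
  from fp_comp[OF this, of "\<lambda>x. (f x, (g x, False), False)"] show ?thesis using assms by (simp add: fp_basic)
qed

text \<open>Shift and add along the bits of the first factor.\<close>

lemma fp_mult:
  assumes "fp f" "fp g"
  shows "fp (\<lambda>x. f x * g x :: nat)"
proof -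
  have "fp (\<lambda>z. (\<lambda>(n::nat) (p::bool) (e::nat). n * e) (fst z) (fst (snd z)) (snd (snd z)))"
  proof (rule fp_rec_nat[where B = "\<lambda>p e. 0" and H = "\<lambda>b n p e. False"
        and G = "\<lambda>b n p e y. (if b then e else 0) + (2 * y + of_bool False)" and c = 1 and d = "[:0, 2:]"])
    show "n * e = (if odd n then e else 0) + (2 * (n div 2 * e) + of_bool False)" for n e :: nat
      by (cases "odd n") (auto elim!: oddE)
    show "esz (n * e) \<le> poly [:0, 2:] (esz n + esz p + esz e)" for n e :: nat and p :: bool
      using esz_mult[of n e] by simp
  qed (auto intro!: fp_basic fp_add fp_double)
  from fp_comp[OF this, of "\<lambda>x. (f x, False, g x)"] show ?thesis using assms by (simp add: fp_basic)
qed

lemma fp_pred: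
  assumes "fp f"
  shows "fp (\<lambda>x. f x - 1 :: nat)"
proof -
  have "fp (\<lambda>z. (\<lambda>(n::nat) (p::bool) (e::bool). n - 1) (fst z) (fst (snd z)) (snd (snd z)))"
  proof (rule fp_rec_nat[where B = "\<lambda>p e. 0" and H = "\<lambda>b n p e. False"
        and G = "\<lambda>b n p e y. 2 * (if b then n else y) + of_bool (\<not> b)" and c = 1 and d = "[:0, 2:]"])
    show "n - 1 = 2 * (if odd n then n div 2 else n div 2 - 1) + of_bool (\<not> odd n)" if "n > 0" for n :: nat
      using that by (auto elim!: oddE evenE)
    show "esz (n - 1) \<le> poly [:0, 2:] (esz n + esz p + esz e)" for n :: nat and p e :: bool
      using esz_mono[of "n - 1" n] by simp
  qed (auto intro!: fp_basic fp_bitcons)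
  from fp_comp[OF this, of "\<lambda>x. (f x, False, False)"] show ?thesis using assms by (simp add: fp_basic)
qed

subsection \<open>Integers\<close>

lemma fp_sign_abs: "fp (\<lambda>k::int. (k < 0, nat \<bar>k\<bar>))"
  by (rule fp_cong_enc[OF fp_ident]) (simp add: enc_int_eq)

lemma fp_neg: "fp f \<Longrightarrow> fp (\<lambda>x. (f x :: int) < 0)"
  using fp_comp[OF fp_fst[OF fp_sign_abs]] by simp

lemma fp_nat_abs: "fp f \<Longrightarrow> fp (\<lambda>x. nat \<bar>f x\<bar>)"
  using fp_comp[OF fp_snd[OF fp_sign_abs]] by simp

lemma fp_intI:
  assumes "fp s" "fp n" "\<And>x. s x \<longleftrightarrow> f x < 0" "\<And>x. n x = nat \<bar>f x\<bar>"
  shows "fp (f :: _ \<Rightarrow> int)"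
  by (rule fp_cong_enc[OF fp_Pair[OF assms(1,2)]]) (simp add: enc_int_eq assms(3,4))

lemma fp_int: "fp f \<Longrightarrow> fp (\<lambda>x. int (f x))"
  by (rule fp_intI[of "\<lambda>_. False" f]) (auto intro: fp_basic)

lemma fp_uminus: "fp f \<Longrightarrow> fp (\<lambda>x. - f x :: int)"
  by (rule fp_intI[of "\<lambda>x. \<not> (f x < 0) \<and> nat \<bar>f x\<bar> \<noteq> 0" "\<lambda>x. nat \<bar>f x\<bar>"])
    (auto intro!: fp_basic fp_neg fp_nat_abs)

lemma fp_int_mult: "fp f \<Longrightarrow> fp g \<Longrightarrow> fp (\<lambda>x. f x * g x :: int)"
  by (rule fp_intI[of "\<lambda>x. (f x < 0) \<noteq> (g x < 0) \<and> f x \<noteq> 0 \<and> g x \<noteq> 0" "\<lambda>x. nat \<bar>f x\<bar> * nat \<bar>g x\<bar>"])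
    (auto intro!: fp_basic fp_neg fp_nat_abs fp_mult simp: mult_less_0_iff abs_mult nat_mult_distrib)

text \<open>One step of bitwise subtraction. As the two bits differ by at most 1, a nonzero
  \<open>y\<close> determines the sign of the result.\<close>

lemma fp_dbl:
  assumes "fp y" "fp s" "fp t"
  shows "fp (\<lambda>x. 2 * y x + of_bool (s x) - of_bool (t x) :: int)"
proof (rule fp_intI)
  show "fp (\<lambda>x. (y x < 0) \<or> (y x = 0 \<and> \<not> s x \<and> t x))" by (intro fp_basic fp_neg assms)
  show "fp (\<lambda>x. if s x = t x then 2 * nat \<bar>y x\<bar> + of_bool False
      else if y x = 0 then 1
      else if (y x < 0) = s x then 2 * (nat \<bar>y x\<bar> - 1) + of_bool True else 2 * nat \<bar>y x\<bar> + of_bool True)"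
    by (intro fp_basic fp_neg assms fp_bitcons fp_pred fp_nat_abs)
qed (auto split: if_splits; presburger)+

lemma esz_int_diff: "esz (int n - int m) \<le> 2 + 2 * (esz n + esz m)"
proof -
  have "nat \<bar>int n - int m\<bar> = (if m \<le> n then n - m else m - n)" by auto
  hence "esz (nat \<bar>int n - int m\<bar>) \<le> 2 * (esz n + esz m)"
    using esz_mono[of "n - m" n] esz_mono[of "m - n" m] by auto
  thus ?thesis using esz_bool[of "int n - int m < 0"]
    by (simp only: enc_int_eq data.size)
qed

text \<open>The signed difference of the halves is computed first and the low bits are added
  afterwards. This avoids borrows and a preliminary comparison.\<close>

lemma fp_nat_diff:
  assumes "fp f" "fp g"
  shows "fp (\<lambda>x. int (f x) - int (g x))"
proof -
  have "fp (\<lambda>z. (\<lambda>(n::nat) (m::nat) (e::bool). int n - int m) (fst z) (fst (snd z)) (snd (snd z)))"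
  proof (rule fp_rec_nat[where B = "\<lambda>m e. - int m" and H = "\<lambda>b n m e. m div 2"
        and G = "\<lambda>b n m e y. 2 * y + of_bool b - of_bool (odd m)" and c = 0 and d = "[:2, 2:]"])
    show "int n - int m = 2 * (int (n div 2) - int (m div 2)) + of_bool (odd n) - of_bool (odd m)" for n m :: nat
      by (cases "odd n"; cases "odd m") (auto elim!: oddE evenE)
    show "esz (m div 2) \<le> esz m + poly 0 0" for m :: nat by (cases "m = 0") (auto simp: enc_nat_pos')
    show "esz (int n - int m) \<le> poly [:2, 2:] (esz n + esz m + esz e)" for n m :: nat and e :: bool
      using esz_int_diff[of n m] by simp
  qed (auto intro!: fp_basic fp_dbl fp_odd fp_div2 fp_uminus fp_int)
  from fp_comp[OF this, of "\<lambda>x. (f x, g x, False)"] show ?thesis using assms by (simp add: fp_basic)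
qed

lemma fp_int_diff:
  assumes "fp f" "fp g"
  shows "fp (\<lambda>x. f x - g x :: int)"
  by (rule fp_cong_enc[of "\<lambda>x. if f x < 0 then
        if g x < 0 then int (nat \<bar>g x\<bar>) - int (nat \<bar>f x\<bar>) else - int (nat \<bar>g x\<bar> + nat \<bar>f x\<bar>)
      else if g x < 0 then int (nat \<bar>g x\<bar> + nat \<bar>f x\<bar>) else int (nat \<bar>f x\<bar>) - int (nat \<bar>g x\<bar>)"])
    (intro fp_basic fp_neg fp_nat_diff fp_uminus fp_int fp_nat_abs fp_add assms, auto)

lemmas fp_intros = fp_basic fp_append fp_concat fp_add fp_mult fp_int fp_int_diff fp_int_mult

section \<open>The algorithm\<close>

type_synonym edge = "(nat \<times> nat list) \<times> nat"

text \<open>Grows a tree directed towards \<open>v\<close>. Newer edges stand in front, so the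
  target of an edge is \<open>v\<close> or the source of a later entry, and \<open>walk\<close>
  reads a path to \<open>v\<close> in one pass.\<close>

definition add_edge :: "nat \<Rightarrow> edge list \<Rightarrow> edge \<Rightarrow> edge list" where
  "add_edge v T t = (if (snd t = v \<or> (\<exists>x\<in>set T. fst (fst x) = snd t)) \<and>
     fst (fst t) \<noteq> v \<and> \<not> (\<exists>x\<in>set T. fst (fst x) = fst (fst t)) then t # T else T)"

text \<open>There are \<open>length tr\<close> passes over all edges. Some run from each state that
  reaches \<open>v\<close> has at most that many edges, and each pass handles at least one more of
  them, counted from \<open>v\<close>.\<close>

definition in_tree :: "edge list \<Rightarrow> nat \<Rightarrow> edge list" where
  "in_tree tr v = foldl (add_edge v) [] (concat (map (\<lambda>_. tr) tr))"

fun walk :: "edge list \<Rightarrow> nat \<Rightarrow> nat list list" where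
  "walk [] p = []"
| "walk (t # T) p = (if fst (fst t) = p then snd (fst t) # walk T (snd t) else walk T p)"

definition reaches :: "edge list \<Rightarrow> nat \<Rightarrow> nat \<Rightarrow> bool" where
  "reaches tr p v \<longleftrightarrow> p = v \<or> (\<exists>t\<in>set (in_tree tr v). fst (fst t) = p)"

definition path :: "edge list \<Rightarrow> nat \<Rightarrow> nat \<Rightarrow> nat list list" where
  "path tr p v = walk (in_tree tr v) p"

text \<open>Total access with default 0. The recursion is on the index, which is a constant of the
  program, so it unrolls to an expression of fixed depth.\<close>

primrec nth0 :: "nat \<Rightarrow> 'a::zero list \<Rightarrow> 'a" where
  "nth0 0 l = (case l of [] \<Rightarrow> 0 | a # _ \<Rightarrow> a)"
| "nth0 (Suc i) l = (case l of [] \<Rightarrow> 0 | _ # l' \<Rightarrow> nth0 i l')"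

primrec val :: "nat \<Rightarrow> nat \<Rightarrow> nat list list \<Rightarrow> nat" where
  "val r i [] = 0"
| "val r i (d # w) = nth0 i d + r * val r i w"

definition short_loops :: "edge list \<Rightarrow> nat list \<Rightarrow> nat \<Rightarrow> nat list list list" where
  "short_loops tr Q q =
     map (\<lambda>t. path tr q (fst (fst t)) @ snd (fst t) # path tr (snd t) q)
       (filter (\<lambda>t. reaches tr q (fst (fst t)) \<and> reaches tr (snd t) q) tr) @
     map (\<lambda>v. path tr q v @ path tr v q) (filter (\<lambda>v. reaches tr q v \<and> reaches tr v q) Q)"

text \<open>This equals \<open>(1 - r ^ length w') * val w - (1 - r ^ length w) * val w'\<close> in
  each coordinate. For nonempty loops it vanishes exactly when the affine maps of the two loops have
  the same fixed point.\<close>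

definition commutator :: "nat \<Rightarrow> nat \<Rightarrow> nat list list \<Rightarrow> nat list list \<Rightarrow> int list" where
  "commutator r m w w' = map (\<lambda>i. int (val r i (w @ w')) - int (val r i (w' @ w))) [0..<m]"

definition generators :: "nat \<Rightarrow> nat \<Rightarrow> edge list \<Rightarrow> nat list \<Rightarrow> nat \<Rightarrow> int list list" where
  "generators r m tr Q q =
     concat (map (\<lambda>w. map (\<lambda>w'. commutator r m w w') (short_loops tr Q q)) (short_loops tr Q q))"

definition elim :: "nat \<Rightarrow> nat \<Rightarrow> int list \<Rightarrow> int list \<Rightarrow> int list" where
  "elim m k u v = map (\<lambda>i. nth0 i v * nth0 k u - nth0 i u * nth0 k v) [0..<m]"

text \<open>Coordinates are treated from the highest down. The pivot \<open>u\<close> is kept in the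
  list, where elimination turns it into the zero vector. No division occurs, so all entries stay
  integers.\<close>

primrec gauss :: "nat \<Rightarrow> nat \<Rightarrow> int list list \<Rightarrow> int list list" where
  "gauss m 0 L = []"
| "gauss m (Suc k) L = (case filter (\<lambda>u. nth0 k u \<noteq> 0) L of
     [] \<Rightarrow> gauss m k L
   | u # _ \<Rightarrow> u # gauss m k (map (elim m k u) L))"

definition useful :: "edge list \<Rightarrow> nat list \<Rightarrow> nat \<Rightarrow> (nat \<times> nat list list) list \<Rightarrow> nat list" where
  "useful tr Q q0 fin = filter (\<lambda>q. reaches tr q0 q \<and> (\<exists>f\<in>set fin. snd f \<noteq> [] \<and> reaches tr q (fst f))) Q"

definition algorithm :: "nat \<Rightarrow> nat \<Rightarrow> nat list \<times> nat \<times> edge list \<times> (nat \<times> nat list list) list \<Rightarrow> int list list list" where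
  "algorithm r m x = (case x of (Q, q0, tr, fin) \<Rightarrow>
     map (\<lambda>q. gauss m m (generators r m tr Q q)) (useful tr Q q0 fin))"

subsection \<open>Running time\<close>

lemma fp_in_tree:
  assumes "fp tr" "fp v"
  shows "fp (\<lambda>x. in_tree (tr x) (v x))"
proof -
  have sz: "esz (add_edge v T t) \<le> esz T + poly [:1, 1:] (esz t + esz e)" for v T t and e :: "edge list \<times> nat"
    by (simp add: add_edge_def)
  have "fp (\<lambda>x. foldl (add_edge (snd x)) [] (concat (map (\<lambda>_. fst x) (fst x))) :: edge list)"
    by (rule fp_foldl[where c = "[:1, 1:]", OF _ _ _ sz]) (unfold add_edge_def, (intro fp_intros fp_map fp_list_ex)+)
  from fp_comp[OF this fp_Pair[OF assms]] show ?thesis by (simp add: in_tree_def)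
qed

lemma esz_walk: "esz (walk T p) \<le> esz T"
proof (induction T arbitrary: p)
  case (Cons t T)
  obtain a d b where t: "t = ((a, d), b)" by (metis surj_pair)
  show ?case using Cons.IH[of b] Cons.IH[of p] by (simp add: t)
qed simp

lemma fp_walk:
  assumes "fp T" "fp p"
  shows "fp (\<lambda>x. walk (T x) (p x))"
proof -
  have "fp (\<lambda>z. (\<lambda>T p (e::bool). walk T p) (fst z) (fst (snd z)) (snd (snd z)))"
  proof (rule fp_rec_list[where B = "\<lambda>p e. []" and G = "\<lambda>t T p e y. if fst (fst t) = p then snd (fst t) # y else y"
        and H = "\<lambda>t T p e. if fst (fst t) = p then snd t else p" and c = "[:0,1:]" and d = "[:0,1:]"])
    show "esz (if fst (fst t) = p then snd t else p) \<le> esz p + poly [:0,1:] (esz t + esz T + esz e)"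
      for t :: edge and T :: "edge list" and p and e :: bool by (cases t) auto
    show "esz (walk T p) \<le> poly [:0,1:] (esz T + esz p + esz e)" for T p and e :: bool
      using esz_walk[of T p] by simp
  qed (intro fp_intros | simp)+
  from fp_comp[OF this, of "\<lambda>x. (T x, p x, False)"] show ?thesis using assms by (simp add: fp_basic)
qed

lemma fp_reaches:
  assumes "fp tr" "fp p" "fp v"
  shows "fp (\<lambda>x. reaches (tr x) (p x) (v x))"
  unfolding reaches_def by (intro fp_intros fp_list_ex fp_in_tree assms fp_comp[OF assms(2)])

lemma fp_path: "fp tr \<Longrightarrow> fp p \<Longrightarrow> fp v \<Longrightarrow> fp (\<lambda>x. path (tr x) (p x) (v x))"
  unfolding path_def by (intro fp_walk fp_in_tree)

lemma fp_nth0':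
  "fp (nth0 i :: 'a::{encodable,zero} list \<Rightarrow> 'a)"
proof (induction i)
  case 0
  show ?case unfolding nth0.simps[abs_def] by (intro fp_case_list fp_intros)
next
  case (Suc i)
  show ?case unfolding nth0.simps[abs_def] by (intro fp_case_list fp_comp[OF Suc] fp_intros)
qed

lemmas fp_nth0 = fp_comp[OF fp_nth0']

lemma nth0_bound: "nth0 i l < (2::nat) ^ esz l"
proof (induction i arbitrary: l)
  case 0
  show ?case
  proof (cases l)
    case (Cons a l')
    have "a < 2 ^ esz a" by (rule less_two_pow_esz)
    also have "\<dots> \<le> 2 ^ esz l" by (rule power_increasing) (auto simp: Cons)
    finally show ?thesis by (simp add: Cons)
  qed simp
next
  case (Suc i)
  show ?case
  proof (cases l)
    case (Cons a l')
    have "nth0 i l' < 2 ^ esz l'" by (rule Suc)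
    also have "\<dots> \<le> 2 ^ esz l" by (rule power_increasing) (auto simp: Cons)
    finally show ?thesis by (simp add: Cons)
  qed simp
qed

text \<open>The exponent \<open>r * length w\<close> comes from \<open>r < 2 ^ r\<close>, one factor
  per letter. Digits are bounded by their encoding and not by \<open>r\<close>, because ill-formed
  inputs are covered too.\<close>

lemma val_bound: "val r i w < 2 ^ (esz w + r * length w)"
proof (induction w)
  case (Cons d w)
  let ?A = "2 ^ esz d :: nat" and ?B = "2 ^ (r + (esz w + r * length w)) :: nat"
  have "r * val r i w < ?B"
    using mult_strict_mono[OF less_exp[of r] Cons] by (simp add: power_add)
  moreover have "nth0 i d < ?A" by (rule nth0_bound)
  moreover have "?A \<le> ?A * ?B" "?B \<le> ?A * ?B" by simp_all
  ultimately have "val r i (d # w) < 2 * (?A * ?B)" by (simp only: val.simps)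
  also have "2 * (?A * ?B) = 2 ^ (esz (d # w) + r * length (d # w))"
    by (simp add: power_add algebra_simps)
  finally show ?case .
qed simp

lemma fp_val:
  assumes "fp w"
  shows "fp (\<lambda>x. val r i (w x))"
proof -
  have "fp (\<lambda>z. (\<lambda>w (p::bool) (e::bool). val r i w) (fst z) (fst (snd z)) (snd (snd z)))"
  proof (rule fp_rec_list[where B = "\<lambda>p e. 0" and G = "\<lambda>d w p e y. nth0 i d + r * y"
        and H = "\<lambda>d w p e. False" and c = 0 and d = "[:0,2 * (r + 1):]"])
    fix w :: "nat list list" and p e :: bool
    have "esz (val r i w) \<le> 2 * (esz w + r * esz w)"
      by (rule order.trans[OF esz_nat_bound[OF val_bound]]) (intro mult_le_mono2 add_left_mono length_le_esz)
    also have "\<dots> = 2 * (r + 1) * esz w" by (simp add: algebra_simps)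
    also have "\<dots> \<le> 2 * (r + 1) * (esz w + esz p + esz e)" by (intro mult_left_mono) auto
    finally show "esz (val r i w) \<le> poly [:0, 2 * (r + 1):] (esz w + esz p + esz e)"
      by (simp add: algebra_simps)
  qed (intro fp_intros fp_nth0 | simp)+
  from fp_comp[OF this, of "\<lambda>x. (w x, False, False)"] show ?thesis using assms by (simp add: fp_basic)
qed

lemma fp_map_const: "(\<And>i. i \<in> set is \<Longrightarrow> fp (F i)) \<Longrightarrow> fp (\<lambda>x. map (\<lambda>i. F i x) is)"
  by (induction "is") (auto intro!: fp_intros)

lemma fp_short_loops:
  assumes "fp tr" "fp Q" "fp q"
  shows "fp (\<lambda>x. short_loops (tr x) (Q x) (q x))"
  unfolding short_loops_def
  by (intro fp_intros fp_map fp_filter fp_path fp_reaches assms fp_comp[OF assms(1)] fp_comp[OF assms(2)] fp_comp[OF assms(3)])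

lemma fp_commutator:
  assumes "fp w" "fp w'"
  shows "fp (\<lambda>x. commutator r m (w x) (w' x))"
  unfolding commutator_def by (intro fp_map_const fp_intros fp_val assms)

lemma fp_generators:
  assumes "fp tr" "fp Q" "fp q"
  shows "fp (\<lambda>x. generators r m (tr x) (Q x) (q x))"
proof -
  have 1: "fp (\<lambda>x. short_loops (tr x) (Q x) (q x))" by (rule fp_short_loops[OF assms])
  show ?thesis unfolding generators_def
    by (intro fp_concat fp_map 1 fp_comp[OF 1] fp_commutator fp_fst fp_snd fp_ident)
qed

lemma fp_elim:
  assumes "fp u" "fp v"
  shows "fp (\<lambda>x. elim m k (u x) (v x))"
  unfolding elim_def by (intro fp_map_const fp_intros fp_nth0 assms)

text \<open>The induction on \<open>k\<close> takes place outside the machine: each \<open>k\<close>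
  has its own program and its own polynomial.\<close>

lemma fp_gauss': "fp (gauss m k)"
proof (induction k)
  case 0
  show ?case unfolding gauss.simps[abs_def] by (rule fp_const)
next
  case (Suc k)
  show ?case unfolding gauss.simps[abs_def]
    by (intro fp_case_list fp_filter fp_comp[OF Suc] fp_map fp_elim fp_intros fp_nth0)
qed

lemmas fp_gauss = fp_comp[OF fp_gauss']

lemma fp_algorithm: "fp (algorithm r m)"
proof -
  have "fp (\<lambda>x. map (\<lambda>q. gauss m m (generators r m (fst (snd (snd x))) (fst x) q))
     (useful (fst (snd (snd x))) (fst x) (fst (snd x)) (snd (snd (snd x)))))"
    unfolding useful_def
    by (intro fp_map fp_gauss fp_generators fp_filter fp_intros fp_reaches fp_list_ex)
  thus ?thesis by (simp add: algorithm_def[abs_def] case_prod_beta)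
qed

lemma fp_algorithm_output: "fp (\<lambda>x. map (map (map (\<lambda>k. (k, 1::int)))) (algorithm r m x))"
  by (intro fp_map fp_intros fp_algorithm)

section \<open>Runs and short loops\<close>

fun runs :: "edge set \<Rightarrow> nat \<Rightarrow> nat list list \<Rightarrow> nat \<Rightarrow> bool" where
  "runs E p [] q \<longleftrightarrow> p = q"
| "runs E p (d # w) q \<longleftrightarrow> (\<exists>p'. ((p, d), p') \<in> E \<and> runs E p' w q)"

lemma runs_append: "runs E p (u @ w) q \<longleftrightarrow> (\<exists>s. runs E p u s \<and> runs E s w q)"
  by (induction u arbitrary: p) auto

section \<open>Correctness of the search trees\<close>

lemma add_edge_keys:
  "fst ` fst ` set T \<subseteq> fst ` fst ` set (add_edge v T t)"
  "snd t \<in> insert v (fst ` fst ` set T) \<Longrightarrow> fst (fst t) \<in> insert v (fst ` fst ` set (add_edge v T t))"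
  unfolding add_edge_def by (auto intro: rev_image_eqI)

lemma foldl_add_edge_keys: "fst ` fst ` set T \<subseteq> fst ` fst ` set (foldl (add_edge v) T l)"
proof (induction l arbitrary: T)
  case (Cons t l)
  have "fst ` fst ` set T \<subseteq> fst ` fst ` set (add_edge v T t)" by (rule add_edge_keys)
  also have "\<dots> \<subseteq> fst ` fst ` set (foldl (add_edge v) (add_edge v T t) l)" by (rule Cons)
  finally show ?case by simp
qed simp

text \<open>One pass settles the sources of all edges whose targets were settled before it.\<close>

lemma foldl_add_edge_closed:
  "t \<in> set l \<Longrightarrow> snd t \<in> insert v (fst ` fst ` set T) \<Longrightarrow>
     fst (fst t) \<in> insert v (fst ` fst ` set (foldl (add_edge v) T l))"
proof (induction l arbitrary: T)
  case (Cons s l)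
  have m: "insert v (fst ` fst ` set T) \<subseteq> insert v (fst ` fst ` set (add_edge v T s))"
    using add_edge_keys(1)[of T v s] by blast
  show ?case
  proof (cases "t = s")
    case True
    with add_edge_keys(2)[OF Cons.prems(2)] foldl_add_edge_keys[of "add_edge v T s" v l]
    show ?thesis by auto
  next
    case False
    with Cons m have "fst (fst t) \<in> insert v (fst ` fst ` set (foldl (add_edge v) (add_edge v T s) l))"
      by (intro Cons.IH) auto
    thus ?thesis by simp
  qed
qed simp

text \<open>After \<open>n\<close> passes every state with a run of length at most \<open>n\<close>
  to \<open>v\<close> is settled. The list \<open>l\<close> only counts the passes.\<close>

lemma in_tree_complete_aux:
  "runs (set tr) p w v \<Longrightarrow> length w \<le> length l \<Longrightarrow>
     p \<in> insert v (fst ` fst ` set (foldl (add_edge v) [] (concat (map (\<lambda>_. tr) l))))"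
proof (induction l arbitrary: p w rule: rev_induct)
  case (snoc x l)
  let ?T = "foldl (add_edge v) [] (concat (map (\<lambda>_. tr) l))"
  have eq: "foldl (add_edge v) [] (concat (map (\<lambda>_. tr) (l @ [x]))) = foldl (add_edge v) ?T tr" by simp
  show ?case
  proof (cases w)
    case Nil
    thus ?thesis using snoc.prems by simp
  next
    case (Cons d w')
    then obtain p' where p': "((p, d), p') \<in> set tr" "runs (set tr) p' w' v" using snoc.prems by auto
    have "p' \<in> insert v (fst ` fst ` set ?T)" using p' snoc Cons by (intro snoc.IH) auto
    thus ?thesis unfolding eq using foldl_add_edge_closed[OF p'(1), of v ?T] by simp
  qed
qed simp

lemma runs_imp_rtrancl: "runs E p w v \<Longrightarrow> (p, v) \<in> {(a, b). \<exists>d. ((a, d), b) \<in> E}\<^sup>*"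
  by (induction w arbitrary: p) (auto intro: converse_rtrancl_into_rtrancl)

lemma relpow_imp_runs: "(p, v) \<in> {(a, b). \<exists>d. ((a, d), b) \<in> E} ^^ n \<Longrightarrow> \<exists>w. length w = n \<and> runs E p w v"
proof (induction n arbitrary: p)
  case (Suc n)
  then obtain p' d where "((p, d), p') \<in> E" "(p', v) \<in> {(a, b). \<exists>d. ((a, d), b) \<in> E} ^^ n"
    by (elim relpow_Suc_E2) auto
  with Suc.IH[of p'] obtain w where "length w = n" "runs E p' w v" by blast
  with \<open>((p, d), p') \<in> E\<close> show ?case by (intro exI[of _ "d # w"]) auto
qed simp

lemma short_run:
  assumes "runs (set tr) p w v"
  obtains w' where "runs (set tr) p w' v" "length w' \<le> length tr"
proof -
  let ?R = "{(a, b). \<exists>d. ((a, d), b) \<in> set tr}"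
  have R: "?R = (\<lambda>t. (fst (fst t), snd t)) ` set tr" by force
  have fin: "finite ?R" unfolding R by simp
  have card: "card ?R \<le> length tr"
    unfolding R using card_image_le[of "set tr"] card_length[of tr] by (meson List.finite_set le_trans)
  from runs_imp_rtrancl[OF assms] obtain n where "n \<le> card ?R" "(p, v) \<in> ?R ^^ n"
    unfolding rtrancl_finite_eq_relpow[OF fin] by blast
  with relpow_imp_runs[where E = "set tr" and n = n and p = p and v = v]
  obtain w' where "length w' = n" "runs (set tr) p w' v" by blast
  with \<open>n \<le> card ?R\<close> card that show thesis by simp
qed

text \<open>Invariant of the construction. A new edge points to a settled state, whose walk is
  already correct, and \<open>v\<close> never becomes a source, so walks stop there.\<close>

lemma walk_foldl:
  assumes "\<forall>p\<in>insert v (fst ` fst ` set T). runs E p (walk T p) v" "v \<notin> fst ` fst ` set T" "set l \<subseteq> E"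
  shows "\<forall>p\<in>insert v (fst ` fst ` set (foldl (add_edge v) T l)). runs E p (walk (foldl (add_edge v) T l) p) v"
  using assms
proof (induction l arbitrary: T)
  case (Cons t l)
  obtain a d b where t: "t = ((a, d), b)" by (metis surj_pair)
  have "\<forall>p\<in>insert v (fst ` fst ` set (add_edge v T t)). runs E p (walk (add_edge v T t) p) v \<and>
    v \<notin> fst ` fst ` set (add_edge v T t)"
  proof (cases "b \<in> insert v (fst ` fst ` set T) \<and> a \<noteq> v \<and> a \<notin> fst ` fst ` set T")
    case True
    note T = this
    hence "add_edge v T t = t # T" unfolding add_edge_def t by force
    moreover have "((a, d), b) \<in> E" using Cons.prems(3) t by simp
    moreover have "runs E p (walk (t # T) p) v" if "p \<in> insert v (insert a (fst ` fst ` set T))" for p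
    proof (cases "p = a")
      case True
      have "runs E b (walk T b) v" using Cons.prems(1) T by blast
      thus ?thesis using \<open>((a, d), b) \<in> E\<close> True by (auto simp: t)
    next
      case False
      hence "runs E p (walk T p) v" using that Cons.prems(1) by blast
      thus ?thesis using False by (simp add: t)
    qed
    ultimately show ?thesis using Cons.prems True by (simp add: t)
  next
    case False
    hence "add_edge v T t = T" unfolding add_edge_def t by force
    thus ?thesis using Cons.prems by simp
  qed
  thus ?case using Cons.prems(3) Cons.IH[of "add_edge v T t"] by simp
qed simp

lemma reaches_iff: "reaches tr p v \<longleftrightarrow> (\<exists>w. runs (set tr) p w v)"
  and path_runs: "reaches tr p v \<Longrightarrow> runs (set tr) p (path tr p v) v"
proof -
  have key: "reaches tr p v \<longleftrightarrow> p \<in> insert v (fst ` fst ` set (in_tree tr v))"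
    unfolding reaches_def by (force simp: image_iff)
  show *: "runs (set tr) p (path tr p v) v" if "reaches tr p v"
  proof -
    have "set (concat (map (\<lambda>_. tr) tr)) \<subseteq> set tr" by auto
    from walk_foldl[OF _ _ this, of v "[]"]
    have "\<forall>p\<in>insert v (fst ` fst ` set (in_tree tr v)). runs (set tr) p (walk (in_tree tr v) p) v"
      unfolding in_tree_def by simp
    thus ?thesis using that unfolding key path_def by blast
  qed
  show "reaches tr p v \<longleftrightarrow> (\<exists>w. runs (set tr) p w v)"
  proof
    assume "\<exists>w. runs (set tr) p w v"
    then obtain w where "runs (set tr) p w v" "length w \<le> length tr" using short_run by metis
    from in_tree_complete_aux[OF this] show "reaches tr p v" unfolding key in_tree_def .
  qed (use * in blast)
qed

text \<open>Lets the replacement of a run by chosen paths start with the empty word and end with the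
  loop itself.\<close>

lemma path_self [simp]: "path tr q q = []"
proof -
  have "v \<notin> fst ` fst ` set T \<Longrightarrow> v \<notin> fst ` fst ` set (foldl (add_edge v) T l)" for v T l
  proof (induction l arbitrary: T)
    case (Cons t l)
    have "v \<notin> fst ` fst ` set (add_edge v T t)" using Cons.prems unfolding add_edge_def by auto
    thus ?case using Cons.IH by simp
  qed simp
  moreover have "v \<notin> fst ` fst ` set T \<Longrightarrow> walk T v = []" for v T by (induction T) auto
  ultimately show ?thesis unfolding path_def in_tree_def by simp
qed

lemma val_append: "val r i (u @ w) = val r i u + r ^ length u * val r i w"
  by (induction u) (auto simp: algebra_simps)

lemma short_loops_runs: "w \<in> set (short_loops tr Q q) \<Longrightarrow> runs (set tr) q w q"
  unfolding short_loops_def using path_runs by (force simp: runs_append)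

section \<open>Common fixed points of loops\<close>

definition linear_pred :: "((nat \<Rightarrow> rat) \<Rightarrow> bool) \<Rightarrow> bool" where
  "linear_pred U \<longleftrightarrow> U (\<lambda>_. 0) \<and> (\<forall>f g. U f \<longrightarrow> U g \<longrightarrow> U (\<lambda>i. f i + g i)) \<and> (\<forall>c f. U f \<longrightarrow> U (\<lambda>i. c * f i))"

lemma linear_predD:
  assumes "linear_pred U"
  shows "U (\<lambda>_. 0)" "U f \<Longrightarrow> U g \<Longrightarrow> U (\<lambda>i. f i + g i)" "U f \<Longrightarrow> U (\<lambda>i. c * f i)"
    "U f \<Longrightarrow> U g \<Longrightarrow> U (\<lambda>i. f i - g i)"
proof -
  show 1: "U (\<lambda>_. 0)" and 2: "U f \<Longrightarrow> U g \<Longrightarrow> U (\<lambda>i. f i + g i)" and 3: "U f \<Longrightarrow> U (\<lambda>i. c * f i)" for f g c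
    using assms unfolding linear_pred_def by blast+
  show "U f \<Longrightarrow> U g \<Longrightarrow> U (\<lambda>i. f i - g i)"
    using 2[of f "\<lambda>i. -1 * g i"] 3[of g "-1"] by simp
qed

abbreviation qval :: "nat \<Rightarrow> nat list list \<Rightarrow> nat \<Rightarrow> rat" where
  "qval r w i \<equiv> of_nat (val r i w)"

text \<open>A loop \<open>w\<close> acts on vectors as an affine map with fixed point \<open>qval w / (1 - r ^ length w)\<close>. Modulo a
  linear space containing the commutators of the short loops, all short loops have the same fixed point
  \<open>x\<close>; replacing a run \<open>u\<close> from \<open>q\<close> to \<open>p\<close> by the chosen one, one digit at a time, shows
  that it is fixed by all loops.\<close>

lemma loops_common_fixpoint:
  assumes r: "r \<ge> 2" and Q: "\<And>a d b. ((a, d), b) \<in> set tr \<Longrightarrow> a \<in> set Q \<and> b \<in> set Q" "q \<in> set Q"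
    and U: "linear_pred U"
    and comm: "\<And>w w'. w \<in> set (short_loops tr Q q) \<Longrightarrow> w' \<in> set (short_loops tr Q q) \<Longrightarrow>
      U (\<lambda>i. qval r (w @ w') i - qval r (w' @ w) i)"
    and ne: "\<exists>w\<in>set (short_loops tr Q q). w \<noteq> []"
  shows "\<exists>x. \<forall>w. runs (set tr) q w q \<longrightarrow> U (\<lambda>i. qval r w i - (1 - of_nat r ^ length w) * x i)"
proof -
  obtain w0 where w0: "w0 \<in> set (short_loops tr Q q)" "w0 \<noteq> []" using ne by blast
  define R :: rat where "R = of_nat r"
  have R: "R > 1" using r by (simp add: R_def)
  have pow: "1 - R ^ length w \<noteq> 0" if "w \<noteq> []" for w :: "nat list list"
    using one_less_power[OF R, of "length w"] that by auto
  define x where "x = (\<lambda>i. qval r w0 i / (1 - R ^ length w0))"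
  define fixes_x where "fixes_x = (\<lambda>w. U (\<lambda>i. qval r w i - (1 - R ^ length w) * x i))"
  note [simp] = linear_predD(1)[OF U]
  have short: "fixes_x w" if "w \<in> set (short_loops tr Q q)" for w
  proof -
    \<comment> \<open>As \<open>qval w0 = (1 - R ^ length w0) * x\<close>, the commutator of
      \<open>w\<close> and \<open>w0\<close> is \<open>1 - R ^ length w0\<close> times the
      expression in \<open>fixes_x w\<close>.\<close>
    have "U (\<lambda>i. 1 / (1 - R ^ length w0) * (qval r (w @ w0) i - qval r (w0 @ w) i))"
      by (intro linear_predD(3)[OF U] comm that w0)
    also have "(\<lambda>i. 1 / (1 - R ^ length w0) * (qval r (w @ w0) i - qval r (w0 @ w) i)) =
        (\<lambda>i. qval r w i - (1 - R ^ length w) * x i)"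
      using pow[OF w0(2)] by (intro ext) (simp add: x_def val_append field_simps R_def)
    finally show ?thesis unfolding fixes_x_def .
  qed
  \<comment> \<open>Replacing the tail \<open>b\<close> by \<open>c\<close> changes the defect from
    the fixed point by \<open>R ^ length u\<close> times a quantity depending on \<open>b\<close>
    and \<open>c\<close> only. The change behind \<open>u\<close> is therefore a multiple of the
    change behind \<open>a\<close>.\<close>
  have exch: "fixes_x (u @ c)" if "fixes_x (u @ b)" "fixes_x (a @ b)" "fixes_x (a @ c)" for u a b c
  proof -
    have "U (\<lambda>i. (qval r (u @ b) i - (1 - R ^ length (u @ b)) * x i)
        - R ^ length u / R ^ length a * ((qval r (a @ b) i - (1 - R ^ length (a @ b)) * x i)
        - (qval r (a @ c) i - (1 - R ^ length (a @ c)) * x i)))"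
      using that unfolding fixes_x_def
      by (rule linear_predD(4)[OF U _ linear_predD(3)[OF U linear_predD(4)[OF U]]])
    also have "(\<lambda>i. (qval r (u @ b) i - (1 - R ^ length (u @ b)) * x i)
        - R ^ length u / R ^ length a * ((qval r (a @ b) i - (1 - R ^ length (a @ b)) * x i)
        - (qval r (a @ c) i - (1 - R ^ length (a @ c)) * x i))) =
        (\<lambda>i. qval r (u @ c) i - (1 - R ^ length (u @ c)) * x i)"
      using R by (intro ext) (simp add: val_append power_add field_simps R_def)
    finally show ?thesis unfolding fixes_x_def .
  qed
  have "fixes_x (u @ path tr p q)" if "runs (set tr) q u p" "reaches tr p q" for u p
    using that
  proof (induction u arbitrary: p rule: rev_induct)
    case Nil
    have eq: "q = p" using Nil by simp
    have rq: "reaches tr q q" by (simp add: reaches_def)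
    have "path tr q q @ path tr q q \<in> set (short_loops tr Q q)"
      unfolding short_loops_def set_append set_map using Q(2) rq by (intro UnI2 imageI) simp
    hence "[] \<in> set (short_loops tr Q q)" by simp
    from short[OF this] show ?case using eq by simp
  next
    case (snoc d u)
    then obtain s where s: "runs (set tr) q u s" "((s, d), p) \<in> set tr" by (auto simp: runs_append)
    have "runs (set tr) s (d # path tr p q) q" using s path_runs[OF snoc.prems(2)] by auto
    hence rs: "reaches tr s q" unfolding reaches_iff by blast
    have qs: "reaches tr q s" using s unfolding reaches_iff by blast
    \<comment> \<open>Exchange of tails with the chosen path to \<open>s\<close> as
      \<open>a\<close>: the short loop through the state \<open>s\<close> and the one through the
      edge from \<open>s\<close> to \<open>p\<close> differ exactly in the tail that has to be
      replaced behind \<open>u\<close>.\<close>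
    have 1: "fixes_x (u @ path tr s q)" by (rule snoc.IH[OF s(1) rs])
    have 2: "fixes_x (path tr q s @ path tr s q)"
      using Q(1)[OF s(2)] qs rs by (intro short) (auto simp: short_loops_def)
    have 3: "fixes_x (path tr q s @ d # path tr p q)"
      using s(2) qs snoc.prems(2) by (intro short) (force simp: short_loops_def)
    from exch[OF 1 2 3] show ?case by simp
  qed
  note all = this
  have "fixes_x w" if "runs (set tr) q w q" for w
    using all[OF that] by (simp add: reaches_def)
  thus ?thesis unfolding fixes_x_def R_def by blast
qed

text \<open>Loops of equal length have the same factor in front of the common fixed point, which
  cancels in the difference.\<close>

lemma equal_length_loops:
  assumes "r \<ge> 2" "\<And>a d b. ((a, d), b) \<in> set tr \<Longrightarrow> a \<in> set Q \<and> b \<in> set Q" "q \<in> set Q"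
    and U: "linear_pred U"
    and comm: "\<And>w w'. w \<in> set (short_loops tr Q q) \<Longrightarrow> w' \<in> set (short_loops tr Q q) \<Longrightarrow>
      U (\<lambda>i. qval r (w @ w') i - qval r (w' @ w) i)"
    and w: "runs (set tr) q w q" "runs (set tr) q w' q" "length w = length w'"
  shows "U (\<lambda>i. qval r w i - qval r w' i)"
proof (cases "w = []")
  case True
  thus ?thesis using w linear_predD(1)[OF U] by simp
next
  case False
  then obtain d w1 p where "w = d # w1" "((q, d), p) \<in> set tr" "runs (set tr) p w1 q"
    using w(1) by (cases w) auto
  hence "path tr q q @ d # path tr p q \<in> set (short_loops tr Q q)"
    unfolding short_loops_def by (force simp: reaches_iff intro: exI[of _ "[]"])
  hence "\<exists>w\<in>set (short_loops tr Q q). w \<noteq> []" by blast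
  have "\<exists>x. \<forall>w. runs (set tr) q w q \<longrightarrow> U (\<lambda>i. qval r w i - (1 - of_nat r ^ length w) * x i)"
    by (rule loops_common_fixpoint[where Q = Q]) (fact assms(1) assms(2) assms(3) U comm | fact)+
  then obtain x where
    x: "\<And>w. runs (set tr) q w q \<Longrightarrow> U (\<lambda>i. qval r w i - (1 - of_nat r ^ length w) * x i)" by blast
  from linear_predD(4)[OF U x[OF w(1)] x[OF w(2)]] w(3) show ?thesis by simp
qed

section \<open>Subspaces of the rational vector space\<close>

lemma subspace_Q_iff:
  "subspace_Q m W \<longleftrightarrow> W \<subseteq> carrier_vec m \<and> 0\<^sub>v m \<in> W \<and> (\<forall>x\<in>W. \<forall>y\<in>W. x + y \<in> W) \<and> (\<forall>c. \<forall>x\<in>W. c \<cdot>\<^sub>v x \<in> W)"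
proof -
  interpret V: vec_space "TYPE(rat)" m .
  show ?thesis
    unfolding subspace_Q_def VectorSpace.subspace_def submodule_def
    using V.vectorspace_axioms V.module_axioms by (auto simp: module_vec_simps)
qed

lemma subspace_QD:
  assumes "subspace_Q m W"
  shows "W \<subseteq> carrier_vec m" "0\<^sub>v m \<in> W" "x \<in> W \<Longrightarrow> y \<in> W \<Longrightarrow> x + y \<in> W" "x \<in> W \<Longrightarrow> c \<cdot>\<^sub>v x \<in> W"
    "x \<in> W \<Longrightarrow> y \<in> W \<Longrightarrow> x - y \<in> W"
proof -
  show 1: "W \<subseteq> carrier_vec m" "0\<^sub>v m \<in> W" and 2: "x \<in> W \<Longrightarrow> y \<in> W \<Longrightarrow> x + y \<in> W"
    and 3: "x \<in> W \<Longrightarrow> c \<cdot>\<^sub>v x \<in> W" for x y c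
    using assms unfolding subspace_Q_iff by blast+
  assume xy: "x \<in> W" "y \<in> W"
  hence "x - y = x + (-1) \<cdot>\<^sub>v y" using 1 by (intro eq_vecI) auto
  thus "x - y \<in> W" using 2 3 xy by simp
qed

lemma subspace_span_Q: "B \<subseteq> carrier_vec m \<Longrightarrow> subspace_Q m (span_Q m B)"
proof -
  interpret V: vec_space "TYPE(rat)" m .
  assume "B \<subseteq> carrier_vec m"
  thus ?thesis unfolding subspace_Q_def span_Q_def using V.span_is_subspace by simp
qed

lemma span_Q_superset: "B \<subseteq> carrier_vec m \<Longrightarrow> B \<subseteq> span_Q m B"
proof -
  interpret V: vec_space "TYPE(rat)" m .
  assume "B \<subseteq> carrier_vec m"
  thus ?thesis unfolding span_Q_def using V.in_own_span by simp
qed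

lemma span_Q_minimal: "subspace_Q m W \<Longrightarrow> B \<subseteq> W \<Longrightarrow> span_Q m B \<subseteq> W"
proof -
  interpret V: vec_space "TYPE(rat)" m .
  assume "subspace_Q m W" "B \<subseteq> W"
  thus ?thesis unfolding span_Q_def subspace_Q_def VectorSpace.subspace_def
    using V.span_is_subset by blast
qed

lemma span_Q_mono: "B \<subseteq> C \<Longrightarrow> C \<subseteq> carrier_vec m \<Longrightarrow> span_Q m B \<subseteq> span_Q m C"
  using span_Q_minimal[OF subspace_span_Q] span_Q_superset by blast

lemma span_Q_eqI:
  "B \<subseteq> span_Q m C \<Longrightarrow> C \<subseteq> span_Q m B \<Longrightarrow> B \<subseteq> carrier_vec m \<Longrightarrow> C \<subseteq> carrier_vec m \<Longrightarrow> span_Q m B = span_Q m C"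
  by (intro equalityI span_Q_minimal subspace_span_Q)

lemma lin_indpt_Q_empty: "lin_indpt_Q m {}"
proof -
  interpret V: vec_space "TYPE(rat)" m .
  show ?thesis unfolding lin_indpt_Q_def V.lin_dep_def by auto
qed

lemma lin_indpt_Q_insert:
  assumes "lin_indpt_Q m B" "B \<subseteq> carrier_vec m" "v \<in> carrier_vec m" "v \<notin> span_Q m B"
  shows "lin_indpt_Q m (insert v B)"
proof -
  interpret V: vec_space "TYPE(rat)" m .
  have "v \<notin> B" using span_Q_superset assms by blast
  thus ?thesis using V.lin_dep_iff_in_span[of B v] assms unfolding lin_indpt_Q_def span_Q_def by simp
qed

lemma lin_indpt_Q_card:
  assumes "lin_indpt_Q m B" "B \<subseteq> carrier_vec m"
  shows "finite B \<and> card B \<le> m"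
proof -
  interpret V: vec_space "TYPE(rat)" m .
  show ?thesis using V.li_le_dim[of B] assms unfolding lin_indpt_Q_def by (simp add: V.dim_is_n)
qed

text \<open>An independent subset of largest size; sizes are at most \<open>m\<close>, so it exists
  even if \<open>S\<close> is infinite.\<close>

lemma finite_spanning_subset:
  assumes "S \<subseteq> carrier_vec m"
  obtains B where "finite B" "B \<subseteq> S" "S \<subseteq> span_Q m B"
proof -
  define N where "N = {card B |B. B \<subseteq> S \<and> lin_indpt_Q m B}"
  have "N \<subseteq> {..m}" unfolding N_def using lin_indpt_Q_card assms by blast
  hence fin: "finite N" using finite_subset by blast
  have "0 \<in> N" unfolding N_def using lin_indpt_Q_empty by force
  hence "Max N \<in> N" using Max_in[OF fin] by blast
  then obtain B where B: "B \<subseteq> S" "lin_indpt_Q m B" "card B = Max N" unfolding N_def by auto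
  have finB: "finite B" using B lin_indpt_Q_card assms by blast
  have "v \<in> span_Q m B" if "v \<in> S" for v
  proof (rule ccontr)
    assume n: "v \<notin> span_Q m B"
    hence "lin_indpt_Q m (insert v B)" using B assms that by (intro lin_indpt_Q_insert) auto
    hence "card (insert v B) \<in> N" unfolding N_def using B that by blast
    hence "card (insert v B) \<le> card B" using Max_ge[OF fin] B by simp
    moreover have "v \<notin> B" using n span_Q_superset B assms by blast
    ultimately show False using finB by simp
  qed
  with B finB that show thesis by blast
qed

section \<open>Correctness of the elimination\<close>

definition rvec :: "nat \<Rightarrow> int list \<Rightarrow> rat vec" where
  "rvec m l = vec m (\<lambda>i. rat_of_int (nth0 i l))"

lemma nth0_nth: "i < length l \<Longrightarrow> nth0 i l = l ! i"
  by (induction i arbitrary: l) (auto split: list.splits)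

lemma rvec_carrier [simp]: "rvec m l \<in> carrier_vec m"
  by (simp add: rvec_def)

lemma dim_rvec [simp]: "dim_vec (rvec m l) = m"
  by (simp add: rvec_def)

lemma rvec_index [simp]: "i < m \<Longrightarrow> rvec m l $ i = rat_of_int (nth0 i l)"
  by (simp add: rvec_def)

lemma rvec_image_carrier [simp]: "rvec m ` L \<subseteq> carrier_vec m"
  by auto

lemma rvec_eq_vec_of_list: "length l = m \<Longrightarrow> rvec m l = vec_of_list (map rat_of_int l)"
  by (intro eq_vecI) (auto simp: nth0_nth vec_of_list_index)

lemma nth0_elim: "i < m \<Longrightarrow> nth0 i (elim m k u v) = nth0 i v * nth0 k u - nth0 i u * nth0 k v"
  by (simp add: elim_def nth0_nth)

lemma rvec_elim:
  "rvec m (elim m k u v) = rat_of_int (nth0 k u) \<cdot>\<^sub>v rvec m v - rat_of_int (nth0 k v) \<cdot>\<^sub>v rvec m u"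
  by (intro eq_vecI) (auto simp: nth0_elim rvec_def)

text \<open>Invariant: the coordinates from \<open>k\<close> on vanish. After a pivot step the
  remaining vectors vanish at \<open>k\<close> and the pivot does not, which gives independence and
  distinctness. A vector is recovered from its reduced form and the pivot by dividing by the pivot
  entry, so the span is kept.\<close>

lemma gauss_correct:
  assumes "k \<le> m" "\<And>l i. l \<in> set L \<Longrightarrow> k \<le> i \<Longrightarrow> i < m \<Longrightarrow> nth0 i l = 0"
  shows "span_Q m (rvec m ` set (gauss m k L)) = span_Q m (rvec m ` set L) \<and>
    distinct (map (rvec m) (gauss m k L)) \<and> lin_indpt_Q m (rvec m ` set (gauss m k L))"
  using assms
proof (induction k arbitrary: L)
  case 0
  have "rvec m ` set L \<subseteq> span_Q m {}"
  proof
    fix v assume "v \<in> rvec m ` set L"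
    hence "v = 0\<^sub>v m" using 0 by (auto intro!: eq_vecI)
    thus "v \<in> span_Q m {}" using subspace_QD(2)[OF subspace_span_Q[of "{}"]] by simp
  qed
  hence "span_Q m {} = span_Q m (rvec m ` set L)" by (intro span_Q_eqI) auto
  thus ?case using lin_indpt_Q_empty by simp
next
  case (Suc k)
  show ?case
  proof (cases "filter (\<lambda>u. nth0 k u \<noteq> 0) L")
    case Nil
    hence "nth0 k l = 0" if "l \<in> set L" for l using that by (auto simp: filter_empty_conv)
    hence "nth0 i l = 0" if "l \<in> set L" "k \<le> i" "i < m" for l i
      using that Suc.prems(2)[of l i] by (cases "i = k") auto
    from Suc.IH[OF _ this] Suc.prems(1) Nil show ?thesis by simp
  next
    case (Cons u us)
    hence "u \<in> set (filter (\<lambda>u. nth0 k u \<noteq> 0) L)" by simp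
    hence u: "u \<in> set L" "nth0 k u \<noteq> 0" by auto
    let ?L = "map (elim m k u) L" and ?B = "gauss m k (map (elim m k u) L)"
    have L0: "nth0 i l = 0" if "l \<in> set ?L" "k \<le> i" "i < m" for l i
    proof -
      from that obtain v where v: "v \<in> set L" "l = elim m k u v" by auto
      show ?thesis using that(2,3) Suc.prems(2)[OF v(1), of i] Suc.prems(2)[OF u(1), of i]
        by (cases "i = k") (auto simp: v(2) nth0_elim)
    qed
    have IH: "span_Q m (rvec m ` set ?B) = span_Q m (rvec m ` set ?L)"
      "distinct (map (rvec m) ?B)" "lin_indpt_Q m (rvec m ` set ?B)"
      using Suc.IH[of ?L] L0 Suc.prems(1) by auto
    have g: "gauss m (Suc k) L = u # ?B" using Cons by simp
    have sub0: "subspace_Q m {x \<in> carrier_vec m. x $ k = 0}"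
      unfolding subspace_Q_iff using Suc.prems(1) by auto
    have "span_Q m (rvec m ` set ?L) \<subseteq> {x \<in> carrier_vec m. x $ k = 0}"
      using Suc.prems(1) L0[where i = k] by (intro span_Q_minimal[OF sub0]) auto
    hence nin: "rvec m u \<notin> span_Q m (rvec m ` set ?B)"
      unfolding IH(1) using u(2) Suc.prems(1) by auto
    have nin': "rvec m u \<notin> rvec m ` set ?B" using nin span_Q_superset[OF rvec_image_carrier] by blast
    let ?C = "rvec m ` set (u # ?B)" and ?SL = "span_Q m (rvec m ` set L)"
    note SL = subspace_QD[OF subspace_span_Q[OF rvec_image_carrier[of m "set L"]]]
    note SC = subspace_QD[OF subspace_span_Q[OF rvec_image_carrier[of m "set (u # ?B)"]]]
    have inL: "rvec m v \<in> ?SL" if "v \<in> set L" for v using that span_Q_superset[OF rvec_image_carrier] by blast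
    have "rvec m ` set ?L \<subseteq> ?SL"
      using inL u(1) by (auto simp: rvec_elim intro!: SL(4,5))
    hence "span_Q m (rvec m ` set ?B) \<subseteq> ?SL"
      unfolding IH(1) by (intro span_Q_minimal subspace_span_Q) auto
    hence 1: "?C \<subseteq> ?SL"
      using span_Q_superset[OF rvec_image_carrier[of m "set ?B"]] inL[OF u(1)] by auto
    have uC: "rvec m u \<in> span_Q m ?C" using span_Q_superset[OF rvec_image_carrier[of m "set (u # ?B)"]] by auto
    have "span_Q m (rvec m ` set ?B) \<subseteq> span_Q m ?C" by (intro span_Q_mono) auto
    hence "rvec m ` set ?L \<subseteq> span_Q m ?C"
      unfolding IH(1) using span_Q_superset[OF rvec_image_carrier[of m "set ?L"]] by blast
    hence eC: "rvec m (elim m k u v) \<in> span_Q m ?C" if "v \<in> set L" for v using that by auto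
    have 2: "rvec m ` set L \<subseteq> span_Q m ?C"
    proof clarify
      fix v assume v: "v \<in> set L"
      have "rvec m v = (1 / rat_of_int (nth0 k u)) \<cdot>\<^sub>v (rvec m (elim m k u v) + rat_of_int (nth0 k v) \<cdot>\<^sub>v rvec m u)"
        using u(2) by (intro eq_vecI) (auto simp: rvec_elim)
      also have "\<dots> \<in> span_Q m ?C" by (intro SC(3,4) eC v uC)
      finally show "rvec m v \<in> span_Q m ?C" .
    qed
    have "span_Q m ?C = ?SL" by (rule span_Q_eqI[OF 1 2]) auto
    moreover have "distinct (map (rvec m) (u # ?B))" using IH(2) nin' by simp
    moreover have "lin_indpt_Q m ?C"
      using lin_indpt_Q_insert[OF IH(3) rvec_image_carrier rvec_carrier nin] by simp
    ultimately show ?thesis unfolding g by blast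
  qed
qed

lemma gauss_length: "(\<And>l. l \<in> set L \<Longrightarrow> length l = m) \<Longrightarrow> l \<in> set (gauss m k L) \<Longrightarrow> length l = m"
proof (induction k arbitrary: L)
  case (Suc k)
  show ?case
  proof (cases "filter (\<lambda>u. nth0 k u \<noteq> 0) L")
    case Nil
    thus ?thesis using Suc.IH[of L] Suc.prems by auto
  next
    case (Cons u us)
    hence "u \<in> set (filter (\<lambda>u. nth0 k u \<noteq> 0) L)" by simp
    hence "u \<in> set L" by simp
    moreover have "length l = m" if "l \<in> set (map (elim m k u) L)" for l
      using that by (auto simp: elim_def)
    ultimately show ?thesis using Cons Suc.prems Suc.IH[of "map (elim m k u) L"] by auto
  qed
qed simp

section \<open>Presburger-definable sets are semilinear\<close>

text \<open>Dickson's lemma with coordinates replaced by arbitrary functions into the naturals.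
  Elements on which \<open>f\<close> is at least \<open>N\<close> lie above an element of
  \<open>B0\<close>; the others fall into finitely many level sets of \<open>f\<close>, to which the
  induction hypothesis applies.\<close>

lemma dickson:
  fixes Fs :: "('a \<Rightarrow> nat) set"
  assumes "finite Fs"
  shows "\<exists>B. finite B \<and> B \<subseteq> X \<and> (\<forall>y\<in>X. \<exists>x\<in>B. \<forall>f\<in>Fs. f x \<le> f y)"
  using assms
proof (induction Fs arbitrary: X rule: finite_induct)
  case empty
  show ?case
  proof (cases "X = {}")
    case False
    then obtain x where "x \<in> X" by blast
    thus ?thesis by (intro exI[of _ "{x}"]) auto
  qed simp
next
  case (insert f Fs)
  obtain B0 where B0: "finite B0" "B0 \<subseteq> X" "\<And>y. y \<in> X \<Longrightarrow> \<exists>x\<in>B0. \<forall>g\<in>Fs. g x \<le> g y"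
    using insert.IH[of X] by metis
  define N where "N = Max (insert 0 (f ` B0))"
  have N: "f x \<le> N" if "x \<in> B0" for x
    unfolding N_def using B0(1) that by (intro Max_ge) auto
  have "\<forall>k. \<exists>B. finite B \<and> B \<subseteq> {y \<in> X. f y = k} \<and> (\<forall>y\<in>{y \<in> X. f y = k}. \<exists>x\<in>B. \<forall>g\<in>Fs. g x \<le> g y)"
    using insert.IH by blast
  from choice[OF this] obtain B where
    "\<forall>k. finite (B k) \<and> B k \<subseteq> {y \<in> X. f y = k} \<and> (\<forall>y\<in>{y \<in> X. f y = k}. \<exists>x\<in>B k. \<forall>g\<in>Fs. g x \<le> g y)"
    by blast
  hence B: "\<And>k. finite (B k)" "\<And>k. B k \<subseteq> {y \<in> X. f y = k}"
    "\<And>k y. y \<in> X \<Longrightarrow> f y = k \<Longrightarrow> \<exists>x\<in>B k. \<forall>g\<in>Fs. g x \<le> g y"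
    by auto
  show ?case
  proof (intro exI conjI ballI)
    show "finite (B0 \<union> (\<Union>k<N. B k))" using B0(1) B(1) by simp
    show "B0 \<union> (\<Union>k<N. B k) \<subseteq> X" using B0(2) B(2) by blast
    fix y assume y: "y \<in> X"
    show "\<exists>x\<in>B0 \<union> (\<Union>k<N. B k). \<forall>g\<in>insert f Fs. g x \<le> g y"
    proof (cases "f y < N")
      case True
      obtain x where "x \<in> B (f y)" "\<forall>g\<in>Fs. g x \<le> g y" using B(3)[OF y refl] by blast
      moreover have "f x = f y" using B(2) \<open>x \<in> _\<close> by blast
      ultimately show ?thesis using True by (intro bexI[of _ x]) auto
    next
      case False
      obtain x where "x \<in> B0" "\<forall>g\<in>Fs. g x \<le> g y" using B0(3)[OF y] by blast
      moreover have "f x \<le> f y" using N[OF \<open>x \<in> B0\<close>] False by simp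
      ultimately show ?thesis by (intro bexI[of _ x]) auto
    qed
  qed
qed

section \<open>Translation into formulas that admit quantifier elimination\<close>

primrec num_of :: "(nat \<Rightarrow> nat) \<Rightarrow> pterm \<Rightarrow> num" where
  "num_of \<sigma> (PVar i) = Bound (\<sigma> i)"
| "num_of \<sigma> (PAdd s t) = Add (num_of \<sigma> s) (num_of \<sigma> t)"

text \<open>The assignment of de Bruijn indices to the named variables is the argument \<open>\<sigma>\<close>.\<close>

primrec fm_of :: "(nat \<Rightarrow> nat) \<Rightarrow> pform \<Rightarrow> fm" where
  "fm_of \<sigma> (PEq s t) = Eq (Sub (num_of \<sigma> s) (num_of \<sigma> t))"
| "fm_of \<sigma> (PLe s t) = Le (Sub (num_of \<sigma> s) (num_of \<sigma> t))"
| "fm_of \<sigma> (PNot f) = Not (fm_of \<sigma> f)"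
| "fm_of \<sigma> (PAnd f g) = And (fm_of \<sigma> f) (fm_of \<sigma> g)"
| "fm_of \<sigma> (PEx x f) = Cooper.E (fm_of (\<lambda>i. if i = x then 0 else Suc (\<sigma> i)) f)"

lemma Inum_num_of: "Inum bs (num_of \<sigma> t) = pterm_val (\<lambda>i. bs ! \<sigma> i) t"
  by (induction t) auto

lemma Ifm_fm_of: "Ifm bbs bs (fm_of \<sigma> f) \<longleftrightarrow> pform_sat (\<lambda>i. bs ! \<sigma> i) f"
proof (induction f arbitrary: \<sigma> bs)
  case (PEx x f)
  have "(\<lambda>i. (a # bs) ! (if i = x then 0 else Suc (\<sigma> i))) = (\<lambda>i. bs ! \<sigma> i)(x := a)" for a
    by (auto simp: fun_eq_iff)
  thus ?case by (simp add: PEx)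
qed (auto simp: Inum_num_of)

lemma pterm_val_cong: "(\<And>i. i \<in> pterm_vars t \<Longrightarrow> e i = e' i) \<Longrightarrow> pterm_val e t = pterm_val e' t"
  by (induction t) auto

lemma pform_sat_cong: "(\<And>i. i \<in> pform_free f \<Longrightarrow> e i = e' i) \<Longrightarrow> pform_sat e f \<longleftrightarrow> pform_sat e' f"
proof (induction f arbitrary: e e')
  case (PEq s t)
  have "pterm_val e s = pterm_val e' s" "pterm_val e t = pterm_val e' t"
    by (rule pterm_val_cong, rule PEq.prems, simp)+
  thus ?case by simp
next
  case (PLe s t)
  have "pterm_val e s = pterm_val e' s" "pterm_val e t = pterm_val e' t"
    by (rule pterm_val_cong, rule PLe.prems, simp)+
  thus ?case by simp
next
  case (PAnd f g)
  have "pform_sat e f \<longleftrightarrow> pform_sat e' f" by (rule PAnd.IH(1), rule PAnd.prems) simp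
  moreover have "pform_sat e g \<longleftrightarrow> pform_sat e' g" by (rule PAnd.IH(2), rule PAnd.prems) simp
  ultimately show ?case by simp
next
  case (PNot f)
  have "pform_sat e f \<longleftrightarrow> pform_sat e' f" by (rule PNot.IH, rule PNot.prems) simp
  thus ?case by simp
next
  case (PEx x f)
  have "pform_sat (e(x := a)) f \<longleftrightarrow> pform_sat (e'(x := a)) f" for a
    using PEx.prems by (intro PEx.IH) auto
  thus ?case by simp
qed

definition env :: "int vec \<Rightarrow> int list" where
  "env x = map (\<lambda>i. x $ i) [0..<dim_vec x]"

primrec lin_part :: "num \<Rightarrow> int vec \<Rightarrow> int" where
  "lin_part (num.C c) v = 0"
| "lin_part (Bound n) v = (if n < dim_vec v then v $ n else 0)"
| "lin_part (CN n c a) v = c * (if n < dim_vec v then v $ n else 0) + lin_part a v"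
| "lin_part (Neg a) v = - lin_part a v"
| "lin_part (Add a b) v = lin_part a v + lin_part b v"
| "lin_part (Sub a b) v = lin_part a v - lin_part b v"
| "lin_part (Mul c a) v = c * lin_part a v"

text \<open>Beyond the end of a list the value is unspecified but depends only on the index and the
  length. It cancels in differences, so such variables contribute 0 to
  \<open>lin_part\<close>.\<close>

lemma nth_beyond: "length xs = length ys \<Longrightarrow> length xs \<le> n \<Longrightarrow> xs ! n = ys ! n"
proof (induction xs ys arbitrary: n rule: list_induct2)
  case (Cons x xs y ys)
  thus ?case by (cases n) auto
qed simp

lemma env_add: "x \<in> carrier_vec m \<Longrightarrow> v \<in> carrier_vec m \<Longrightarrow>
    env (x + v) ! n = env x ! n + (if n < m then v $ n else 0)"
  using nth_beyond[of "env (x + v)" "env x" n] by (auto simp: env_def)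

lemma Inum_env_add:
  "x \<in> carrier_vec m \<Longrightarrow> v \<in> carrier_vec m \<Longrightarrow> Inum (env (x + v)) t = Inum (env x) t + lin_part t v"
  by (induction t) (auto simp: env_add algebra_simps)

lemma lin_part_add:
  "u \<in> carrier_vec m \<Longrightarrow> v \<in> carrier_vec m \<Longrightarrow> lin_part t (u + v) = lin_part t u + lin_part t v"
  by (induction t) (auto simp: algebra_simps)

lemma lin_part_0: "lin_part t (0\<^sub>v m) = 0"
  by (induction t) auto

lemma lin_part_dvd: "(\<And>i. i < dim_vec v \<Longrightarrow> M dvd v $ i) \<Longrightarrow> M dvd lin_part t v"
  by (induction t) auto

section \<open>Sign and residue types of integer vectors\<close>

definition same_type :: "nat \<Rightarrow> num set \<Rightarrow> int \<Rightarrow> int vec \<Rightarrow> int vec \<Rightarrow> bool" where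
  "same_type m Ts M x y \<longleftrightarrow> (\<forall>t\<in>Ts. Inum (env x) t \<ge> 0 \<longleftrightarrow> Inum (env y) t \<ge> 0) \<and> (\<forall>i<m. M dvd y $ i - x $ i)"

lemma same_type_mono: "same_type m Ts M x y \<Longrightarrow> Ts' \<subseteq> Ts \<Longrightarrow> M' dvd M \<Longrightarrow> same_type m Ts' M' x y"
  unfolding same_type_def using dvd_trans by blast

lemma same_type_signs:
  assumes "same_type m {t, Neg t} M x y"
  shows "Inum (env x) t < 0 \<longleftrightarrow> Inum (env y) t < 0" "Inum (env x) t > 0 \<longleftrightarrow> Inum (env y) t > 0"
    "Inum (env x) t = 0 \<longleftrightarrow> Inum (env y) t = 0"
  using assms unfolding same_type_def by auto

text \<open>Divisibility by 0 means being 0, which the signs of \<open>t\<close> and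
  \<open>Neg t\<close> decide. Otherwise equal residues of the coordinates give equal residues of
  the term.\<close>

lemma same_type_dvd:
  assumes "same_type m {t, Neg t} (if d = 0 then 1 else \<bar>d\<bar>) x y" "x \<in> carrier_vec m" "y \<in> carrier_vec m"
  shows "d dvd Inum (env x) t \<longleftrightarrow> d dvd Inum (env y) t"
proof (cases "d = 0")
  case True
  thus ?thesis using same_type_signs(3)[OF assms(1)] by simp
next
  case False
  have "d dvd lin_part t (y - x)"
    using assms False unfolding same_type_def by (intro lin_part_dvd) auto
  moreover have "x + (y - x) = y" using assms by (intro eq_vecI) auto
  hence "Inum (env y) t = Inum (env x) t + lin_part t (y - x)"
    using Inum_env_add[of x m "y - x" t] assms by simp
  ultimately show ?thesis by (simp add: dvd_add_left_iff)
qed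

definition type_invariant :: "nat \<Rightarrow> (int vec \<Rightarrow> bool) \<Rightarrow> bool" where
  "type_invariant m P \<longleftrightarrow> (\<exists>Ts M. finite Ts \<and> M > 0 \<and> (\<forall>x\<in>carrier_vec m. \<forall>y\<in>carrier_vec m.
     same_type m Ts M x y \<longrightarrow> P x = P y))"

lemma type_invariantI:
  assumes "M > 0" "\<And>x y. x \<in> carrier_vec m \<Longrightarrow> y \<in> carrier_vec m \<Longrightarrow> same_type m {t, Neg t} M x y \<Longrightarrow> P x = P y"
  shows "type_invariant m P"
  unfolding type_invariant_def using assms by (intro exI[of _ "{t, Neg t}"] exI[of _ M]) simp

lemma type_invariant_combine:
  assumes "type_invariant m P" "type_invariant m Q"
  shows "type_invariant m (\<lambda>x. h (P x) (Q x))"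
proof -
  obtain Ts M where 1: "finite Ts" "M > 0"
    "\<And>x y. x \<in> carrier_vec m \<Longrightarrow> y \<in> carrier_vec m \<Longrightarrow> same_type m Ts M x y \<Longrightarrow> P x = P y"
    using assms(1) unfolding type_invariant_def by blast
  obtain Ts' M' where 2: "finite Ts'" "M' > 0"
    "\<And>x y. x \<in> carrier_vec m \<Longrightarrow> y \<in> carrier_vec m \<Longrightarrow> same_type m Ts' M' x y \<Longrightarrow> Q x = Q y"
    using assms(2) unfolding type_invariant_def by blast
  have "h (P x) (Q x) = h (P y) (Q y)"
    if "x \<in> carrier_vec m" "y \<in> carrier_vec m" "same_type m (Ts \<union> Ts') (M * M') x y" for x y
    using 1(3)[OF that(1,2) same_type_mono[OF that(3)]] 2(3)[OF that(1,2) same_type_mono[OF that(3)]] by simp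
  thus ?thesis unfolding type_invariant_def
    using 1(1,2) 2(1,2) by (intro exI[of _ "Ts \<union> Ts'"] exI[of _ "M * M'"]) simp
qed

lemma type_invariant_const: "type_invariant m (\<lambda>_. b)"
  unfolding type_invariant_def by (intro exI[of _ "{}"] exI[of _ 1]) simp

lemma type_invariant_dvd: "type_invariant m (\<lambda>x. d dvd Inum (env x) t)"
  by (rule type_invariantI[where M = "if d = 0 then 1 else \<bar>d\<bar>" and t = t]) (simp, rule same_type_dvd)

lemma type_invariant_sign:
  "type_invariant m (\<lambda>x. Inum (env x) t < 0)" "type_invariant m (\<lambda>x. Inum (env x) t > 0)"
  "type_invariant m (\<lambda>x. Inum (env x) t = 0)"
  by (rule type_invariantI[where M = 1 and t = t], simp, erule same_type_signs)+

lemma type_invariant_Not: "type_invariant m P \<Longrightarrow> type_invariant m (\<lambda>x. \<not> P x)"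
  using type_invariant_combine[of m P P "\<lambda>p q. \<not> p"] by simp

lemma qfree_type_invariant: "qfree \<phi> \<Longrightarrow> type_invariant m (\<lambda>x. Ifm bbs (env x) \<phi>)"
proof (induction \<phi>)
  case (Le t)
  show ?case using type_invariant_Not[OF type_invariant_sign(2)[of m t]] by (simp add: not_less)
next
  case (Ge t)
  show ?case using type_invariant_Not[OF type_invariant_sign(1)[of m t]] by (simp add: not_less)
next
  case (And p q)
  thus ?case using type_invariant_combine[where h = "(\<and>)"] by simp
next
  case (Or p q)
  thus ?case using type_invariant_combine[where h = "(\<or>)"] by simp
next
  case (Imp p q)
  thus ?case using type_invariant_combine[where h = "(\<longrightarrow>)"] by simp
next
  case (Iff p q)
  thus ?case using type_invariant_combine[where h = "(=)"] by simp
qed (simp_all add: type_invariant_const type_invariant_sign type_invariant_dvd type_invariant_Not)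

text \<open>The sets \<open>x + K x\<close> are the linear sets of the usual definition, except that the monoids \<open>K x\<close>
  are not claimed to be finitely generated.\<close>

theorem presburger_semilinear:
  assumes "presburger_definable m X"
  obtains B K where "finite B" "B \<subseteq> X"
    "\<And>x. x \<in> B \<Longrightarrow> K x \<subseteq> carrier_vec m \<and> 0\<^sub>v m \<in> K x"
    "\<And>x u v. x \<in> B \<Longrightarrow> u \<in> K x \<Longrightarrow> v \<in> K x \<Longrightarrow> u + v \<in> K x"
    "\<And>x v. x \<in> B \<Longrightarrow> v \<in> K x \<Longrightarrow> x + v \<in> X"
    "\<And>y. y \<in> X \<Longrightarrow> \<exists>x\<in>B. y - x \<in> K x"
proof -
  obtain f where f: "pform_free f \<subseteq> {..<m}" and X: "X = {v \<in> carrier_vec m. pform_sat (\<lambda>i. v $ i) f}"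
    using assms unfolding presburger_definable_def by blast
  define \<phi> where "\<phi> = pa (fm_of id f)"
  have \<phi>: "qfree \<phi>" "Ifm [] bs \<phi> = Ifm [] bs (fm_of id f)" for bs
    unfolding \<phi>_def using mirqe by blast+
  have sat: "x \<in> X \<longleftrightarrow> Ifm [] (env x) \<phi>" if "x \<in> carrier_vec m" for x
  proof -
    have "pform_sat (\<lambda>i. env x ! id i) f \<longleftrightarrow> pform_sat (\<lambda>i. x $ i) f"
      using f that by (intro pform_sat_cong) (auto simp: env_def)
    thus ?thesis using that by (simp add: X \<phi>(2) Ifm_fm_of)
  qed
  obtain Ts M where T: "finite Ts" "M > 0" and inv: "\<And>x y. x \<in> carrier_vec m \<Longrightarrow> y \<in> carrier_vec m \<Longrightarrow>
     same_type m Ts M x y \<Longrightarrow> Ifm [] (env x) \<phi> = Ifm [] (env y) \<phi>"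
    using qfree_type_invariant[OF \<phi>(1), of m "[]"] unfolding type_invariant_def by blast
  \<comment> \<open>If no function in \<open>Fs\<close> decreases from \<open>x\<close> to
    \<open>y\<close>, all signs agree, as each condition and its negation are listed; terms move
    away from 0; and residues agree, as they and their complements in \<open>M\<close> are
    listed.\<close>
  define Fs :: "(int vec \<Rightarrow> nat) set" where
    "Fs = (\<Union>t\<in>Ts. {\<lambda>x. nat (Inum (env x) t), \<lambda>x. nat (- Inum (env x) t),
        \<lambda>x. of_bool (Inum (env x) t \<ge> 0), \<lambda>x. of_bool (\<not> Inum (env x) t \<ge> 0)}) \<union>
      (\<Union>i<m. {\<lambda>x. nat (x $ i mod M), \<lambda>x. nat (M - x $ i mod M)})"
  have "finite Fs" unfolding Fs_def using T(1) by auto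
  then obtain B where B: "finite B" "B \<subseteq> X" "\<And>y. y \<in> X \<Longrightarrow> \<exists>x\<in>B. \<forall>f\<in>Fs. f x \<le> f y"
    using dickson[of Fs X] by metis
  \<comment> \<open>The steps that move no term back towards 0 from its side and keep all residues.
    They form a monoid that depends only on the signs of the terms at \<open>x\<close>.\<close>
  define K where "K = (\<lambda>x. {v \<in> carrier_vec m.
     (\<forall>t\<in>Ts. if Inum (env x) t \<ge> 0 then lin_part t v \<ge> 0 else lin_part t v \<le> 0) \<and> (\<forall>i<m. M dvd v $ i)})"
  have XC: "X \<subseteq> carrier_vec m" unfolding X by blast
  show thesis
  proof (rule that[of B K])
    fix x v assume x: "x \<in> B" and v: "v \<in> K x"
    have c: "x \<in> carrier_vec m" "v \<in> carrier_vec m" using x v B(2) XC unfolding K_def by auto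
    have "same_type m Ts M x (x + v)"
      unfolding same_type_def
    proof (intro conjI ballI allI impI)
      fix t assume t: "t \<in> Ts"
      show "(Inum (env x) t \<ge> 0) = (Inum (env (x + v)) t \<ge> 0)"
        using v t unfolding K_def Inum_env_add[OF c] by (auto split: if_splits)
    qed (use c v in \<open>auto simp: K_def\<close>)
    thus "x + v \<in> X" using inv[OF c(1), of "x + v"] sat c x B(2) by auto
  next
    fix y assume y: "y \<in> X"
    then obtain x where x: "x \<in> B" and le: "\<And>f. f \<in> Fs \<Longrightarrow> f x \<le> f y" using B(3) by blast
    have c: "x \<in> carrier_vec m" "y \<in> carrier_vec m" using x y B(2) XC by auto
    have "x + (y - x) = y" using c by (intro eq_vecI) auto
    hence lin: "Inum (env y) t = Inum (env x) t + lin_part t (y - x)" for t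
      using Inum_env_add[of x m "y - x" t] c by simp
    have "y - x \<in> K x"
      unfolding K_def
    proof (intro CollectI conjI ballI allI impI)
      fix t assume t: "t \<in> Ts"
      have "f x \<le> f y" if "f \<in> {\<lambda>x. nat (Inum (env x) t), \<lambda>x. nat (- Inum (env x) t),
        \<lambda>x. of_bool (Inum (env x) t \<ge> 0), \<lambda>x. of_bool (\<not> Inum (env x) t \<ge> 0)}" for f
        using t that by (intro le) (unfold Fs_def, blast)
      hence "nat (Inum (env x) t) \<le> nat (Inum (env y) t)" "nat (- Inum (env x) t) \<le> nat (- Inum (env y) t)"
        "of_bool (Inum (env x) t \<ge> 0) \<le> (of_bool (Inum (env y) t \<ge> 0) :: nat)"
        "of_bool (\<not> Inum (env x) t \<ge> 0) \<le> (of_bool (\<not> Inum (env y) t \<ge> 0) :: nat)"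
        by blast+
      thus "if Inum (env x) t \<ge> 0 then lin_part t (y - x) \<ge> 0 else lin_part t (y - x) \<le> 0"
        by (auto simp: lin split: if_splits)
    next
      fix i assume i: "i < m"
      have "f x \<le> f y" if "f \<in> {\<lambda>x. nat (x $ i mod M), \<lambda>x. nat (M - x $ i mod M)}" for f
        using i that by (intro le) (unfold Fs_def, blast)
      hence "nat (x $ i mod M) \<le> nat (y $ i mod M)" "nat (M - x $ i mod M) \<le> nat (M - y $ i mod M)"
        by blast+
      moreover have "0 \<le> x $ i mod M" "x $ i mod M < M" "0 \<le> y $ i mod M" "y $ i mod M < M"
        using T(2) by auto
      ultimately have "y $ i mod M = x $ i mod M" by auto
      thus "M dvd (y - x) $ i" using i c by (simp add: mod_eq_dvd_iff)
    qed (use c in auto)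
    thus "\<exists>x\<in>B. y - x \<in> K x" using x by blast
  next
    show "K x \<subseteq> carrier_vec m \<and> 0\<^sub>v m \<in> K x" for x
      unfolding K_def by (auto simp: lin_part_0)
    show "u + v \<in> K x" if "u \<in> K x" "v \<in> K x" for x u v
    proof -
      have c: "u \<in> carrier_vec m" "v \<in> carrier_vec m" using that unfolding K_def by auto
      show ?thesis
        unfolding K_def
      proof (intro CollectI conjI ballI)
        fix t assume "t \<in> Ts"
        with that have "if Inum (env x) t \<ge> 0 then lin_part t u \<ge> 0 else lin_part t u \<le> 0"
          "if Inum (env x) t \<ge> 0 then lin_part t v \<ge> 0 else lin_part t v \<le> 0"
          unfolding K_def by blast+
        thus "if Inum (env x) t \<ge> 0 then lin_part t (u + v) \<ge> 0 else lin_part t (u + v) \<le> 0"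
          unfolding lin_part_add[OF c] by (auto split: if_splits)
      qed (use c that in \<open>auto simp: K_def\<close>)
    qed
  qed (use B in auto)
qed

section \<open>Semi-affine hulls\<close>

abbreviation coset :: "rat vec \<Rightarrow> rat vec set \<Rightarrow> rat vec set" where
  "coset a W \<equiv> {a + v | v. v \<in> W}"

lemma coset_iff:
  assumes "a \<in> carrier_vec m" "subspace_Q m W"
  shows "x \<in> coset a W \<longleftrightarrow> x \<in> carrier_vec m \<and> x - a \<in> W"
proof
  assume "x \<in> coset a W"
  then obtain v where v: "x = a + v" "v \<in> W" by blast
  hence c: "v \<in> carrier_vec m" using subspace_QD(1)[OF assms(2)] by blast
  hence "x - a = v" using v(1) assms(1) by (intro eq_vecI) auto
  thus "x \<in> carrier_vec m \<and> x - a \<in> W" using v c assms(1) by simp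
next
  assume x: "x \<in> carrier_vec m \<and> x - a \<in> W"
  hence "x = a + (x - a)" using assms(1) by (intro eq_vecI) auto
  thus "x \<in> coset a W" using x by blast
qed

lemma direction_coset:
  assumes "a \<in> carrier_vec m" "subspace_Q m W"
  shows "direction (coset a W) = W"
proof -
  note W = subspace_QD[OF assms(2)]
  have "x - y \<in> W" if "x \<in> coset a W" "y \<in> coset a W" for x y
  proof -
    from that obtain u v where uv: "x = a + u" "y = a + v" "u \<in> W" "v \<in> W" by blast
    hence "u \<in> carrier_vec m" "v \<in> carrier_vec m" using W(1) by blast+
    hence "x - y = u - v" using uv(1,2) assms(1) by (intro eq_vecI) auto
    thus ?thesis using W(5) uv by simp
  qed
  moreover have "\<exists>x\<in>coset a W. \<exists>y\<in>coset a W. v = x - y" if "v \<in> W" for v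
  proof -
    have "v \<in> carrier_vec m" using that W(1) by blast
    hence "v = (a + v) - (a + 0\<^sub>v m)" using assms(1) by (intro eq_vecI) auto
    thus ?thesis using that W(2) by blast
  qed
  ultimately show ?thesis unfolding direction_def by blast
qed

lemma affine_space_coset: "a \<in> carrier_vec m \<Longrightarrow> subspace_Q m W \<Longrightarrow> affine_space m (coset a W)"
  unfolding affine_space_def by blast

lemma affine_spaceD:
  assumes "affine_space m S"
  shows "S \<subseteq> carrier_vec m" "S \<noteq> {}" "subspace_Q m (direction S)"
    "x \<in> S \<Longrightarrow> y \<in> S \<Longrightarrow> x - y \<in> direction S"
    "x \<in> S \<Longrightarrow> d \<in> direction S \<Longrightarrow> x + d \<in> S"
    "x \<in> S \<Longrightarrow> S = coset x (direction S)"
proof -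
  obtain a W where a: "a \<in> carrier_vec m" "subspace_Q m W" "S = coset a W"
    using assms unfolding affine_space_def by blast
  note W = subspace_QD[OF a(2)] and mem = coset_iff[OF a(1,2)]
  have dir: "direction S = W" using direction_coset[OF a(1,2)] a(3) by simp
  show 1: "S \<subseteq> carrier_vec m" using mem a(3) by blast
  show "S \<noteq> {}" using W(2) a(3) by blast
  show "subspace_Q m (direction S)" using dir a(2) by simp
  show 4: "x - y \<in> direction S" if "x \<in> S" "y \<in> S" for x y
    using that unfolding direction_def by blast
  show 5: "x + d \<in> S" if "x \<in> S" "d \<in> direction S" for x d
  proof -
    have c: "x \<in> carrier_vec m" "d \<in> carrier_vec m" using that 1 W(1) dir by auto
    have "x + d - a = (x - a) + d" using c a(1) by (intro eq_vecI) auto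
    also have "\<dots> \<in> W" using W(3) that mem a(3) dir by blast
    finally show ?thesis using mem c a(3) by simp
  qed
  show "S = coset x (direction S)" if "x \<in> S"
  proof
    show "coset x (direction S) \<subseteq> S" using 5 that by blast
    show "S \<subseteq> coset x (direction S)"
    proof
      fix y assume y: "y \<in> S"
      have "x \<in> carrier_vec m" "y \<in> carrier_vec m" using 1 y that by blast+
      hence "y = x + (y - x)" by (intro eq_vecI) auto
      thus "y \<in> coset x (direction S)" using 4[OF y that] by blast
    qed
  qed
qed

lemma direction_mono: "S \<subseteq> S' \<Longrightarrow> direction S \<subseteq> direction S'"
  unfolding direction_def by blast

lemma affine_space_subset:
  assumes "affine_space m S" "affine_space m S'" "x \<in> S" "x \<in> S'" "direction S \<subseteq> direction S'"
  shows "S \<subseteq> S'"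
  using affine_spaceD(6)[OF assms(1,3)] affine_spaceD(6)[OF assms(2,4)] assms(5) by blast

section \<open>Covering by finitely many affine spaces\<close>

text \<open>\<open>fan k c us Y\<close>: the set \<open>Y\<close> contains the leaves of a tree with root \<open>c\<close> and more than \<open>k\<close> branches
  at every node, where the steps at level \<open>i\<close> are distinct multiples of the \<open>i\<close>-th vector.\<close>

primrec fan :: "nat \<Rightarrow> rat vec \<Rightarrow> rat vec list \<Rightarrow> rat vec set \<Rightarrow> bool" where
  "fan k c [] Y \<longleftrightarrow> c \<in> Y"
| "fan k c (u # us) Y \<longleftrightarrow> (\<exists>S::rat set. finite S \<and> card S > k \<and> (\<forall>s\<in>S. fan k (c + s \<cdot>\<^sub>v u) us Y))"

text \<open>Pigeonhole: the root has more branches than there are spaces, so two branch points lie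
  in one space that by induction has the later vectors among its directions. Their difference is a
  nonzero multiple of \<open>u\<close>, so \<open>u\<close> is a direction as well, and stepping
  back along \<open>u\<close> puts the root into the space.\<close>

lemma fan_cover:
  assumes F: "finite F" "\<And>S. S \<in> F \<Longrightarrow> affine_space m S" "card F \<le> k" "Y \<subseteq> \<Union> F"
  shows "c \<in> carrier_vec m \<Longrightarrow> set us \<subseteq> carrier_vec m \<Longrightarrow> fan k c us Y \<Longrightarrow>
    \<exists>S\<in>F. c \<in> S \<and> set us \<subseteq> direction S"
proof (induction us arbitrary: c)
  case (Cons u us)
  obtain R :: "rat set" where R: "finite R" "card R > k" "\<And>s. s \<in> R \<Longrightarrow> fan k (c + s \<cdot>\<^sub>v u) us Y"
    using Cons.prems(3) by auto
  have c: "c \<in> carrier_vec m" "u \<in> carrier_vec m" "set us \<subseteq> carrier_vec m" using Cons.prems by auto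
  have "\<exists>S\<in>F. c + s \<cdot>\<^sub>v u \<in> S \<and> set us \<subseteq> direction S" if "s \<in> R" for s
    using c that by (intro Cons.IH R(3)) auto
  then obtain g where g: "\<And>s. s \<in> R \<Longrightarrow> g s \<in> F \<and> c + s \<cdot>\<^sub>v u \<in> g s \<and> set us \<subseteq> direction (g s)" by metis
  have "\<not> inj_on g R"
  proof
    assume "inj_on g R"
    moreover have "g ` R \<subseteq> F" using g by blast
    ultimately have "card R \<le> card F" using F(1) card_inj_on_le by blast
    thus False using R(2) F(3) by simp
  qed
  then obtain s t where st: "s \<in> R" "t \<in> R" "s \<noteq> t" "g s = g t" unfolding inj_on_def by blast
  define S where "S = g s"
  have S: "S \<in> F" "c + s \<cdot>\<^sub>v u \<in> S" "c + t \<cdot>\<^sub>v u \<in> S" "set us \<subseteq> direction S"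
    using g[OF st(1)] g[OF st(2)] st(4) unfolding S_def by auto
  note A = affine_spaceD[OF F(2)[OF S(1)]] and W = subspace_QD[OF affine_spaceD(3)[OF F(2)[OF S(1)]]]
  have "u = (1 / (s - t)) \<cdot>\<^sub>v ((c + s \<cdot>\<^sub>v u) - (c + t \<cdot>\<^sub>v u))"
    using st(3) c by (intro eq_vecI) (auto simp: field_simps)
  moreover have "(1 / (s - t)) \<cdot>\<^sub>v ((c + s \<cdot>\<^sub>v u) - (c + t \<cdot>\<^sub>v u)) \<in> direction S" by (intro W(4) A(4) S(2,3))
  ultimately have u: "u \<in> direction S" by simp
  have "c = (c + s \<cdot>\<^sub>v u) + (- s) \<cdot>\<^sub>v u" using c by (intro eq_vecI) auto
  moreover have "(c + s \<cdot>\<^sub>v u) + (- s) \<cdot>\<^sub>v u \<in> S" by (intro A(5) S(2) W(4) u)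
  ultimately have "c \<in> S" by simp
  thus ?case using S u by auto
qed (use F in auto)

lemma fan_affine:
  assumes "affine_space m S" "c \<in> S" "set us \<subseteq> direction S"
  shows "fan k c us S"
  using assms(2,3)
proof (induction us arbitrary: c)
  case (Cons u us)
  note A = affine_spaceD[OF assms(1)] and W = subspace_QD[OF affine_spaceD(3)[OF assms(1)]]
  have "fan k (c + s \<cdot>\<^sub>v u) us S" for s using Cons.prems by (intro Cons.IH A(5) W(4)) auto
  moreover have "finite (rat_of_nat ` {..k})" "card (rat_of_nat ` {..k}) > k"
    by (auto simp: card_image inj_on_def)
  ultimately show ?case by auto
qed simp

text \<open>An affine space contains fans of any width on a finite spanning set of its directions,
  so \<open>fan_cover\<close> finds the member that contains it.\<close>

lemma affine_subset_Union:
  assumes F: "finite F" "\<And>S. S \<in> F \<Longrightarrow> affine_space m S" and A: "affine_space m A" "A \<subseteq> \<Union> F"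
  obtains S where "S \<in> F" "A \<subseteq> S"
proof -
  obtain a where a: "a \<in> A" using affine_spaceD(2)[OF A(1)] by blast
  note W = subspace_QD[OF affine_spaceD(3)[OF A(1)]]
  obtain P where P: "finite P" "P \<subseteq> direction A" "direction A \<subseteq> span_Q m P"
    using finite_spanning_subset[OF W(1)] by blast
  obtain us where us: "set us = P" using finite_list[OF P(1)] by blast
  have "fan (card F) a us A" using fan_affine[OF A(1) a] P us by simp
  moreover have "a \<in> carrier_vec m" "set us \<subseteq> carrier_vec m"
    using a affine_spaceD(1)[OF A(1)] us P(2) W(1) by blast+
  ultimately have "\<exists>S\<in>F. a \<in> S \<and> set us \<subseteq> direction S" by (intro fan_cover[OF F order.refl A(2)])
  then obtain S where S: "S \<in> F" "a \<in> S" "P \<subseteq> direction S" using us by blast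
  have "direction A \<subseteq> direction S"
    using P(3) span_Q_minimal[OF affine_spaceD(3)[OF F(2)[OF S(1)]] S(3)] by blast
  with affine_space_subset[OF A(1) F(2)[OF S(1)] a S(2)] S(1) that show thesis by blast
qed

section \<open>Hulls of unions of translated monoids\<close>

abbreviation (input) rv :: "int vec \<Rightarrow> rat vec" where "rv \<equiv> map_vec rat_of_int"

lemma rv_inj: "rv x = rv y \<Longrightarrow> x = y"
proof (rule eq_vecI)
  assume eq: "rv x = rv y"
  show d: "dim_vec x = dim_vec y" using arg_cong[OF eq, of dim_vec] by simp
  show "x $ i = y $ i" if "i < dim_vec y" for i
    using arg_cong[OF eq, of "\<lambda>v. v $ i"] that d by simp
qed

lemma rv_mem_rat_points [simp]: "rv x \<in> rat_points X \<longleftrightarrow> x \<in> X"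
  unfolding rat_points_def using rv_inj by blast

text \<open>The branches are the nonnegative integer multiples of the vectors, which stay in the
  monoid.\<close>

lemma fan_monoid:
  assumes K: "K \<subseteq> carrier_vec m" "\<And>u v. u \<in> K \<Longrightarrow> v \<in> K \<Longrightarrow> u + v \<in> K" "0\<^sub>v m \<in> K"
    and x: "x \<in> carrier_vec m" "\<And>v. v \<in> K \<Longrightarrow> x + v \<in> X"
    and us: "set us \<subseteq> rv ` K" and y: "y \<in> K"
  shows "fan k (rv (x + y)) us (rat_points X)"
  using us y
proof (induction us arbitrary: y)
  case (Cons u us)
  obtain v where v: "u = rv v" "v \<in> K" using Cons.prems by auto
  have mult: "int n \<cdot>\<^sub>v v \<in> K" for n
  proof (induction n)
    case 0
    have "int 0 \<cdot>\<^sub>v v = 0\<^sub>v m" using v(2) K(1) by (intro eq_vecI) auto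
    thus ?case using K(3) by metis
  next
    case (Suc n)
    have "int (Suc n) \<cdot>\<^sub>v v = v + int n \<cdot>\<^sub>v v" by (intro eq_vecI) (auto simp: algebra_simps)
    thus ?case using K(2)[OF v(2) Suc] by metis
  qed
  have "fan k (rv (x + y) + rat_of_nat n \<cdot>\<^sub>v u) us (rat_points X)" for n
  proof -
    have "y + int n \<cdot>\<^sub>v v \<in> K" using K(2) Cons.prems(2) mult by blast
    hence "fan k (rv (x + (y + int n \<cdot>\<^sub>v v))) us (rat_points X)" using Cons by simp
    moreover have "y \<in> carrier_vec m" "v \<in> carrier_vec m" using K(1) Cons.prems(2) v(2) by auto
    hence "rv (x + (y + int n \<cdot>\<^sub>v v)) = rv (x + y) + rat_of_nat n \<cdot>\<^sub>v u"
      using x(1) v(1) by (intro eq_vecI) auto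
    ultimately show ?thesis by simp
  qed
  moreover have "finite (rat_of_nat ` {..k})" "card (rat_of_nat ` {..k}) > k"
    by (auto simp: card_image inj_on_def)
  ultimately show ?case by auto
qed (use x(2) in simp)

text \<open>The fans inside \<open>x + K x\<close> force every semi-affine superset of
  \<open>X\<close> to contain \<open>x\<close> plus the span of \<open>K x\<close>, so the union of
  these cosets is the hull. Every affine subset of the union lies in one coset. Hence the maximal
  cosets are components, and every direction of a coset occurs in one of them.\<close>

lemma saff_direction_semilinear:
  assumes B: "finite B" "B \<subseteq> X" and X: "X \<subseteq> carrier_vec m"
    and K: "\<And>x. x \<in> B \<Longrightarrow> K x \<subseteq> carrier_vec m \<and> 0\<^sub>v m \<in> K x"
      "\<And>x u v. x \<in> B \<Longrightarrow> u \<in> K x \<Longrightarrow> v \<in> K x \<Longrightarrow> u + v \<in> K x"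
    and sub: "\<And>x v. x \<in> B \<Longrightarrow> v \<in> K x \<Longrightarrow> x + v \<in> X"
    and cov: "\<And>y. y \<in> X \<Longrightarrow> \<exists>x\<in>B. y - x \<in> K x"
  defines "F \<equiv> (\<lambda>x. coset (rv x) (span_Q m (rv ` K x))) ` B"
  shows "rat_points X \<subseteq> \<Union> F" "saff_direction m (rat_points X) = (\<Union>x\<in>B. span_Q m (rv ` K x))"
proof -
  define C where "C = (\<lambda>x. coset (rv x) (span_Q m (rv ` K x)))"
  have FC: "F = C ` B" unfolding F_def C_def ..
  have Kc: "rv ` K x \<subseteq> carrier_vec m" if "x \<in> B" for x using K(1)[OF that] by auto
  have Bc: "rv x \<in> carrier_vec m" "x \<in> carrier_vec m" if "x \<in> B" for x using that B(2) X by auto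
  have finF: "finite F" unfolding F_def using B(1) by simp
  have affF: "affine_space m S" if SF: "S \<in> F" for S
  proof -
    obtain x where x: "x \<in> B" "S = C x" using SF unfolding FC by blast
    show ?thesis unfolding x(2) C_def by (rule affine_space_coset[OF Bc(1)[OF x(1)] subspace_span_Q[OF Kc[OF x(1)]]])
  qed
  show XF: "rat_points X \<subseteq> \<Union> F"
  proof
    fix z assume "z \<in> rat_points X"
    then obtain y where y: "y \<in> X" "z = rv y" unfolding rat_points_def by blast
    obtain x where x: "x \<in> B" "y - x \<in> K x" using cov[OF y(1)] by blast
    have "z = rv x + rv (y - x)" using y X Bc[OF x(1)] by (intro eq_vecI) auto
    moreover have "rv (y - x) \<in> span_Q m (rv ` K x)" using span_Q_superset[OF Kc[OF x(1)]] x(2) by blast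
    ultimately have "z \<in> C x" unfolding C_def by blast
    thus "z \<in> \<Union> F" unfolding FC using x(1) by blast
  qed
  have least: "\<Union> F \<subseteq> S" if sS: "semi_affine_space m S" and XS: "rat_points X \<subseteq> S" for S
  proof -
    obtain G where G: "finite G" "\<And>A. A \<in> G \<Longrightarrow> affine_space m A" "S = \<Union> G"
      using sS unfolding semi_affine_space_def by blast
    have "C x \<subseteq> S" if x: "x \<in> B" for x
    proof -
      obtain P where P: "finite P" "P \<subseteq> rv ` K x" "rv ` K x \<subseteq> span_Q m P"
        using finite_spanning_subset[OF Kc[OF x]] by blast
      obtain us where us: "set us = P" using finite_list[OF P(1)] by blast
      have "fan (card G) (rv (x + 0\<^sub>v m)) us (rat_points X)"
        by (rule fan_monoid[where K = "K x" and m = m]) (use K x sub Bc P us in auto)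
      hence "fan (card G) (rv x) us (rat_points X)" using Bc[OF x] by simp
      moreover have "set us \<subseteq> carrier_vec m" using us P(2) Kc[OF x] by blast
      ultimately have "\<exists>A\<in>G. rv x \<in> A \<and> set us \<subseteq> direction A"
        using XS G(3) Bc(1)[OF x] by (intro fan_cover[OF G(1,2) order.refl]) auto
      then obtain A where A: "A \<in> G" "rv x \<in> A" "P \<subseteq> direction A" using us by blast
      have "span_Q m (rv ` K x) \<subseteq> span_Q m P"
        using P Kc[OF x] by (intro span_Q_minimal subspace_span_Q) auto
      also have "\<dots> \<subseteq> direction A" by (rule span_Q_minimal[OF affine_spaceD(3)[OF G(2)[OF A(1)]] A(3)])
      finally have "C x \<subseteq> A"
        using affine_spaceD(5)[OF G(2)[OF A(1)] A(2)] unfolding C_def by blast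
      thus ?thesis using A(1) G(3) by blast
    qed
    thus ?thesis unfolding FC by blast
  qed
  have saff: "saff m (rat_points X) = \<Union> F"
    unfolding saff_def
  proof (rule Least_equality)
    show "semi_affine_space m (\<Union> F) \<and> rat_points X \<subseteq> \<Union> F"
      unfolding semi_affine_space_def using finF affF XF by blast
  qed (use least in blast)
  have dirF: "direction (C x) = span_Q m (rv ` K x)" if "x \<in> B" for x
    unfolding C_def by (rule direction_coset[OF Bc(1)[OF that] subspace_span_Q[OF Kc[OF that]]])
  show "saff_direction m (rat_points X) = (\<Union>x\<in>B. span_Q m (rv ` K x))"
    unfolding saff_direction_def saff
  proof (intro equalityI subsetI)
    fix d assume "d \<in> (\<Union>A\<in>affine_components m (\<Union> F). direction A)"
    then obtain A where A: "affine_space m A" "A \<subseteq> \<Union> F" "d \<in> direction A"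
      unfolding affine_components_def by blast
    obtain S where "S \<in> F" "A \<subseteq> S" using affine_subset_Union[OF finF affF A(1,2)] by blast
    then obtain x where "x \<in> B" "A \<subseteq> C x" unfolding FC by blast
    with A(3) direction_mono[of A "C x"] dirF[of x] show "d \<in> (\<Union>x\<in>B. span_Q m (rv ` K x))" by blast
  next
    fix d assume "d \<in> (\<Union>x\<in>B. span_Q m (rv ` K x))"
    then obtain x where x: "x \<in> B" "d \<in> span_Q m (rv ` K x)" by blast
    have "C x \<in> F" unfolding FC using x(1) by blast
    then obtain M where M: "M \<in> F" "C x \<subseteq> M" "\<And>S. S \<in> F \<Longrightarrow> M \<subseteq> S \<Longrightarrow> S = M"
      using finite_has_maximal2[OF finF] by metis
    have "M \<in> affine_components m (\<Union> F)"
      unfolding affine_components_def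
    proof (intro CollectI conjI allI impI)
      fix A assume A: "affine_space m A \<and> M \<subseteq> A \<and> A \<subseteq> \<Union> F"
      then obtain S where "S \<in> F" "A \<subseteq> S" using affine_subset_Union[OF finF affF] by blast
      with M(3)[of S] A show "A = M" by blast
    qed (use M affF in auto)
    moreover have "d \<in> direction M" using direction_mono[OF M(2)] dirF[OF x(1)] x(2) by blast
    ultimately show "d \<in> (\<Union>A\<in>affine_components m (\<Union> F). direction A)" by blast
  qed
qed

section \<open>Automata representing integer vectors\<close>

definition wval :: "nat \<Rightarrow> nat \<Rightarrow> nat list list \<Rightarrow> int vec" where
  "wval r m w = vec m (\<lambda>i. int (val r i w))"

text \<open>A sign \<open>s\<close> contributes \<open>s / (1 - r)\<close>, which is -1 for
  \<open>s = r - 1\<close>, as in two's complement.\<close>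

definition sign_vec :: "nat \<Rightarrow> nat list \<Rightarrow> int vec" where
  "sign_vec m s = vec m (\<lambda>i. if s ! i = 0 then 0 else -1)"

lemma wval_simps [simp]: "wval r m w \<in> carrier_vec m" "dim_vec (wval r m w) = m"
    "i < m \<Longrightarrow> wval r m w $ i = int (val r i w)"
  and sign_vec_simps [simp]: "sign_vec m s \<in> carrier_vec m" "dim_vec (sign_vec m s) = m"
    "i < m \<Longrightarrow> sign_vec m s $ i = (if s ! i = 0 then 0 else -1)"
  by (simp_all add: wval_def sign_vec_def)

text \<open>The integer vector obtained by reading \<open>w\<close> and continuing with any
  representation of \<open>c\<close>.\<close>

definition point :: "nat \<Rightarrow> nat \<Rightarrow> nat list list \<Rightarrow> int vec \<Rightarrow> int vec" where
  "point r m w c = wval r m w + int r ^ length w \<cdot>\<^sub>v c"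

lemma point_simps [simp]: "c \<in> carrier_vec m \<Longrightarrow> point r m w c \<in> carrier_vec m"
  "c \<in> carrier_vec m \<Longrightarrow> dim_vec (point r m w c) = m"
  "c \<in> carrier_vec m \<Longrightarrow> i < m \<Longrightarrow> point r m w c $ i = int (val r i w) + int r ^ length w * c $ i"
  by (auto simp: point_def)

lemma val_eq_sum: "w \<in> lists (digit_vectors r m) \<Longrightarrow> i < m \<Longrightarrow> val r i w = (\<Sum>j<length w. r ^ j * (w ! j ! i))"
proof (induction w)
  case (Cons d w)
  have "nth0 i d = d ! i" using Cons.prems by (intro nth0_nth) (auto simp: digit_vectors_def)
  moreover have "val r i w = (\<Sum>j<length w. r ^ j * (w ! j ! i))" using Cons by simp
  ultimately show ?case unfolding length_Cons sum.lessThan_Suc_shift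
    by (simp add: sum_distrib_left algebra_simps)
qed simp

lemma rho_eq_point:
  assumes "r \<ge> 2" "w \<in> lists (digit_vectors r m)" "s \<in> sign_vectors r m"
  shows "rho r m w s = rv (point r m w (sign_vec m s))"
proof (rule eq_vecI)
  fix i assume "i < dim_vec (rv (point r m w (sign_vec m s)))"
  hence i: "i < m" by simp
  hence "s ! i \<in> {0, r - 1}" using assms(3) unfolding sign_vectors_def by (metis (mono_tags, lifting) mem_Collect_eq nth_mem subsetD)
  hence "rat_of_nat (s ! i) / (1 - rat_of_nat r) = rat_of_int (sign_vec m s $ i)"
    using assms(1) i by (auto simp: of_nat_diff field_simps)
  thus "rho r m w s $ i = rv (point r m w (sign_vec m s)) $ i"
    using i val_eq_sum[OF assms(2) i] by (simp add: rho_def del: times_divide_eq_right)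
qed (simp add: rho_def)

text \<open>Repeated division with remainder. Division by \<open>r\<close> strictly decreases the
  absolute value of every integer other than 0 and -1, and these two are the values of a
  sign.\<close>

lemma ex_representation:
  assumes "r \<ge> 2" "c \<in> carrier_vec m"
  shows "\<exists>w\<in>lists (digit_vectors r m). \<exists>s\<in>sign_vectors r m. c = point r m w (sign_vec m s)"
  using assms(2)
proof (induction "\<Sum>i<m. nat \<bar>c $ i\<bar>" arbitrary: c rule: less_induct)
  case less
  note c = \<open>c \<in> carrier_vec m\<close>
  show ?case
  proof (cases "\<forall>i<m. c $ i = 0 \<or> c $ i = -1")
    case True
    let ?s = "map (\<lambda>i. if c $ i = 0 then 0 else r - 1) [0..<m]"
    have "?s \<in> sign_vectors r m" by (auto simp: sign_vectors_def)
    moreover have "c = point r m [] (sign_vec m ?s)"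
      using True c assms(1) by (intro eq_vecI) auto
    ultimately show ?thesis by blast
  next
    case False
    then obtain k where k: "k < m" "c $ k \<noteq> 0" "c $ k \<noteq> -1" by blast
    define c' where "c' = vec m (\<lambda>i. c $ i div int r)"
    define d where "d = map (\<lambda>i. nat (c $ i mod int r)) [0..<m]"
    have le: "\<bar>y div int r\<bar> \<le> \<bar>y\<bar> \<and> (y \<noteq> 0 \<longrightarrow> y \<noteq> -1 \<longrightarrow> \<bar>y div int r\<bar> < \<bar>y\<bar>)" for y
    proof -
      define z where "z = y div int r"
      have y: "y = int r * z + y mod int r" "0 \<le> y mod int r" "y mod int r < int r"
        using assms(1) by (auto simp: z_def)
      show ?thesis
      proof (cases "z \<ge> 0")
        case True
        have "2 * z \<le> int r * z" using True assms(1) by (intro mult_right_mono) auto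
        thus ?thesis unfolding z_def[symmetric] using y True by linarith
      next
        case False
        hence "int r * (z + 1) \<le> 2 * (z + 1)" using assms(1) by (intro mult_right_mono_neg) auto
        hence "y < 2 * (z + 1)" using y by (simp add: algebra_simps)
        thus ?thesis unfolding z_def[symmetric] using False by arith
      qed
    qed
    have "(\<Sum>i<m. nat \<bar>c' $ i\<bar>) < (\<Sum>i<m. nat \<bar>c $ i\<bar>)"
    proof (rule sum_strict_mono_ex1)
      show "\<forall>i\<in>{..<m}. nat \<bar>c' $ i\<bar> \<le> nat \<bar>c $ i\<bar>"
        using le by (simp add: c'_def nat_mono)
      show "\<exists>i\<in>{..<m}. nat \<bar>c' $ i\<bar> < nat \<bar>c $ i\<bar>" using le[of "c $ k"] k by (intro bexI[of _ k]) (auto simp: c'_def)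
    qed simp
    then obtain w s where ws: "w \<in> lists (digit_vectors r m)" "s \<in> sign_vectors r m" "c' = point r m w (sign_vec m s)"
      using less.hyps[of c'] by (auto simp: c'_def)
    have "nat (y mod int r) \<le> r - 1" for y
    proof -
      have "0 \<le> y mod int r" "y mod int r < int r" using assms(1) by auto
      thus ?thesis by linarith
    qed
    hence "d \<in> digit_vectors r m" by (auto simp: d_def digit_vectors_def)
    moreover have "c = point r m (d # w) (sign_vec m s)"
    proof (rule eq_vecI)
      fix i assume "i < dim_vec (point r m (d # w) (sign_vec m s))"
      hence i: "i < m" by simp
      have "c $ i = c $ i mod int r + int r * (c' $ i)" using i by (simp add: c'_def)
      also have "\<dots> = int (nth0 i d) + int r * (c' $ i)" using i assms(1) by (simp add: d_def nth0_nth)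
      finally show "c $ i = point r m (d # w) (sign_vec m s) $ i"
        using i by (simp add: ws(3) algebra_simps)
    qed (use c in simp)
    ultimately show ?thesis using ws by (metis lists.Cons)
  qed
qed

locale represented =
  fixes r m :: nat and A :: fdva and X :: "int vec set"
  assumes r: "r \<ge> 2" and wf: "wf_fdva r m A" and X: "X \<subseteq> carrier_vec m" and rep: "represents r m A X"
begin

abbreviation "edges \<equiv> set (transitions A)"
abbreviation "Q \<equiv> states A"
abbreviation "tr \<equiv> transitions A"
abbreviation "q0 \<equiv> start A"

lemma edge: "((a, d), b) \<in> edges \<Longrightarrow> a \<in> set Q \<and> b \<in> set Q \<and> d \<in> digit_vectors r m \<and> delta A a d = b"
proof -
  assume e: "((a, d), b) \<in> edges"
  have "(a, d) \<in> fst ` edges" "b \<in> snd ` edges" using e by force+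
  moreover have "map_of tr (a, d) = Some b" using wf e unfolding wf_fdva_def by simp
  ultimately show ?thesis using wf unfolding wf_fdva_def delta_def by auto
qed

lemma edge_total: "a \<in> set Q \<Longrightarrow> d \<in> digit_vectors r m \<Longrightarrow> ((a, d), delta A a d) \<in> edges"
proof -
  assume "a \<in> set Q" "d \<in> digit_vectors r m"
  hence "(a, d) \<in> fst ` edges" using wf unfolding wf_fdva_def by auto
  then obtain b where "((a, d), b) \<in> edges" by force
  with edge show ?thesis by blast
qed

lemma start_state: "q0 \<in> set Q"
  using wf unfolding wf_fdva_def by simp

lemma runs_foldl: "runs edges p w q \<Longrightarrow> w \<in> lists (digit_vectors r m) \<and> foldl (delta A) p w = q \<and> (p \<in> set Q \<longrightarrow> q \<in> set Q)"
  by (induction w arbitrary: p) (auto dest: edge)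

lemma foldl_runs: "p \<in> set Q \<Longrightarrow> w \<in> lists (digit_vectors r m) \<Longrightarrow> runs edges p w (foldl (delta A) p w)"
proof (induction w arbitrary: p)
  case (Cons d w)
  hence "((p, d), delta A p d) \<in> edges" by (intro edge_total) auto
  moreover have "runs edges (delta A p d) w (foldl (delta A) (delta A p d) w)"
    using Cons edge[OF \<open>((p, d), delta A p d) \<in> edges\<close>] by (intro Cons.IH) auto
  ultimately show ?case by auto
qed simp

lemma accept:
  assumes "runs edges q0 w p" "s \<in> sign_vectors r m"
  shows "point r m w (sign_vec m s) \<in> X \<longleftrightarrow> s \<in> final_fun A p"
proof -
  have w: "w \<in> lists (digit_vectors r m)" "foldl (delta A) q0 w = p" using runs_foldl[OF assms(1)] by auto
  have "rho r m w s \<in> rat_points X \<longleftrightarrow> s \<in> final_fun A p"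
    using rep w assms(2) unfolding represents_def by blast
  thus ?thesis unfolding rho_eq_point[OF r w(1) assms(2)] by simp
qed

lemma finals_final_fun:
  "(p, ss) \<in> set (finals A) \<Longrightarrow> final_fun A p = set ss \<and> set ss \<subseteq> sign_vectors r m"
  "p \<in> set Q \<Longrightarrow> \<exists>ss. (p, ss) \<in> set (finals A)"
proof -
  assume f: "(p, ss) \<in> set (finals A)"
  hence "map_of (finals A) p = Some ss" using wf unfolding wf_fdva_def by simp
  thus "final_fun A p = set ss \<and> set ss \<subseteq> sign_vectors r m"
    using wf f unfolding wf_fdva_def final_fun_def by auto
next
  assume "p \<in> set Q"
  hence "p \<in> fst ` set (finals A)" using wf unfolding wf_fdva_def by auto
  thus "\<exists>ss. (p, ss) \<in> set (finals A)" by force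
qed

lemma useful_iff:
  "q \<in> set (useful tr Q q0 (finals A)) \<longleftrightarrow>
    (\<exists>u. runs edges q0 u q) \<and> (\<exists>w p. runs edges q w p \<and> final_fun A p \<noteq> {})"
proof -
  have "(\<exists>f\<in>set (finals A). snd f \<noteq> [] \<and> reaches tr q (fst f)) \<longleftrightarrow> (\<exists>w p. runs edges q w p \<and> final_fun A p \<noteq> {})"
    if "q \<in> set Q"
  proof
    assume "\<exists>f\<in>set (finals A). snd f \<noteq> [] \<and> reaches tr q (fst f)"
    then obtain p ss where "(p, ss) \<in> set (finals A)" "ss \<noteq> []" "reaches tr q p" by auto
    thus "\<exists>w p. runs edges q w p \<and> final_fun A p \<noteq> {}"
      using finals_final_fun(1)[of p ss] unfolding reaches_iff by (metis set_empty)
  next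
    assume "\<exists>w p. runs edges q w p \<and> final_fun A p \<noteq> {}"
    then obtain w p where p: "runs edges q w p" "final_fun A p \<noteq> {}" by blast
    then obtain ss where "(p, ss) \<in> set (finals A)" using runs_foldl[OF p(1)] finals_final_fun(2) \<open>q \<in> set Q\<close> by blast
    with p show "\<exists>f\<in>set (finals A). snd f \<noteq> [] \<and> reaches tr q (fst f)"
      using finals_final_fun(1)[of p ss] unfolding reaches_iff by (intro bexI[of _ "(p, ss)"]) auto
  qed
  moreover have "q \<in> set Q" if "runs edges q0 u q" for u
    using runs_foldl[OF that] start_state by blast
  ultimately show ?thesis unfolding useful_def by (auto simp: reaches_iff)
qed

text \<open>The space \<open>V q\<close> in the form in which the algorithm generates it.\<close>

definition loop_space :: "nat \<Rightarrow> rat vec set" where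
  "loop_space q = span_Q m (rvec m ` set (generators r m tr Q q))"

lemma loop_space_equal_length:
  assumes q: "q \<in> set Q" and w: "runs edges q w q" "runs edges q w' q" "length w = length w'"
  shows "vec m (\<lambda>i. qval r w i - qval r w' i) \<in> loop_space q"
proof -
  define U where "U = (\<lambda>f. vec m f \<in> loop_space q)"
  note L = subspace_QD[OF subspace_span_Q[OF rvec_image_carrier[of m "set (generators r m tr Q q)"]], folded loop_space_def]
  have lin: "linear_pred U"
    unfolding linear_pred_def U_def
  proof (intro conjI allI impI)
    show "vec m (\<lambda>_. 0) \<in> loop_space q" using L(2) unfolding zero_vec_def .
    fix f g :: "nat \<Rightarrow> rat" assume "vec m f \<in> loop_space q" "vec m g \<in> loop_space q"
    moreover have "vec m (\<lambda>i. f i + g i) = vec m f + vec m g" by (intro eq_vecI) auto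
    ultimately show "vec m (\<lambda>i. f i + g i) \<in> loop_space q" using L(3) by simp
  next
    fix c and f :: "nat \<Rightarrow> rat" assume "vec m f \<in> loop_space q"
    moreover have "vec m (\<lambda>i. c * f i) = c \<cdot>\<^sub>v vec m f" by (intro eq_vecI) auto
    ultimately show "vec m (\<lambda>i. c * f i) \<in> loop_space q" using L(4) by simp
  qed
  have "U (\<lambda>i. qval r w i - qval r w' i)"
  proof (rule equal_length_loops[where tr = tr and Q = Q and q = q, OF r _ q lin _ w])
    fix u u' assume u: "u \<in> set (short_loops tr Q q)" "u' \<in> set (short_loops tr Q q)"
    have "rvec m (commutator r m u u') = vec m (\<lambda>i. qval r (u @ u') i - qval r (u' @ u) i)"
      by (intro eq_vecI) (auto simp: commutator_def nth0_nth)
    moreover have "commutator r m u u' \<in> set (generators r m tr Q q)"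
      using u unfolding generators_def by auto
    ultimately show "U (\<lambda>i. qval r (u @ u') i - qval r (u' @ u) i)"
      unfolding U_def loop_space_def using span_Q_superset[OF rvec_image_carrier[of m "set (generators r m tr Q q)"]] by force
  qed (use edge in blast)
  thus ?thesis unfolding U_def .
qed

subsection \<open>Loop spaces are contained in the hull direction\<close>

definition geo :: "nat \<Rightarrow> nat \<Rightarrow> nat" where
  "geo l n = (\<Sum>j<n. r ^ (l * j))"

lemma val_replicate: "val r i (concat (replicate n a)) = geo (length a) n * val r i a"
proof (induction n)
  case (Suc n)
  have "concat (replicate (Suc n) a) = concat (replicate n a) @ a"
    by (induction n) auto
  thus ?case using Suc by (simp add: val_append geo_def length_concat sum_list_replicate algebra_simps power_mult)
qed (simp add: geo_def)

lemma geo_add: "geo l (s + t) = geo l s + r ^ (l * s) * geo l t"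
  by (induction t) (auto simp: geo_def algebra_simps power_add)

text \<open>Exchanging the first \<open>t\<close> of \<open>k\<close> copies of \<open>b\<close> for
  \<open>a\<close> moves the value along the line spanned by \<open>val a - val b\<close>. The
  multiplier is strictly increasing in \<open>t\<close>.\<close>

lemma val_exchange:
  assumes "length a = length b" "t \<le> k"
  shows "int (val r i (u @ concat (replicate t a) @ concat (replicate (k - t) b) @ v)) =
    int (val r i (u @ concat (replicate k b) @ v)) + int (r ^ length u * geo (length b) t) * (int (val r i a) - int (val r i b))"
proof -
  have "geo (length b) k = geo (length b) t + r ^ (length b * t) * geo (length b) (k - t)"
    using geo_add[of "length b" t "k - t"] assms(2) by simp
  moreover have "length b * t + length b * (k - t) = length b * k"
    using assms(2) by (simp add: algebra_simps flip: distrib_left)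
  hence "r ^ (length b * k) = r ^ (length b * t) * r ^ (length b * (k - t))" by (simp flip: power_add)
  ultimately show ?thesis using assms(1)
    by (simp add: val_append val_replicate length_concat sum_list_replicate algebra_simps)
qed

lemma point_exchange:
  assumes "length w = length w'" "c \<in> carrier_vec m"
    and "\<And>i. int (val r i w) = int (val r i w') + int N * (int (val r i a) - int (val r i b))"
  shows "rv (point r m w c) = rv (point r m w' c) + rat_of_nat N \<cdot>\<^sub>v rv (wval r m a - wval r m b)"
proof (rule eq_vecI)
  fix i assume "i < dim_vec (rv (point r m w' c) + rat_of_nat N \<cdot>\<^sub>v rv (wval r m a - wval r m b))"
  hence i: "i < m" by simp
  have "point r m w c $ i = point r m w' c $ i + int N * (wval r m a - wval r m b) $ i"
    using i assms(1,2) assms(3)[of i] by simp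
  from arg_cong[OF this, of rat_of_int] show "rv (point r m w c) $ i =
      (rv (point r m w' c) + rat_of_nat N \<cdot>\<^sub>v rv (wval r m a - wval r m b)) $ i"
    using i assms(2) by simp
qed (use assms(2) in simp)

lemma geo_strict_mono: "s < t \<Longrightarrow> geo l s < geo l t"
proof (induction t)
  case (Suc t)
  have "geo l t < geo l (Suc t)" using r by (simp add: geo_def)
  thus ?case using Suc by (cases "s = t") auto
qed simp

text \<open>The branches at the level of a pair \<open>(a, b)\<close> are the words
  \<open>a^n b^(k - n)\<close> with \<open>n \<le> k\<close>. They are loops of the same length, so
  all leaves reach the same state and are accepted with the same sign vector. Every pair contributes
  a level, so a single tree treats all of them.\<close>

lemma fan_loops:
  assumes fin: "runs edges q t p" "s \<in> final_fun A p" "s \<in> sign_vectors r m"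
    and prs: "\<And>a b. (a, b) \<in> set prs \<Longrightarrow> runs edges q a q \<and> runs edges q b q \<and> length a = length b"
    and u: "runs edges q0 u q"
  shows "fan k (rv (point r m (u @ concat (map (\<lambda>(a, b). concat (replicate k b)) prs) @ t) (sign_vec m s)))
    (map (\<lambda>(a, b). rv (wval r m a - wval r m b)) prs) (rat_points X)"
  using prs u
proof (induction prs arbitrary: u)
  case Nil
  have "runs edges q0 (u @ t) p" using Nil fin(1) by (auto simp: runs_append)
  thus ?case using accept[of "u @ t" p s] fin by simp
next
  case (Cons ab prs)
  obtain a b where ab: "ab = (a, b)" by (cases ab)
  have loops: "runs edges q a q" "runs edges q b q" "length a = length b"
    using Cons.prems(1)[of a b] ab by auto
  let ?v = "concat (map (\<lambda>(a, b). concat (replicate k b)) prs) @ t"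
  let ?d = "rv (wval r m a - wval r m b)"
  let ?c = "rv (point r m (u @ concat (replicate k b) @ ?v) (sign_vec m s))"
  define x where "x = (\<lambda>n. rat_of_nat (r ^ length u * geo (length b) n))"
  have rep: "runs edges q (concat (replicate n w)) q" if "runs edges q w q" for n w
    using that by (induction n) (auto simp: runs_append)
  have "fan k (?c + x n \<cdot>\<^sub>v ?d) (map (\<lambda>(a, b). rv (wval r m a - wval r m b)) prs) (rat_points X)" if n: "n \<le> k" for n
  proof -
    let ?u = "u @ concat (replicate n a) @ concat (replicate (k - n) b)"
    have "runs edges q0 ?u q" using Cons.prems(2) rep loops by (auto simp: runs_append)
    hence "fan k (rv (point r m (?u @ ?v) (sign_vec m s)))
      (map (\<lambda>(a, b). rv (wval r m a - wval r m b)) prs) (rat_points X)"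
      by (intro Cons.IH) (use Cons.prems(1) in auto)
    moreover have "rv (point r m (?u @ ?v) (sign_vec m s)) = ?c + x n \<cdot>\<^sub>v ?d"
      unfolding x_def
    proof (rule point_exchange)
      have "n * length b + (k - n) * length b = k * length b" using n by (simp flip: distrib_right)
      thus "length (?u @ ?v) = length (u @ concat (replicate k b) @ ?v)"
        using loops(3) by (simp add: length_concat sum_list_replicate)
      show "int (val r i (?u @ ?v)) = int (val r i (u @ concat (replicate k b) @ ?v)) +
          int (r ^ length u * geo (length b) n) * (int (val r i a) - int (val r i b))" for i
        using val_exchange[OF loops(3) n, of i u ?v] unfolding append_assoc .
    qed (rule sign_vec_simps)
    ultimately show ?thesis by simp
  qed
  moreover have "inj_on x {..k}"
  proof (rule inj_onI)
    fix n n' assume "x n = x n'"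
    hence "r ^ length u * geo (length b) n = r ^ length u * geo (length b) n'" unfolding x_def by (simp only: of_nat_eq_iff)
    hence "geo (length b) n = geo (length b) n'" using r by simp
    thus "n = n'" using geo_strict_mono[of n n' "length b"] geo_strict_mono[of n' n "length b"] by linarith
  qed
  hence "finite (x ` {..k})" "card (x ` {..k}) > k" by (auto simp: card_image)
  ultimately have "\<exists>R. finite R \<and> card R > k \<and>
      (\<forall>y\<in>R. fan k (?c + y \<cdot>\<^sub>v ?d) (map (\<lambda>(a, b). rv (wval r m a - wval r m b)) prs) (rat_points X))"
    by (intro exI[of _ "x ` {..k}"]) blast
  thus ?case unfolding ab by simp
qed

lemma loop_space_subset:
  assumes F: "finite F" "\<And>S. S \<in> F \<Longrightarrow> affine_space m S" "rat_points X \<subseteq> \<Union> F"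
    and q: "q \<in> set (useful tr Q q0 (finals A))"
  shows "\<exists>S\<in>F. loop_space q \<subseteq> direction S"
proof -
  obtain u w p s where u: "runs edges q0 u q" and w: "runs edges q w p" "s \<in> final_fun A p"
    using q unfolding useful_iff by blast
  have "p \<in> set Q" using u w runs_foldl start_state by blast
  then obtain ss where "(p, ss) \<in> set (finals A)" using finals_final_fun(2) by blast
  hence s: "s \<in> sign_vectors r m" using finals_final_fun(1) w(2) by blast
  define prs where "prs = concat (map (\<lambda>w. map (\<lambda>w'. (w @ w', w' @ w)) (short_loops tr Q q)) (short_loops tr Q q))"
  have prs: "runs edges q a q \<and> runs edges q b q \<and> length a = length b" if "(a, b) \<in> set prs" for a b
    using that short_loops_runs unfolding prs_def by (fastforce simp: runs_append)
  have gens: "rvec m ` set (generators r m tr Q q) = set (map (\<lambda>(a, b). rv (wval r m a - wval r m b)) prs)"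
  proof -
    have "rvec m (commutator r m w w') = rv (wval r m (w @ w') - wval r m (w' @ w))" for w w'
      by (intro eq_vecI) (auto simp: commutator_def nth0_nth)
    thus ?thesis unfolding generators_def prs_def by (force simp: image_iff)
  qed
  let ?us = "map (\<lambda>(a, b). rv (wval r m a - wval r m b)) prs"
  have "\<exists>S\<in>F. rv (point r m (u @ concat (map (\<lambda>(a, b). concat (replicate (card F) b)) prs) @ w) (sign_vec m s)) \<in> S
     \<and> set ?us \<subseteq> direction S"
    by (rule fan_cover[OF F(1,2) order.refl F(3) _ _ fan_loops[OF w s prs u]]) auto
  then obtain S where S: "S \<in> F" "set ?us \<subseteq> direction S" by blast
  have "loop_space q \<subseteq> direction S"
    unfolding loop_space_def gens by (rule span_Q_minimal[OF affine_spaceD(3)[OF F(2)[OF S(1)]] S(2)])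
  with S(1) show ?thesis by blast
qed

end

section \<open>Recurrence in finite graphs\<close>

text \<open>Among the points reachable from \<open>v\<close>, one that reaches the fewest points
  lies in a terminal strongly connected component.\<close>

lemma ex_recurrent:
  assumes "finite G" "v \<in> G" "Rel \<subseteq> G \<times> G"
  obtains u where "(v, u) \<in> Rel\<^sup>*" "\<And>x. (u, x) \<in> Rel\<^sup>* \<Longrightarrow> (x, u) \<in> Rel\<^sup>*"
proof -
  have inG: "x \<in> G" if "(v, x) \<in> Rel\<^sup>*" for x
    using that assms(2,3) by (induction rule: rtrancl_induct) auto
  define D where "D = (\<lambda>u. {x. (u, x) \<in> Rel\<^sup>*})"
  obtain u where u: "(v, u) \<in> Rel\<^sup>*" "\<And>x. (v, x) \<in> Rel\<^sup>* \<Longrightarrow> card (D u) \<le> card (D x)"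
    using ex_has_least_nat[of "\<lambda>u. (v, u) \<in> Rel\<^sup>*" v "\<lambda>u. card (D u)"] by auto
  have "(x, u) \<in> Rel\<^sup>*" if x: "(u, x) \<in> Rel\<^sup>*" for x
  proof -
    have "(v, x) \<in> Rel\<^sup>*" using u(1) x by (rule rtrancl_trans)
    have sub: "D x \<subseteq> D u" unfolding D_def using x by (auto intro: rtrancl_trans)
    have "D u \<subseteq> G" unfolding D_def using inG u(1) by (auto intro: rtrancl_trans)
    hence "finite (D u)" using assms(1) finite_subset by blast
    hence "D x = D u" using card_seteq[OF _ sub] u(2)[OF \<open>(v, x) \<in> Rel\<^sup>*\<close>] by blast
    thus ?thesis unfolding D_def by blast
  qed
  with u(1) that show thesis by blast
qed

lemma iterate_cycle:
  assumes "finite G" "v \<in> G" "\<And>x. x \<in> G \<Longrightarrow> f x \<in> G"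
  shows "\<exists>i l. l > 0 \<and> (f ^^ l) ((f ^^ i) v) = (f ^^ i) v"
proof -
  have "(f ^^ n) v \<in> G" for n using assms(2,3) by (induction n) auto
  hence "range (\<lambda>n. (f ^^ n) v) \<subseteq> G" by blast
  hence "\<not> inj (\<lambda>n. (f ^^ n) v)" using assms(1) finite_subset finite_imageD infinite_UNIV_nat by blast
  then obtain i j where ij: "i < j" "(f ^^ i) v = (f ^^ j) v"
    unfolding inj_on_def by (metis nat_neq_iff)
  have "(f ^^ (j - i)) ((f ^^ i) v) = (f ^^ j) v"
    using ij(1) by (metis comp_apply funpow_add le_add_diff_inverse2 less_imp_le)
  with ij show ?thesis by (intro exI[of _ i] exI[of _ "j - i"]) simp
qed

lemma finite_box: "finite {c \<in> carrier_vec m. \<forall>i<m. \<bar>c $ i :: int\<bar> \<le> b}"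
proof (rule finite_subset)
  show "{c \<in> carrier_vec m. \<forall>i<m. \<bar>c $ i\<bar> \<le> b} \<subseteq> vec_of_list ` {l. set l \<subseteq> {-b..b} \<and> length l = m}"
  proof
    fix c assume c: "c \<in> {c \<in> carrier_vec m. \<forall>i<m. \<bar>c $ i\<bar> \<le> b}"
    have "c = vec_of_list (map (\<lambda>i. c $ i) [0..<m])"
      using c by (intro eq_vecI) (auto simp: vec_of_list_index)
    moreover have "map (\<lambda>i. c $ i) [0..<m] \<in> {l. set l \<subseteq> {-b..b} \<and> length l = m}"
      using c by (auto simp: abs_le_iff)
    ultimately show "c \<in> vec_of_list ` {l. set l \<subseteq> {-b..b} \<and> length l = m}" by (rule image_eqI)
  qed
qed (simp add: finite_lists_length_eq)

lemma point_Nil: "c \<in> carrier_vec m \<Longrightarrow> point r m [] c = c"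
  by (intro eq_vecI) auto

context represented
begin

subsection \<open>Periods lie in a loop space\<close>

primrec zval :: "nat \<Rightarrow> int vec list \<Rightarrow> int" where
  "zval i [] = 0"
| "zval i (z # zs) = z $ i + int r * zval i zs"

lemma zval_append: "zval i (zs @ zs') = zval i zs + int r ^ length zs * zval i zs'"
  by (induction zs) (auto simp: algebra_simps)

lemma zval_zeros: "i < m \<Longrightarrow> zval i (replicate n (0\<^sub>v m)) = 0"
  by (induction n) auto

text \<open>A configuration \<open>(c, q)\<close> consists of a carry and a state. Adding the vectors \<open>zs\<close>, one per
  digit position, to the carry makes the automaton read the word \<open>w\<close> and leaves a new carry.\<close>

definition conn :: "int vec \<times> nat \<Rightarrow> int vec list \<Rightarrow> nat list list \<Rightarrow> int vec \<times> nat \<Rightarrow> bool" where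
  "conn a zs w b \<longleftrightarrow> runs edges (snd a) w (snd b) \<and> length w = length zs \<and>
     (\<forall>i<m. fst a $ i + zval i zs = int (val r i w) + int r ^ length zs * fst b $ i)"

lemma conn_append: "conn a zs w b \<Longrightarrow> conn b zs' w' c \<Longrightarrow> conn a (zs @ zs') (w @ w') c"
proof -
  assume 1: "conn a zs w b" and 2: "conn b zs' w' c"
  have "fst a $ i + zval i (zs @ zs') = int (val r i (w @ w')) + int r ^ length (zs @ zs') * fst c $ i"
    if i: "i < m" for i
  proof -
    have e1: "fst a $ i + zval i zs = int (val r i w) + int r ^ length zs * fst b $ i"
      using 1 i unfolding conn_def by blast
    have e2: "fst b $ i + zval i zs' = int (val r i w') + int r ^ length zs' * fst c $ i"
      using 2 i unfolding conn_def by blast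
    have "fst a $ i + zval i (zs @ zs') = int (val r i w) + int r ^ length zs * (fst b $ i + zval i zs')"
      using e1 by (simp add: zval_append algebra_simps)
    also have "\<dots> = int (val r i (w @ w')) + int r ^ length (zs @ zs') * fst c $ i"
      using 1 unfolding e2 conn_def by (simp add: val_append power_add algebra_simps)
    finally show ?thesis .
  qed
  thus ?thesis using 1 2 unfolding conn_def by (auto simp: runs_append)
qed

lemma conn_Nil: "conn a [] [] a"
  unfolding conn_def by simp

text \<open>A closed walk at a configuration with carry \<open>c\<close> satisfies
  \<open>c + zval zs = val w + r ^ length zs * c\<close>. Its commutator with a closed walk that
  adds only zeros eliminates \<open>c\<close> and leaves a nonzero multiple of
  \<open>zval zs\<close> in the loop space. A period \<open>p\<close> is isolated by comparing two
  closed walks that begin with \<open>p\<close> and differ by a cycle of zeros inserted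
  later.\<close>

lemma periods_in_loop_space:
  assumes x: "x \<in> X"
    and K: "K \<subseteq> carrier_vec m" "\<And>u v. u \<in> K \<Longrightarrow> v \<in> K \<Longrightarrow> u + v \<in> K" "0\<^sub>v m \<in> K"
    and sub: "\<And>v. v \<in> K \<Longrightarrow> x + v \<in> X"
    and P: "finite P" "P \<subseteq> K"
  shows "\<exists>q\<in>set (useful tr Q q0 (finals A)). rv ` P \<subseteq> loop_space q"
proof -
  define Z where "Z = insert (0\<^sub>v m) P"
  have Z: "finite Z" "Z \<subseteq> K" "Z \<subseteq> carrier_vec m" unfolding Z_def using P K by auto
  \<comment> \<open>The box of radius \<open>b\<close> is closed under steps: a carry and a summand
    add up to at most \<open>2 * b \<le> r * b\<close> in absolute value, and division by
    \<open>r\<close> returns to the box.\<close>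
  define b where "b = Max (insert 0 ((\<lambda>(v, i). \<bar>v $ i\<bar>) ` (insert x Z \<times> {..<m})))"
  have b: "0 \<le> b" "\<And>v i. v \<in> insert x Z \<Longrightarrow> i < m \<Longrightarrow> \<bar>v $ i\<bar> \<le> b"
    unfolding b_def using Z(1) by (auto intro!: Max_ge)
  \<comment> \<open>After reading \<open>u\<close> with carry \<open>c\<close>, all of
    \<open>c + K\<close> still completes to points of \<open>X\<close>. A step keeps this because
    \<open>z + r * v\<close> belongs to the monoid whenever \<open>z\<close> and \<open>v\<close>
    do.\<close>
  define good where "good = (\<lambda>a :: int vec \<times> nat. \<exists>u. runs edges q0 u (snd a) \<and>
     (\<forall>v\<in>K. point r m u (fst a + v) \<in> X))"
  define G where "G = {a. good a} \<inter> ({c \<in> carrier_vec m. \<forall>i<m. \<bar>c $ i\<bar> \<le> b} \<times> set Q)"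
  have finG: "finite G" unfolding G_def using finite_box by (intro finite_Int disjI2 finite_cartesian_product) auto
  have start: "(x, q0) \<in> G"
  proof -
    have "point r m [] (x + v) = x + v" if "v \<in> K" for v
    proof -
      have "x + v \<in> carrier_vec m" using that K(1) X x by (intro add_carrier_vec) auto
      thus ?thesis by (rule point_Nil)
    qed
    hence "good (x, q0)" unfolding good_def using sub by (intro exI[of _ "[]"]) auto
    thus ?thesis unfolding G_def using b X x start_state by auto
  qed
  have step: "\<exists>w a'. conn a [z] w a' \<and> a' \<in> G" if a: "a \<in> G" and z: "z \<in> Z" for a z
  proof -
    obtain c q where aq: "a = (c, q)" by (cases a)
    have c: "c \<in> carrier_vec m" "q \<in> set Q" "\<And>i. i < m \<Longrightarrow> \<bar>c $ i\<bar> \<le> b" "good (c, q)"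
      using a unfolding G_def aq by auto
    have zc: "z \<in> carrier_vec m" using z Z(3) by blast
    define c' where "c' = vec m (\<lambda>i. (c $ i + z $ i) div int r)"
    define d where "d = map (\<lambda>i. nat ((c $ i + z $ i) mod int r)) [0..<m]"
    have c': "c' \<in> carrier_vec m" by (simp add: c'_def)
    have "nat (y mod int r) \<le> r - 1" for y
    proof -
      have "0 \<le> y mod int r" "y mod int r < int r" using r by auto
      thus ?thesis by linarith
    qed
    hence dd: "d \<in> digit_vectors r m" by (auto simp: d_def digit_vectors_def)
    have eq: "c $ i + z $ i = int (nth0 i d) + int r * c' $ i" if "i < m" for i
      using that r by (simp add: d_def c'_def nth0_nth)
    have e: "((q, d), delta A q d) \<in> edges" by (rule edge_total[OF c(2) dd])
    have conn: "conn (c, q) [z] [d] (c', delta A q d)"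
      unfolding conn_def using e eq by simp
    have "\<bar>c' $ i\<bar> \<le> b" if i: "i < m" for i
    proof -
      have "\<bar>c $ i + z $ i\<bar> \<le> 2 * b" using c(3)[OF i] b(2)[of z i] z i by auto
      moreover have "2 * b \<le> int r * b" using r b(1) by (intro mult_right_mono) auto
      ultimately have "- (int r * b) \<le> c $ i + z $ i" "c $ i + z $ i \<le> int r * b" by linarith+
      hence "(int r * (- b)) div int r \<le> (c $ i + z $ i) div int r" "(c $ i + z $ i) div int r \<le> (int r * b) div int r"
        by (intro zdiv_mono1; use r in simp)+
      moreover have "(int r * (- b)) div int r = - b" "(int r * b) div int r = b"
        using r by (intro nonzero_mult_div_cancel_left; simp)+
      ultimately show ?thesis using i r by (simp add: c'_def abs_le_iff)
    qed
    moreover have "good (c', delta A q d)"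
    proof -
      obtain u where u: "runs edges q0 u q" "\<And>v. v \<in> K \<Longrightarrow> point r m u (c + v) \<in> X"
        using c(4) unfolding good_def by auto
      have "point r m (u @ [d]) (c' + v) \<in> X" if v: "v \<in> K" for v
      proof -
        have mult: "int n \<cdot>\<^sub>v v \<in> K" for n
        proof (induction n)
          case 0
          have "int 0 \<cdot>\<^sub>v v = 0\<^sub>v m" using v K(1) by (intro eq_vecI) auto
          thus ?case using K(3) by metis
        next
          case (Suc n)
          have "int (Suc n) \<cdot>\<^sub>v v = v + int n \<cdot>\<^sub>v v" by (intro eq_vecI) (auto simp: algebra_simps)
          thus ?case using K(2)[OF v Suc] by metis
        qed
        have "z + int r \<cdot>\<^sub>v v \<in> K" using K(2) z Z(2) mult by blast
        moreover have "point r m (u @ [d]) (c' + v) = point r m u (c + (z + int r \<cdot>\<^sub>v v))"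
        proof (rule eq_vecI)
          have vc: "v \<in> carrier_vec m" using v K(1) by blast
          show "dim_vec (point r m (u @ [d]) (c' + v)) = dim_vec (point r m u (c + (z + int r \<cdot>\<^sub>v v)))"
            using vc c' c(1) zc by simp
          fix i assume "i < dim_vec (point r m u (c + (z + int r \<cdot>\<^sub>v v)))"
          hence i: "i < m" using vc c(1) zc by simp
          have "point r m u (c + (z + int r \<cdot>\<^sub>v v)) $ i
              = int (val r i u) + int r ^ length u * ((c $ i + z $ i) + int r * v $ i)"
            using i vc c(1) zc by (simp add: algebra_simps)
          also have "\<dots> = point r m (u @ [d]) (c' + v) $ i"
            unfolding eq[OF i] using i vc c' by (simp add: val_append algebra_simps)
          finally show "point r m (u @ [d]) (c' + v) $ i = point r m u (c + (z + int r \<cdot>\<^sub>v v)) $ i" by simp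
        qed
        ultimately show ?thesis using u(2) by simp
      qed
      moreover have "runs edges q0 (u @ [d]) (delta A q d)" using u(1) e by (auto simp: runs_append)
      ultimately show ?thesis unfolding good_def by auto
    qed
    ultimately have "(c', delta A q d) \<in> G" unfolding G_def using c' edge[OF e] by auto
    with conn aq show ?thesis by blast
  qed
  define Rel where "Rel = {(a, a'). a \<in> G \<and> a' \<in> G \<and> (\<exists>z\<in>Z. \<exists>w. conn a [z] w a')}"
  have RelG: "Rel \<subseteq> G \<times> G" unfolding Rel_def by blast
  have conn_rel: "\<exists>zs w. conn a zs w a'" if "(a, a') \<in> Rel\<^sup>*" for a a'
    using that
  proof (induction rule: rtrancl_induct)
    case base
    show ?case using conn_Nil by blast
  next
    case (step y z)
    thus ?case using conn_append unfolding Rel_def by blast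
  qed
  have "\<forall>a. \<exists>a'. a \<in> G \<longrightarrow> (\<exists>w. conn a [0\<^sub>v m] w a') \<and> a' \<in> G" using step unfolding Z_def by blast
  then obtain f where f: "\<And>a. a \<in> G \<Longrightarrow> \<exists>w. conn a [0\<^sub>v m] w (f a)" "\<And>a. a \<in> G \<Longrightarrow> f a \<in> G" by metis
  have iter: "(f ^^ n) a \<in> G \<and> (a, (f ^^ n) a) \<in> Rel\<^sup>* \<and> (\<exists>w. conn a (replicate n (0\<^sub>v m)) w ((f ^^ n) a))" if "a \<in> G" for a n
  proof (induction n)
    case 0
    show ?case using that conn_Nil[of a] by (auto intro: exI[of _ "[]"])
  next
    case (Suc n)
    then obtain w where w: "(f ^^ n) a \<in> G" "(a, (f ^^ n) a) \<in> Rel\<^sup>*" "conn a (replicate n (0\<^sub>v m)) w ((f ^^ n) a)" by blast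
    obtain w' where w': "conn ((f ^^ n) a) [0\<^sub>v m] w' (f ((f ^^ n) a))" using f(1)[OF w(1)] by blast
    have rel: "((f ^^ n) a, f ((f ^^ n) a)) \<in> Rel" unfolding Rel_def Z_def using w(1) w' f(2) by blast
    have eq: "(f ^^ Suc n) a = f ((f ^^ n) a)" by simp
    have "conn a (replicate (Suc n) (0\<^sub>v m)) (w @ w') (f ((f ^^ n) a))"
      using conn_append[OF w(3) w'] by (simp add: replicate_append_same)
    thus ?case unfolding eq using f(2)[OF w(1)] rtrancl_into_rtrancl[OF w(2) rel] by blast
  qed
  obtain v0 where v0: "((x, q0), v0) \<in> Rel\<^sup>*" "\<And>y. (v0, y) \<in> Rel\<^sup>* \<Longrightarrow> (y, v0) \<in> Rel\<^sup>*"
    using ex_recurrent[OF finG start RelG] by blast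
  have "v0 \<in> G"
    using v0(1)
  proof (induction rule: rtrancl_induct)
    case base
    show ?case by (rule start)
  next
    case (step y z)
    thus ?case using RelG by blast
  qed
  \<comment> \<open>Adding zeros from \<open>v0\<close> on eventually cycles. A point
    \<open>v\<close> on that cycle inherits recurrence from \<open>v0\<close> and has a closed walk
    of zeros.\<close>
  obtain i0 l0 where l0: "l0 > 0" "(f ^^ l0) ((f ^^ i0) v0) = (f ^^ i0) v0"
    using iterate_cycle[where f = f, OF finG \<open>v0 \<in> G\<close> f(2)] by blast
  define v where "v = (f ^^ i0) v0"
  have v: "v \<in> G" "(v0, v) \<in> Rel\<^sup>*" unfolding v_def using iter[OF \<open>v0 \<in> G\<close>] by auto
  have rec: "(y, v) \<in> Rel\<^sup>*" if "(v, y) \<in> Rel\<^sup>*" for y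
    using v0(2)[OF rtrancl_trans[OF v(2) that]] v(2) by (rule rtrancl_trans)
  obtain w0 where w0: "conn v (replicate l0 (0\<^sub>v m)) w0 v" using iter[OF v(1), of l0] l0(2) unfolding v_def by auto
  obtain c q where cq: "v = (c, q)" by (cases v)
  have c: "c \<in> carrier_vec m" "q \<in> set Q" using v(1) unfolding G_def cq by auto
  note L = subspace_QD[OF subspace_span_Q[OF rvec_image_carrier[of m "set (generators r m tr Q q)"]], folded loop_space_def]
  define R where "R = rat_of_nat r"
  have R: "R > 1" using r by (simp add: R_def)
  have loop: "vec m (\<lambda>i. rat_of_int (zval i zs)) \<in> loop_space q" if "conn v zs w v" for zs w
  proof -
    have runs: "runs edges q (w @ w0) q" "runs edges q (w0 @ w) q"
      using that w0 unfolding conn_def cq by (auto simp: runs_append)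
    have "vec m (\<lambda>i. qval r (w @ w0) i - qval r (w0 @ w) i) \<in> loop_space q"
      by (rule loop_space_equal_length[OF c(2) runs]) simp
    hence "(1 / (1 - R ^ l0)) \<cdot>\<^sub>v vec m (\<lambda>i. qval r (w @ w0) i - qval r (w0 @ w) i) \<in> loop_space q" by (rule L(4))
    also have "(1 / (1 - R ^ l0)) \<cdot>\<^sub>v vec m (\<lambda>i. qval r (w @ w0) i - qval r (w0 @ w) i) = vec m (\<lambda>i. rat_of_int (zval i zs))"
    proof (rule eq_vecI)
      fix i assume "i < dim_vec (vec m (\<lambda>i. rat_of_int (zval i zs)))"
      hence i: "i < m" by simp
      have len: "length w = length zs" "length w0 = l0" using that w0 unfolding conn_def by auto
      have "c $ i + zval i zs = int (val r i w) + int r ^ length zs * c $ i"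
        using that i unfolding conn_def cq by simp
      from arg_cong[OF this, of rat_of_int]
      have 1: "qval r w i = (1 - R ^ length zs) * rat_of_int (c $ i) + rat_of_int (zval i zs)"
        by (simp add: R_def algebra_simps)
      have "c $ i = int (val r i w0) + int r ^ l0 * c $ i"
        using w0 i unfolding conn_def cq by (simp add: zval_zeros)
      from arg_cong[OF this, of rat_of_int]
      have 2: "qval r w0 i = (1 - R ^ l0) * rat_of_int (c $ i)"
        by (simp add: R_def algebra_simps)
      have "qval r (w @ w0) i - qval r (w0 @ w) i = (qval r w i + R ^ length zs * qval r w0 i) - (qval r w0 i + R ^ l0 * qval r w i)"
        by (simp add: val_append len R_def)
      also have "\<dots> = (1 - R ^ l0) * rat_of_int (zval i zs)"
        unfolding 1 2 by (simp add: algebra_simps)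
      finally have "qval r (w @ w0) i - qval r (w0 @ w) i = (1 - R ^ l0) * rat_of_int (zval i zs)" .
      moreover have "1 - R ^ l0 \<noteq> 0" using one_less_power[OF R l0(1)] by simp
      ultimately show "((1 / (1 - R ^ l0)) \<cdot>\<^sub>v vec m (\<lambda>i. qval r (w @ w0) i - qval r (w0 @ w) i)) $ i =
          vec m (\<lambda>i. rat_of_int (zval i zs)) $ i" using i by simp
    qed simp
    finally show ?thesis .
  qed
  have "rv p \<in> loop_space q" if p: "p \<in> P" for p
  proof -
    have pZ: "p \<in> Z" "p \<in> carrier_vec m" using p P K unfolding Z_def by auto
    obtain w1 u1 where u1: "conn v [p] w1 u1" "u1 \<in> G" using step[OF v(1) pZ(1)] by blast
    obtain i1 l1 where l1: "l1 > 0" "(f ^^ l1) ((f ^^ i1) u1) = (f ^^ i1) u1"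
      using iterate_cycle[where f = f, OF finG u1(2) f(2)] by blast
    define u where "u = (f ^^ i1) u1"
    have u: "u \<in> G" "(u1, u) \<in> Rel\<^sup>*" unfolding u_def using iter[OF u1(2)] by auto
    obtain w2 where w2: "conn u1 (replicate i1 (0\<^sub>v m)) w2 u" using iter[OF u1(2)] unfolding u_def by blast
    obtain w3 where w3: "conn u (replicate l1 (0\<^sub>v m)) w3 u" using iter[OF u(1), of l1] l1(2) unfolding u_def by auto
    have "(v, u1) \<in> Rel" unfolding Rel_def using v(1) u1 pZ(1) by blast
    hence "(u, v) \<in> Rel\<^sup>*" using rec u(2) by (meson converse_rtrancl_into_rtrancl)
    then obtain zs w4 where w4: "conn u zs w4 v" using conn_rel by blast
    \<comment> \<open>With \<open>n = 1 + i1\<close> the two vectors are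
      \<open>p + r^n * zval zs\<close> and \<open>p + r^(n + l1) * zval zs\<close>. Multiplying the
      first by \<open>r^l1\<close> and subtracting the second leaves
      \<open>(r^l1 - 1) * p\<close>.\<close>
    have A: "vec m (\<lambda>i. rat_of_int (zval i ([p] @ replicate i1 (0\<^sub>v m) @ zs))) \<in> loop_space q"
      by (rule loop[OF conn_append[OF u1(1) conn_append[OF w2 w4]]])
    have B: "vec m (\<lambda>i. rat_of_int (zval i ([p] @ replicate i1 (0\<^sub>v m) @ replicate l1 (0\<^sub>v m) @ zs))) \<in> loop_space q"
      by (rule loop[OF conn_append[OF u1(1) conn_append[OF w2 conn_append[OF w3 w4]]]])
    have "(1 / (R ^ l1 - 1)) \<cdot>\<^sub>v (R ^ l1 \<cdot>\<^sub>v vec m (\<lambda>i. rat_of_int (zval i ([p] @ replicate i1 (0\<^sub>v m) @ zs)))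
       - vec m (\<lambda>i. rat_of_int (zval i ([p] @ replicate i1 (0\<^sub>v m) @ replicate l1 (0\<^sub>v m) @ zs)))) \<in> loop_space q"
      by (intro L(4,5) A B)
    also have "(1 / (R ^ l1 - 1)) \<cdot>\<^sub>v (R ^ l1 \<cdot>\<^sub>v vec m (\<lambda>i. rat_of_int (zval i ([p] @ replicate i1 (0\<^sub>v m) @ zs)))
       - vec m (\<lambda>i. rat_of_int (zval i ([p] @ replicate i1 (0\<^sub>v m) @ replicate l1 (0\<^sub>v m) @ zs)))) = rv p"
    proof (rule eq_vecI)
      fix i assume "i < dim_vec (rv p)"
      hence i: "i < m" using pZ(2) by simp
      have "R ^ l1 - 1 \<noteq> 0" using one_less_power[OF R l1(1)] by simp
      thus "((1 / (R ^ l1 - 1)) \<cdot>\<^sub>v (R ^ l1 \<cdot>\<^sub>v vec m (\<lambda>i. rat_of_int (zval i ([p] @ replicate i1 (0\<^sub>v m) @ zs)))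
       - vec m (\<lambda>i. rat_of_int (zval i ([p] @ replicate i1 (0\<^sub>v m) @ replicate l1 (0\<^sub>v m) @ zs))))) $ i = rv p $ i"
        using i pZ(2) by (simp add: zval_append zval_zeros field_simps R_def)
    qed (use pZ(2) in simp)
    finally show ?thesis .
  qed
  moreover have "q \<in> set (useful tr Q q0 (finals A))"
  proof -
    \<comment> \<open>\<open>0 \<in> K\<close> gives a point of \<open>X\<close> with prefix
      \<open>u\<close> and carry \<open>c\<close>. Continuing \<open>u\<close> by a representation
      of \<open>c\<close> yields an accepting run through \<open>q\<close>.\<close>
    obtain u where u: "runs edges q0 u q" "point r m u (c + 0\<^sub>v m) \<in> X"
      using v(1) K(3) unfolding G_def good_def cq by auto
    obtain w s where ws: "w \<in> lists (digit_vectors r m)" "s \<in> sign_vectors r m" "c = point r m w (sign_vec m s)"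
      using ex_representation[OF r c(1)] by blast
    define p where "p = foldl (delta A) q w"
    have w: "runs edges q w p" unfolding p_def by (rule foldl_runs[OF c(2) ws(1)])
    have "runs edges q0 (u @ w) p" using u(1) w by (auto simp: runs_append)
    moreover have "point r m (u @ w) (sign_vec m s) = point r m u (c + 0\<^sub>v m)"
      unfolding ws(3) by (intro eq_vecI) (auto simp: val_append power_add algebra_simps)
    ultimately have "s \<in> final_fun A p" using accept[OF _ ws(2)] u(2) by metis
    thus ?thesis unfolding useful_iff using u(1) w by blast
  qed
  ultimately show ?thesis by (intro bexI[of _ q] image_subsetI)
qed

theorem saff_direction_eq:
  assumes "presburger_definable m X"
  shows "saff_direction m (rat_points X) = (\<Union>q\<in>set (useful tr Q q0 (finals A)). loop_space q)"
proof (rule presburger_semilinear[OF assms])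
  fix B K assume B: "finite B" "B \<subseteq> X"
    and K: "\<And>x. x \<in> B \<Longrightarrow> K x \<subseteq> carrier_vec m \<and> 0\<^sub>v m \<in> K x"
      "\<And>x u v. x \<in> B \<Longrightarrow> u \<in> K x \<Longrightarrow> v \<in> K x \<Longrightarrow> u + v \<in> K x"
    and sub: "\<And>x v. x \<in> B \<Longrightarrow> v \<in> K x \<Longrightarrow> x + v \<in> X"
    and cov: "\<And>y. y \<in> X \<Longrightarrow> \<exists>x\<in>B. y - x \<in> K x"
  let ?V = "\<lambda>x. span_Q m (rv ` K x)"
  have Kc: "rv ` K x \<subseteq> carrier_vec m" if "x \<in> B" for x using K(1)[OF that] by auto
  have Bc: "rv x \<in> carrier_vec m" if "x \<in> B" for x using that B(2) X by auto
  have eq: "rat_points X \<subseteq> \<Union> ((\<lambda>x. coset (rv x) (?V x)) ` B)" "saff_direction m (rat_points X) = (\<Union>x\<in>B. ?V x)"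
    by (rule saff_direction_semilinear(1)[OF B X K sub cov] saff_direction_semilinear(2)[OF B X K sub cov]; assumption)+
  show ?thesis
    unfolding eq(2)
  proof (intro equalityI UN_least)
    fix x assume x: "x \<in> B"
    obtain P where P: "finite P" "P \<subseteq> rv ` K x" "rv ` K x \<subseteq> span_Q m P"
      using finite_spanning_subset[OF Kc[OF x]] by blast
    obtain P0 where P0: "finite P0" "P0 \<subseteq> K x" "P = rv ` P0" using finite_subset_image[OF P(1,2)] by blast
    have "\<exists>q\<in>set (useful tr Q q0 (finals A)). rv ` P0 \<subseteq> loop_space q"
      by (rule periods_in_loop_space[where x = x and K = "K x"]) (use x B(2) K sub P0 in auto)
    then obtain q where q: "q \<in> set (useful tr Q q0 (finals A))" "P \<subseteq> loop_space q" using P0(3) by blast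
    have s: "subspace_Q m (loop_space q)" unfolding loop_space_def by (rule subspace_span_Q[OF rvec_image_carrier])
    have "?V x \<subseteq> span_Q m P" using P Kc[OF x] by (intro span_Q_minimal subspace_span_Q) auto
    also have "\<dots> \<subseteq> loop_space q" by (rule span_Q_minimal[OF s q(2)])
    finally show "?V x \<subseteq> (\<Union>q\<in>set (useful tr Q q0 (finals A)). loop_space q)" using q(1) by blast
  next
    fix q assume q: "q \<in> set (useful tr Q q0 (finals A))"
    have "\<exists>S\<in>(\<lambda>x. coset (rv x) (?V x)) ` B. loop_space q \<subseteq> direction S"
    proof (rule loop_space_subset[OF _ _ eq(1) q])
      show "affine_space m S" if "S \<in> (\<lambda>x. coset (rv x) (?V x)) ` B" for S
        using that affine_space_coset[OF Bc subspace_span_Q[OF Kc]] by (elim imageE) simp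
    qed (use B(1) in simp)
    then obtain x where x: "x \<in> B" "loop_space q \<subseteq> direction (coset (rv x) (?V x))" by (elim bexE imageE) simp
    thus "loop_space q \<subseteq> (\<Union>x\<in>B. ?V x)"
      using direction_coset[OF Bc[OF x(1)] subspace_span_Q[OF Kc[OF x(1)]]] by blast
  qed
qed

lemma algorithm_correct:
  assumes "presburger_definable m X"
  shows "union_of_subspaces_with_bases m
    (map (map (rvec m)) (algorithm r m (Q, q0, tr, finals A))) (saff_direction m (rat_points X))"
proof -
  have g: "span_Q m (rvec m ` set (gauss m m (generators r m tr Q q))) = loop_space q \<and>
      distinct (map (rvec m) (gauss m m (generators r m tr Q q))) \<and>
      lin_indpt_Q m (rvec m ` set (gauss m m (generators r m tr Q q)))" for q
    unfolding loop_space_def by (rule gauss_correct) auto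
  show ?thesis
    unfolding union_of_subspaces_with_bases_def algorithm_def saff_direction_eq[OF assms]
    using g by (auto simp: image_image)
qed

end

text \<open>The computed basis vectors have integer entries, and the normalized quotient of an
  integer \<open>k\<close> is the pair \<open>(k, 1)\<close>.\<close>

lemma encode_algorithm_output:
  assumes "\<And>L l. L \<in> set Ls \<Longrightarrow> l \<in> set L \<Longrightarrow> length l = m"
  shows "encode (map (map (map (\<lambda>k. (k, 1::int)))) Ls) = enc_bases (map (map (rvec m)) Ls)"
proof -
  have list: "encode (map f xs) = enc_list g (map h xs)" if "\<And>x. x \<in> set xs \<Longrightarrow> encode (f x) = g (h x)"
    for f :: "'c \<Rightarrow> 'd::encodable" and h :: "'c \<Rightarrow> 'e" and g xs
    using that by (induction xs) (auto simp: enc_list_def)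
  have rat: "encode (k, 1::int) = enc_rat (rat_of_int k)" for k
    by (simp add: enc_rat_def enc_pair_def encode_int_def)
  show ?thesis
    unfolding enc_bases_def
  proof (intro list)
    fix L l assume "L \<in> set Ls" "l \<in> set L"
    hence lv: "list_of_vec (rvec m l) = map rat_of_int l"
      using assms by (simp only: rvec_eq_vec_of_list list_vec)
    show "encode (map (\<lambda>k. (k, 1::int)) l) = enc_list enc_rat (list_of_vec (rvec m l))"
      unfolding lv by (rule list) (rule rat)
  qed
qed

theorem mainTheorem3:
  fixes r m :: nat
  assumes "r \<ge> 2" and "m \<ge> 1"
  shows "\<exists>(P :: program) (p :: nat poly). \<forall>(A :: fdva) (X :: int vec set).
    wf_fdva r m A \<and> X \<subseteq> carrier_vec m \<and> presburger_definable m X \<and> represents r m A X \<longrightarrow>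
    (\<exists>Bs t. computes_in_time P (enc_fdva A) (enc_bases Bs) t \<and>
            t \<le> poly p (fdva_size A) \<and>
            union_of_subspaces_with_bases m Bs (saff_direction m (rat_points X)))"
proof -
  obtain P p where P: "\<And>a. \<exists>t. computes_in_time P (encode a)
      (encode (map (map (map (\<lambda>k. (k, 1::int)))) (algorithm r m a))) t \<and> t \<le> poly p (esz a)"
    using fp_computes[OF fp_algorithm_output[of r m]] by metis
  show ?thesis
  proof (intro exI[of _ P] exI[of _ p] allI impI)
    fix A X
    assume *: "wf_fdva r m A \<and> X \<subseteq> carrier_vec m \<and> presburger_definable m X \<and> represents r m A X"
    interpret represented r m A X using * assms by unfold_locales auto
    let ?a = "(states A, start A, transitions A, finals A)"
    let ?Bs = "map (map (rvec m)) (algorithm r m ?a)"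
    \<comment> \<open>The nested tuple of the four fields has the same tree as the
      automaton.\<close>
    have enc: "encode ?a = enc_fdva A"
      by (simp add: enc_fdva_def encode_list_def encode_nat_def encode_prod_def enc_pair_def
          encode_list_def[abs_def] encode_prod_def[abs_def] encode_nat_def[abs_def])
    have "length l = m" if "L \<in> set (algorithm r m ?a)" "l \<in> set L" for L l
    proof -
      obtain q where "L = gauss m m (generators r m (transitions A) (states A) q)"
        using \<open>L \<in> _\<close> unfolding algorithm_def by auto
      hence l: "l \<in> set (gauss m m (generators r m (transitions A) (states A) q))" using \<open>l \<in> set L\<close> by simp
      show ?thesis by (rule gauss_length[OF _ l]) (auto simp: generators_def commutator_def)
    qed
    hence out: "encode (map (map (map (\<lambda>k. (k, 1::int)))) (algorithm r m ?a)) = enc_bases ?Bs"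
      by (rule encode_algorithm_output)
    obtain t where "computes_in_time P (enc_fdva A) (enc_bases ?Bs) t" "t \<le> poly p (fdva_size A)"
      using P[of ?a] unfolding out enc fdva_size_def by blast
    moreover have "union_of_subspaces_with_bases m ?Bs (saff_direction m (rat_points X))"
      using algorithm_correct * by blast
    ultimately show "\<exists>Bs t. computes_in_time P (enc_fdva A) (enc_bases Bs) t \<and> t \<le> poly p (fdva_size A) \<and>
        union_of_subspaces_with_bases m Bs (saff_direction m (rat_points X))" by blast
  qed
qed

end
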